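(* Let $(X,f)$ be a topological dynamical system with the approximate product property. Then every invariant measure $\mu\in\mathcal{M}(X,f)$ is almost entropy-approximable.
   Context: A topological dynamical system $(X,f)$ consists of a compact metric space $(X,d)$ and a continuous map $f:X\to X$. $\mathcal{M}(X,f)$ is the space of $f$-invariant Borel probability measures with the weak-$*$ topology; $h_\mu(f)$ is the metric (Kolmogorov–Sinai) entropy of $\mu\in\mathcal{M}(X,f)$. A subset $\Lambda\subset X$ is $f$-invariant if $f(\Lambda)\subset\Lambda$; for compact $f$-invariant $\Lambda$, $\mathcal{M}(\Lambda,f)$ is the set of invariant probability measures of $(\Lambda,f)$, regarded as a subset of $\mathcal{M}(X,f)$. Entropy at a scale: for $K\subset X$, $n\in\mathbb{Z}^+$, $\varepsilon>0$, a set $E\subset K$ is $(n,\varepsilon)$-separated if $\max_{0\le k\le n-1}d(f^k(x),f^k(y))>\varepsilon$ for all distinct $x,y\in E$; $s(K,n,\varepsilon)$ is the maximal cardinality of an $(n,\varepsilon)$-separated subset of $K$; $h(K,f,\varepsilon):=\limsup_{n\to\infty}\frac{\ln s(K,n,\varepsilon)}{n}$ and $h(K,f):=\lim_{\varepsilon\to0}h(K,f,\varepsilon)$. Approximate product property: for $n\in\mathbb{Z}^+$ and $\delta_1>0$, an increasing sequence $\{t_k\}_{k\in\mathbb{Z}^+}$ of nonnegative integers is $(n,\delta_1)$-spaced if $t_1=0$ and $n\le t_{k+1}-t_k<n(1+\delta_1)$ for every $k$. A sequence $\{x_k\}_{k\in\mathbb{Z}^+}$ in $X$ is $(n,\delta_1,\delta_2,\{t_k\},\varepsilon)$-traced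 by $z\in X$ if $\{t_k\}$ is $(n,\delta_1)$-spaced and $|\{j\in\{0,\dots,n-1\}: d(f^{t_k+j}(z),f^j(x_k))>\varepsilon\}|<\delta_2 n$ for every $k\in\mathbb{Z}^+$. $(X,f)$ has the approximate product property if for every $\delta_1,\delta_2,\varepsilon>0$ there is $M=M(\delta_1,\delta_2,\varepsilon)>0$ such that for every $n>M$ and every sequence $\mathscr{C}$ in $X$ there are an $(n,\delta_1)$-spaced sequence $\mathscr{G}$ and $z\in X$ such that $\mathscr{C}$ is $(n,\delta_1,\delta_2,\mathscr{G},\varepsilon)$-traced by $z$. Almost entropy-approximable: $\mu\in\mathcal{M}(X,f)$ is almost entropy-approximable if for every neighborhood $U$ of $\mu$, every $h\in(0,h_\mu(f))$ and every $\varepsilon,\beta>0$ there are a compact $f$-invariant set $\Lambda\subset X$ and $\gamma\in(0,\varepsilon)$ such that $\mathcal{M}(\Lambda,f)\subset U$, $h(\Lambda,f)>h$ and $h(\Lambda,f,\gamma)<h+\beta$. *)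

theory Defs
  imports "HOL-Probability.Probability"
begin

text \<open>
  A topological dynamical system \<open>(X, f)\<close> is a continuous map \<open>f :: 'a \<Rightarrow> 'a\<close> on a metric type whose
  universe \<open>X = UNIV\<close> is compact.  Compactness and continuity are hypotheses of the theorem; the
  definitions below only mention the structure they use.
\<close>

section \<open>Invariant measures\<close>

text \<open>For a closed \<open>K\<close> with \<open>f ` K \<subseteq> K\<close>, these are the invariant measures of the system \<open>(K, f)\<close>,
  living on the Borel \<open>\<sigma>\<close>-algebra of the subspace \<open>K\<close>.\<close>

definition invariant_measures_of :: "'a::topological_space set \<Rightarrow> ('a \<Rightarrow> 'a) \<Rightarrow> 'a measure set" where
  "invariant_measures_of K f =
     {\<nu>. prob_space \<nu> \<and> sets \<nu> = sets (restrict_space borel K) \<and> distr \<nu> \<nu> f = \<nu>}"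

definition invariant_measures :: "('a::topological_space \<Rightarrow> 'a) \<Rightarrow> 'a measure set" where
  "invariant_measures f = {\<mu>. prob_space \<mu> \<and> sets \<mu> = sets borel \<and> distr \<mu> \<mu> f = \<mu>}"

text \<open>\<open>\<M>(\<Lambda>, f)\<close> regarded as a subset of \<open>\<M>(X, f)\<close>: push forward along the inclusion.\<close>

definition invariant_measures_on :: "'a::topological_space set \<Rightarrow> ('a \<Rightarrow> 'a) \<Rightarrow> 'a measure set" where
  "invariant_measures_on \<Lambda> f = (\<lambda>\<nu>. distr \<nu> borel (\<lambda>x. x)) ` invariant_measures_of \<Lambda> f"

lemma invariant_measures_of_UNIV: "invariant_measures_of UNIV f = invariant_measures f"
  by (simp add: invariant_measures_of_def invariant_measures_def sets_restrict_UNIV)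

lemma invariant_measures_on_eq:
  fixes f :: "'a::topological_space \<Rightarrow> 'a"
  assumes f: "continuous_on UNIV f" and K: "closed K" and inv: "f ` K \<subseteq> K"
  shows "invariant_measures_on K f = {\<mu> \<in> invariant_measures f. emeasure \<mu> K = 1}"
proof (intro equalityI subsetI)
  have Kb: "K \<in> sets borel" using K by (rule borel_closed)
  have fb: "f \<in> borel_measurable borel" using f by (rule borel_measurable_continuous_onI)
  {
    fix \<mu> assume "\<mu> \<in> invariant_measures_on K f"
    then obtain \<nu> where \<mu>: "\<mu> = distr \<nu> borel (\<lambda>x. x)" and ps: "prob_space \<nu>"
      and s: "sets \<nu> = sets (restrict_space borel K)" and d: "distr \<nu> \<nu> f = \<nu>"
      by (auto simp: invariant_measures_on_def invariant_measures_of_def)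
    have sp: "space \<nu> = K" using sets_eq_imp_space_eq[OF s] by (simp add: space_restrict_space)
    have idm: "(\<lambda>x. x) \<in> measurable \<nu> borel"
      unfolding measurable_cong_sets[OF s refl] by (rule measurable_restrict_space1) simp
    have fm: "f \<in> measurable \<nu> \<nu>"
    proof -
      have "f \<in> measurable (restrict_space borel K) (restrict_space borel K)"
        by (rule measurable_restrict_space3[OF fb]) (use inv in auto)
      thus ?thesis using measurable_cong_sets[OF s s] by simp
    qed
    have mm: "f \<in> measurable \<mu> \<mu>" using fb by (simp add: \<mu> cong: measurable_cong_sets)
    have "distr \<mu> \<mu> f = distr \<nu> borel f"
      unfolding \<mu> by (subst distr_distr) (use fb idm in \<open>auto simp: comp_def cong: distr_cong\<close>)
    also have "\<dots> = distr (distr \<nu> \<nu> f) borel (\<lambda>x. x)"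
      by (subst distr_distr) (use fm idm in \<open>auto simp: comp_def\<close>)
    also have "\<dots> = \<mu>" by (simp add: d \<mu>)
    finally have "distr \<mu> \<mu> f = \<mu>" .
    moreover have "prob_space \<mu>" unfolding \<mu> by (rule prob_space.prob_space_distr[OF ps idm])
    moreover have "emeasure \<mu> K = 1"
      using prob_space.emeasure_space_1[OF ps]
      by (simp add: \<mu> emeasure_distr[OF idm Kb] sp)
    ultimately show "\<mu> \<in> {\<mu> \<in> invariant_measures f. emeasure \<mu> K = 1}"
      by (simp add: invariant_measures_def \<mu>)
  next
    fix \<mu> assume "\<mu> \<in> {\<mu> \<in> invariant_measures f. emeasure \<mu> K = 1}"
    then have ps: "prob_space \<mu>" and s: "sets \<mu> = sets borel" and d: "distr \<mu> \<mu> f = \<mu>"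
      and e: "emeasure \<mu> K = 1" by (auto simp: invariant_measures_def)
    interpret prob_space \<mu> by (rule ps)
    have Km: "K \<in> sets \<mu>" using Kb s by simp
    have spm: "space \<mu> = UNIV" using sets_eq_imp_space_eq[OF s] by simp
    have fm: "f \<in> measurable \<mu> \<mu>" using fb measurable_cong_sets[OF s s] by simp
    define \<nu> where "\<nu> = restrict_space \<mu> K"
    have sn: "sets \<nu> = sets (restrict_space borel K)"
      by (simp add: \<nu>_def sets_restrict_space s)
    have spn: "space \<nu> = K" by (simp add: \<nu>_def space_restrict_space spm)
    have emn: "emeasure \<nu> A = emeasure \<mu> A" if "A \<in> sets \<nu>" for A
      using that Km spm
      by (auto simp: \<nu>_def emeasure_restrict_space sets_restrict_space_iff)
    have fn: "f \<in> measurable \<nu> \<nu>"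
      unfolding \<nu>_def by (rule measurable_restrict_space3[OF fm]) (use inv in auto)
    have idm: "(\<lambda>x. x) \<in> measurable \<nu> borel"
      unfolding measurable_cong_sets[OF sn refl] by (rule measurable_restrict_space1) simp
    have AE: "AE x in \<mu>. x \<in> K"
      using e Km by (simp add: AE_in_set_eq_1 emeasure_eq_measure)
    have em_int: "emeasure \<mu> (A \<inter> K) = emeasure \<mu> A" if A: "A \<in> sets \<mu>" for A
      by (rule emeasure_eq_AE) (use AE A Km in auto)
    have "prob_space \<nu>"
      by (rule prob_spaceI) (use e emn[of K] spn sets.top[of \<nu>] in simp)
    moreover have "distr \<nu> \<nu> f = \<nu>"
    proof (rule measure_eqI)
      fix A assume "A \<in> sets (distr \<nu> \<nu> f)"
      then have A: "A \<in> sets \<nu>" by simp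
      then have Am: "A \<in> sets \<mu>" using Km by (auto simp: \<nu>_def sets_restrict_space_iff spm)
      have vim: "f -` A \<in> sets \<mu>" using measurable_sets[OF fm Am] spm by simp
      have "emeasure (distr \<nu> \<nu> f) A = emeasure \<nu> (f -` A \<inter> K)"
        using emeasure_distr[OF fn A] spn by simp
      also have "\<dots> = emeasure \<mu> (f -` A \<inter> K)"
        using measurable_sets[OF fn A] spn by (intro emn) simp
      also have "\<dots> = emeasure \<mu> (f -` A)" by (rule em_int[OF vim])
      also have "\<dots> = emeasure \<mu> A"
        using emeasure_distr[OF fm Am] d spm by simp
      finally show "emeasure (distr \<nu> \<nu> f) A = emeasure \<nu> A" using emn[OF A] by simp
    qed simp
    moreover have "\<mu> = distr \<nu> borel (\<lambda>x. x)"
    proof (rule measure_eqI)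
      fix A assume A: "A \<in> sets \<mu>"
      have "emeasure (distr \<nu> borel (\<lambda>x. x)) A = emeasure \<nu> (A \<inter> K)"
        using emeasure_distr[OF idm] A s spn by simp
      also have "\<dots> = emeasure \<mu> (A \<inter> K)"
        by (rule emn) (use A Km spm in \<open>auto simp: \<nu>_def sets_restrict_space_iff\<close>)
      finally show "emeasure \<mu> A = emeasure (distr \<nu> borel (\<lambda>x. x)) A" using em_int[OF A] by simp
    qed (simp add: s)
    ultimately show "\<mu> \<in> invariant_measures_on K f"
      unfolding invariant_measures_on_def invariant_measures_of_def using sn by blast
  }
qed

text \<open>The coarsest topology on \<open>\<M>(X, f)\<close> making \<open>\<mu> \<mapsto> \<integral> \<phi> d\<mu>\<close> continuous for all continuous \<open>\<phi>\<close>.\<close>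

definition weak_star_topology :: "('a::topological_space \<Rightarrow> 'a) \<Rightarrow> 'a measure topology" where
  "weak_star_topology f = topology_generated_by
     {{\<mu> \<in> invariant_measures f. (\<integral>x. \<phi> x \<partial>\<mu>) \<in> V} | \<phi> V.
        continuous_on UNIV (\<phi> :: 'a \<Rightarrow> real) \<and> open V}"

lemma topspace_weak_star_topology: "topspace (weak_star_topology f) = invariant_measures f"
proof -
  have "continuous_on UNIV (\<lambda>x::'a. 0::real)" by simp
  then show ?thesis
    unfolding weak_star_topology_def topology_generated_by_topspace by blast
qed

section \<open>Metric entropy\<close>

text \<open>\<open>ln 0 = 0\<close>, so null cells contribute \<open>0\<close>.\<close>

definition partition_entropy :: "'a measure \<Rightarrow> 'a set set \<Rightarrow> real" where
  "partition_entropy \<mu> P = - (\<Sum>A\<in>P. measure \<mu> A * ln (measure \<mu> A))"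

text \<open>The join of the partitions \<open>f\<^sup>-\<^sup>i P\<close> for \<open>i < n\<close>.  The empty set may occur as a cell, which
  does not affect the entropy.\<close>

definition dynamical_join :: "('a \<Rightarrow> 'a) \<Rightarrow> 'a set set \<Rightarrow> nat \<Rightarrow> 'a set set" where
  "dynamical_join f P n = {(\<Inter>i<n. (f ^^ i) -` c i) | c. \<forall>i<n. c i \<in> P}"

definition metric_entropy_partition :: "'a measure \<Rightarrow> ('a \<Rightarrow> 'a) \<Rightarrow> 'a set set \<Rightarrow> ereal" where
  "metric_entropy_partition \<mu> f P =
     lim (\<lambda>n. ereal (partition_entropy \<mu> (dynamical_join f P n) / real n))"

definition metric_entropy :: "'a measure \<Rightarrow> ('a \<Rightarrow> 'a) \<Rightarrow> ereal" where
  "metric_entropy \<mu> f =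
     (SUP P\<in>{P. finite P \<and> P \<subseteq> sets \<mu> \<and> partition_on (space \<mu>) P}. metric_entropy_partition \<mu> f P)"

section \<open>Topological entropy\<close>

definition separated_set :: "('a::metric_space \<Rightarrow> 'a) \<Rightarrow> nat \<Rightarrow> real \<Rightarrow> 'a set \<Rightarrow> bool" where
  "separated_set f n \<epsilon> E \<longleftrightarrow>
     (\<forall>x\<in>E. \<forall>y\<in>E. x \<noteq> y \<longrightarrow> (MAX k\<in>{..<n}. dist ((f ^^ k) x) ((f ^^ k) y)) > \<epsilon>)"

text \<open>For continuous \<open>f\<close> on a compact space, \<open>\<epsilon> > 0\<close> and \<open>n \<ge> 1\<close>, separated sets are finite with
  uniformly bounded cardinality, so that the maximum exists.\<close>

definition max_separated :: "'a::metric_space set \<Rightarrow> ('a \<Rightarrow> 'a) \<Rightarrow> nat \<Rightarrow> real \<Rightarrow> nat" where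
  "max_separated K f n \<epsilon> = Max {card E | E. E \<subseteq> K \<and> separated_set f n \<epsilon> E}"

text \<open>As \<open>ln 0 = 0\<close>, the empty set gets entropy \<open>0\<close> rather than \<open>-\<infinity>\<close>.\<close>

definition entropy_at_scale :: "'a::metric_space set \<Rightarrow> ('a \<Rightarrow> 'a) \<Rightarrow> real \<Rightarrow> ereal" where
  "entropy_at_scale K f \<epsilon> = limsup (\<lambda>n. ereal (ln (real (max_separated K f n \<epsilon>)) / real n))"

definition topological_entropy :: "'a::metric_space set \<Rightarrow> ('a \<Rightarrow> 'a) \<Rightarrow> ereal" where
  "topological_entropy K f = Lim (at_right 0) (\<lambda>\<epsilon>. entropy_at_scale K f \<epsilon>)"

section \<open>Approximate product property\<close>

text \<open>Sequences are indexed from \<open>0\<close> instead of \<open>1\<close>.\<close>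

definition spaced :: "nat \<Rightarrow> real \<Rightarrow> (nat \<Rightarrow> nat) \<Rightarrow> bool" where
  "spaced n \<delta>\<^sub>1 t \<longleftrightarrow> strict_mono t \<and> t 0 = 0 \<and>
     (\<forall>k. n \<le> t (Suc k) - t k \<and> real (t (Suc k) - t k) < real n * (1 + \<delta>\<^sub>1))"

definition traced ::
  "('a::metric_space \<Rightarrow> 'a) \<Rightarrow> nat \<Rightarrow> real \<Rightarrow> real \<Rightarrow> (nat \<Rightarrow> nat) \<Rightarrow> real \<Rightarrow> (nat \<Rightarrow> 'a) \<Rightarrow> 'a \<Rightarrow> bool"
  where
  "traced f n \<delta>\<^sub>1 \<delta>\<^sub>2 t \<epsilon> x z \<longleftrightarrow> spaced n \<delta>\<^sub>1 t \<and>
     (\<forall>k. real (card {j\<in>{..<n}. dist ((f ^^ (t k + j)) z) ((f ^^ j) (x k)) > \<epsilon>}) < \<delta>\<^sub>2 * real n)"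

definition approximate_product_property :: "('a::metric_space \<Rightarrow> 'a) \<Rightarrow> bool" where
  "approximate_product_property f \<longleftrightarrow>
     (\<forall>\<delta>\<^sub>1>0. \<forall>\<delta>\<^sub>2>0. \<forall>\<epsilon>>0. \<exists>M::real. M > 0 \<and>
        (\<forall>n::nat. real n > M \<longrightarrow>
           (\<forall>x :: nat \<Rightarrow> 'a. \<exists>t z. spaced n \<delta>\<^sub>1 t \<and> traced f n \<delta>\<^sub>1 \<delta>\<^sub>2 t \<epsilon> x z)))"

section \<open>Almost entropy-approximable measures\<close>

text \<open>\<open>\<mu> \<in> T interior_of U\<close> says that \<open>U\<close> is a neighbourhood of \<open>\<mu>\<close>.\<close>

definition almost_entropy_approximable :: "('a::metric_space \<Rightarrow> 'a) \<Rightarrow> 'a measure \<Rightarrow> bool" where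
  "almost_entropy_approximable f \<mu> \<longleftrightarrow>
     (\<forall>U (h::real) \<epsilon> \<beta>.
        \<mu> \<in> weak_star_topology f interior_of U \<longrightarrow>
        0 < h \<longrightarrow> ereal h < metric_entropy \<mu> f \<longrightarrow> 0 < \<epsilon> \<longrightarrow> 0 < \<beta> \<longrightarrow>
        (\<exists>\<Lambda> \<gamma>. compact \<Lambda> \<and> f ` \<Lambda> \<subseteq> \<Lambda> \<and> 0 < \<gamma> \<and> \<gamma> < \<epsilon> \<and>
           invariant_measures_on \<Lambda> f \<subseteq> U \<and>
           topological_entropy \<Lambda> f > ereal h \<and>
           entropy_at_scale \<Lambda> f \<gamma> < ereal (h + \<beta>)))"

end

theory Submission
  imports Defs
begin

text \<open>
  No ergodic decomposition is needed. Fix a partition \<open>P\<close> whose entropy exceeds \<open>h\<close> and a large \<open>n\<close>. Sort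
  the points by the empirical means over \<open>n\<close> steps of finitely many test functions. The entropy of
  the \<open>n\<close>-th join of \<open>P\<close> is, up to \<open>o(n)\<close>, at most the \<open>\<mu>\<close>-average over the classes of the logarithm
  of the number of cells that meet the class, and Hamming balls of small radius contain few names, so
  every class contains that many points, up to a factor \<open>e\<^bsup>o(n)\<^esup>\<close>, whose orbit segments differ at a
  positive proportion of times. Concatenating \<open>N\<close> segments, with classes scheduled in proportion to
  their measure, gives words over which the test functions average to their \<open>\<mu>\<close>-integrals. Keep
  about \<open>e\<^bsup>nN(h + a/2)\<^esup>\<close> of these words and let \<open>\<Lambda>\<close> be the orbit closure of all points that trace
  sequences of kept words. Tracing errors and gaps are so rare that they change neither the averages
  nor the exponential orbit count by much, at any prescribed small scale, and words that differ at
  many times stay separated after tracing.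
\<close>

section \<open>Combinatorial preliminaries\<close>


text \<open>Tracing is lossy: in each block a fraction \<open>\<delta>\<^sub>2\<close> of the times,
  at unknown places, may be wrong, and gap lengths depend on the traced sequence. Words that differ
  at few times can thus have indistinguishable tracers, so the relevant distance is Hamming
  distance. The same losses enlarge the tracking set: at scale \<gamma> a lost time may cost the
  logarithm of the size of a \<gamma>-cover. This forces an order on the constants:
  \<open>\<zeta>\<close> and \<open>\<gamma>\<^sub>0\<close> come from the measure and a partition,
  \<gamma> from \<epsilon>, then the tracing scale \<open>e\<close>, then
  \<open>\<delta>\<^sub>1\<close> and \<open>\<delta>\<^sub>2\<close>, small in terms of the cover,
  and \<open>n\<close> last. Hence word selection must work for all large \<open>n\<close> with the
  same \<open>\<zeta>\<close> and \<open>\<gamma>\<^sub>0\<close>. A gap has at most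
  \<open>n\<close> possible lengths and costs only \<open>ln n / n\<close> per step. Words must be
  discarded because the upper bound counts words and \<mu> may carry more entropy than
  \<open>h + \<beta>\<close>. If \<mu> is not ergodic, the averages over single orbit segments may
  all be far from those of \<mu>, so only concatenations over several classes imitate it.\<close>

lemma hamming_ball_card_powr:
  fixes A :: "'b set" and \<theta> :: real
  assumes A: "finite A" and I: "finite I" and u: "\<And>i. i \<in> I \<Longrightarrow> u i \<in> A" and th: "0 < \<theta>" "\<theta> \<le> 1"
  shows "real (card {v \<in> PiE I (\<lambda>_. A). real (card {i\<in>I. v i \<noteq> u i}) \<le> r}) * \<theta> powr r
           \<le> (1 + real (card A) * \<theta>) ^ card I"
proof -
  define S where "S = {v \<in> PiE I (\<lambda>_. A). real (card {i\<in>I. v i \<noteq> u i}) \<le> r}"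
  have fP: "finite (PiE I (\<lambda>_. A))" using A I by (simp add: finite_PiE)
  \<comment> \<open>Weight every word by \<open>\<theta>\<close> to the power of its distance from \<open>u\<close>: the total weight factorises.\<close>
  have "real (card S) * \<theta> powr r = (\<Sum>v\<in>S. \<theta> powr r)" by simp
  also have "\<dots> \<le> (\<Sum>v\<in>S. \<Prod>i\<in>I. if v i \<noteq> u i then \<theta> else 1)"
  proof (rule sum_mono)
    fix v assume v: "v \<in> S"
    have "(\<Prod>i\<in>I. if v i \<noteq> u i then \<theta> else 1) = \<theta> ^ card {i\<in>I. v i \<noteq> u i}"
      by (simp add: prod.inter_filter[symmetric] I)
    also have "\<dots> = \<theta> powr real (card {i\<in>I. v i \<noteq> u i})"
      using th by (simp add: powr_realpow)
    also have "\<dots> \<ge> \<theta> powr r"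
      using v th by (intro powr_mono') (auto simp: S_def)
    finally show "\<theta> powr r \<le> (\<Prod>i\<in>I. if v i \<noteq> u i then \<theta> else 1)" .
  qed
  also have "\<dots> \<le> (\<Sum>v\<in>PiE I (\<lambda>_. A). \<Prod>i\<in>I. if v i \<noteq> u i then \<theta> else 1)"
    using th fP by (intro sum_mono2) (auto simp: S_def intro!: prod_nonneg)
  also have "\<dots> = (\<Prod>i\<in>I. \<Sum>a\<in>A. if a \<noteq> u i then \<theta> else 1)"
    using A I by (subst prod_sum_PiE) auto
  also have "\<dots> \<le> (\<Prod>i\<in>I. 1 + real (card A) * \<theta>)"
  proof (intro prod_mono conjI)
    fix i assume i: "i \<in> I"
    have "(\<Sum>a\<in>A. if a \<noteq> u i then \<theta> else 1) \<le> (\<Sum>a\<in>A. \<theta> + (if a = u i then 1 else 0))"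
      using th by (intro sum_mono) auto
    also have "\<dots> = 1 + real (card A) * \<theta>"
      using A u[OF i] by (simp add: sum.distrib)
    finally show "(\<Sum>a\<in>A. if a \<noteq> u i then \<theta> else 1) \<le> 1 + real (card A) * \<theta>" .
    show "0 \<le> (\<Sum>a\<in>A. if a \<noteq> u i then \<theta> else 1)" using th by (intro sum_nonneg) auto
  qed
  finally show ?thesis by (simp add: S_def)
qed

text \<open>The weight \<open>\<theta>\<close> makes each coordinate contribute a factor of at most
  \<open>exp (\<sigma> / 2)\<close>, and \<open>\<rho>\<close> makes
  \<open>\<theta> powr \<rho>\<close> equal to \<open>exp (- \<sigma> / 2)\<close>. Since
  \<open>\<rho>\<close> depends only on \<open>card A\<close> and \<open>\<sigma>\<close>, it can be
  fixed before the length of the words.\<close>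

lemma hamming_ball_card_exp:
  fixes A :: "'b set" and \<sigma> :: real
  assumes A: "finite A" and \<sigma>: "0 < \<sigma>"
  obtains \<rho> :: real where "0 < \<rho>"
    "\<And>(I :: 'i set) u. finite I \<Longrightarrow> (\<And>i. i \<in> I \<Longrightarrow> u i \<in> A) \<Longrightarrow>
       real (card {v \<in> PiE I (\<lambda>_. A). real (card {i\<in>I. v i \<noteq> u i}) \<le> \<rho> * card I}) \<le> exp (\<sigma> * card I)"
proof -
  define \<theta> where "\<theta> = min (1/2) (\<sigma> / (2 * (real (card A) + 1)))"
  have th: "0 < \<theta>" "\<theta> < 1" using \<sigma> by (auto simp: \<theta>_def)
  have qth: "real (card A) * \<theta> \<le> \<sigma> / 2"
  proof -
    have "real (card A) * \<theta> \<le> real (card A) * (\<sigma> / (2 * (real (card A) + 1)))"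
      by (intro mult_left_mono) (auto simp: \<theta>_def)
    also have "\<dots> \<le> \<sigma> / 2" using \<sigma> by (simp add: field_simps)
    finally show ?thesis .
  qed
  define \<rho> where "\<rho> = \<sigma> / 2 / (- ln \<theta>)"
  have l: "- ln \<theta> > 0" using th by simp
  have rho: "\<rho> > 0" using \<sigma> l unfolding \<rho>_def by (intro divide_pos_pos) auto
  show ?thesis
  proof (rule that[OF rho])
    fix I :: "'i set" and u :: "'i \<Rightarrow> 'b"
    assume I: "finite I" and u: "\<And>i. i \<in> I \<Longrightarrow> u i \<in> A"
    define n where "n = real (card I)"
    define C where "C = real (card {v \<in> PiE I (\<lambda>_. A). real (card {i\<in>I. v i \<noteq> u i}) \<le> \<rho> * n})"
    have "C * \<theta> powr (\<rho> * n) \<le> (1 + real (card A) * \<theta>) ^ card I"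
      unfolding C_def using th u by (intro hamming_ball_card_powr A I) auto
    also have "\<dots> \<le> exp (\<sigma> / 2) ^ card I"
    proof (rule power_mono)
      show "1 + real (card A) * \<theta> \<le> exp (\<sigma> / 2)"
        using qth exp_ge_add_one_self[of "real (card A) * \<theta>"] by (smt (verit) exp_le_cancel_iff)
    qed (use th in auto)
    also have "\<dots> = exp (\<sigma> / 2 * n)" by (simp add: n_def exp_of_nat_mult[symmetric] mult.commute)
    finally have 1: "C * \<theta> powr (\<rho> * n) \<le> exp (\<sigma> / 2 * n)" .
    have "\<theta> powr (\<rho> * n) = exp (- (\<sigma> / 2 * n))"
      using th l by (simp add: powr_def \<rho>_def field_simps)
    with 1 have "C * exp (- (\<sigma> / 2 * n)) * exp (\<sigma> / 2 * n) \<le> exp (\<sigma> / 2 * n) * exp (\<sigma> / 2 * n)"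
      by (intro mult_right_mono) auto
    also have "C * exp (- (\<sigma> / 2 * n)) * exp (\<sigma> / 2 * n) = C" by (simp add: exp_minus)
    also have "exp (\<sigma> / 2 * n) * exp (\<sigma> / 2 * n) = exp (\<sigma> * n)" by (simp add: exp_add[symmetric])
    finally show "real (card {v \<in> PiE I (\<lambda>_. A). real (card {i\<in>I. v i \<noteq> u i}) \<le> \<rho> * card I}) \<le> exp (\<sigma> * card I)"
      by (simp add: C_def n_def)
  qed
qed

text \<open>The greedy bound of Gilbert and Varshamov: the \<open>R\<close>-balls around a maximal
  \<open>R\<close>-free subset cover \<open>Y\<close>, since a point outside all of them could be
  added.\<close>

lemma separated_subset_of_ball_bound:
  fixes b :: real
  assumes Y: "finite Y" and sym: "symp R" and refl: "reflp R" and b: "\<And>y. y \<in> Y \<Longrightarrow> real (card {x\<in>Y. R x y}) \<le> b"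
  shows "\<exists>E\<subseteq>Y. (\<forall>x\<in>E. \<forall>y\<in>E. x \<noteq> y \<longrightarrow> \<not> R x y) \<and> real (card Y) \<le> card E * b"
proof -
  define F where "F = {E. E \<subseteq> Y \<and> (\<forall>x\<in>E. \<forall>y\<in>E. x \<noteq> y \<longrightarrow> \<not> R x y)}"
  have "finite F" unfolding F_def by (rule finite_subset[OF _ finite_Pow_iff[THEN iffD2, OF Y]]) auto
  moreover have "{} \<in> F" by (auto simp: F_def)
  ultimately obtain E where E: "E \<in> F" and mx: "\<And>E'. E' \<in> F \<Longrightarrow> E \<subseteq> E' \<Longrightarrow> E = E'"
    using finite_has_maximal[of F] by (metis empty_iff)
  have fE: "finite E" using E Y by (auto simp: F_def intro: finite_subset)
  have "Y \<subseteq> (\<Union>e\<in>E. {x\<in>Y. R x e})"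
  proof
    fix y assume y: "y \<in> Y"
    show "y \<in> (\<Union>e\<in>E. {x\<in>Y. R x e})"
    proof (rule ccontr)
      assume *: "y \<notin> (\<Union>e\<in>E. {x\<in>Y. R x e})"
      then have "\<forall>e\<in>E. \<not> R y e" using y by auto
      then have "insert y E \<in> F" using E y sym by (auto simp: F_def dest: sympD)
      then have "y \<in> E" using mx[of "insert y E"] by auto
      with * y refl show False by (auto dest: reflpD)
    qed
  qed
  then have "card Y \<le> card (\<Union>e\<in>E. {x\<in>Y. R x e})" using fE Y by (intro card_mono) auto
  also have "\<dots> \<le> (\<Sum>e\<in>E. card {x\<in>Y. R x e})" using fE by (rule card_UN_le)
  finally have "real (card Y) \<le> (\<Sum>e\<in>E. real (card {x\<in>Y. R x e}))" by (simp flip: of_nat_sum)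
  also have "\<dots> \<le> (\<Sum>e\<in>E. b)" using b E by (intro sum_mono) (auto simp: F_def)
  finally have "real (card Y) \<le> card E * b" by simp
  moreover have "E \<subseteq> Y" "\<forall>x\<in>E. \<forall>y\<in>E. x \<noteq> y \<longrightarrow> \<not> R x y" using E unfolding F_def by simp_all
  ultimately show ?thesis by (intro exI[of _ E]) simp
qed

text \<open>Turns a weighted average into a schedule: index \<open>i\<close> is used about
  \<open>N * w i\<close> times, and the slots left over by rounding down go to an arbitrary index.
  The error is bounded independently of \<open>N\<close>, so one \<open>N\<close> serves all
  functions in the finite set \<open>G\<close>.\<close>

lemma finite_average_approximation:
  fixes w :: "'i \<Rightarrow> real" and G :: "('i \<Rightarrow> real) set"
  assumes I: "finite I" "I \<noteq> {}" and w: "\<And>i. i \<in> I \<Longrightarrow> 0 \<le> w i" "(\<Sum>i\<in>I. w i) = 1"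
    and G: "finite G" and \<tau>: "0 < \<tau>"
  obtains N s where "(0::nat) < N" "\<And>j. j < N \<Longrightarrow> s j \<in> I"
    "\<And>g. g \<in> G \<Longrightarrow> \<bar>(\<Sum>j<N. g (s j)) - N * (\<Sum>i\<in>I. w i * g i)\<bar> < \<tau> * N"
proof -
  obtain i0 where i0: "i0 \<in> I" using I by auto
  define B where "B = 1 + (\<Sum>g\<in>G. \<Sum>i\<in>I. \<bar>g i\<bar>)"
  have B1: "B \<ge> 1" by (auto simp: B_def intro!: sum_nonneg)
  have B: "\<bar>g i\<bar> \<le> B" if "g \<in> G" "i \<in> I" for g i
  proof -
    have "\<bar>g i\<bar> \<le> (\<Sum>i\<in>I. \<bar>g i\<bar>)" using that I by (intro member_le_sum) auto
    also have "\<dots> \<le> (\<Sum>g\<in>G. \<Sum>i\<in>I. \<bar>g i\<bar>)"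
      using that G by (intro member_le_sum[of g G "\<lambda>g. \<Sum>i\<in>I. \<bar>g i\<bar>"]) (auto intro: sum_nonneg)
    finally show ?thesis by (simp add: B_def)
  qed
  \<comment> \<open>Rounding changes each multiplicity by at most 1 and leaves at most
    \<open>card I\<close> spare slots; each of the two effects costs at most
    \<open>card I * B\<close>.\<close>
  obtain N :: nat where N: "2 * real (card I) * B / \<tau> < real N" using reals_Archimedean2 by blast
  have "0 \<le> 2 * real (card I) * B / \<tau>" using B1 \<tau> by simp
  then have N0: "0 < N" using N by (metis gr0I of_nat_0 not_less)
  have N': "2 * real (card I) * B < \<tau> * N" using N \<tau> by (simp add: field_simps)
  define p where "p i = nat \<lfloor>N * w i\<rfloor>" for i
  have p: "real (p i) \<le> N * w i" "N * w i < real (p i) + 1" if "i \<in> I" for i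
    using w(1)[OF that] by (auto simp: p_def)
  have sp: "real (\<Sum>i\<in>I. p i) \<le> N"
  proof -
    have "real (\<Sum>i\<in>I. p i) \<le> (\<Sum>i\<in>I. N * w i)" unfolding of_nat_sum using p by (intro sum_mono) auto
    then show ?thesis using w(2) by (simp add: sum_distrib_left[symmetric])
  qed
  define r where "r = N - (\<Sum>i\<in>I. p i)"
  have rN: "(\<Sum>i\<in>I. p i) + r = N" using sp unfolding r_def of_nat_le_iff by (rule le_add_diff_inverse)
  have r: "real r \<le> card I"
  proof -
    have "real N = (\<Sum>i\<in>I. N * w i)" using w(2) by (simp add: sum_distrib_left[symmetric])
    also have "\<dots> \<le> (\<Sum>i\<in>I. real (p i) + 1)" using p(2) by (intro sum_mono) (auto intro: less_imp_le)
    also have "\<dots> = real (\<Sum>i\<in>I. p i) + card I" by (simp add: sum.distrib)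
    finally show ?thesis using rN by (metis add_le_cancel_left of_nat_add)
  qed
  \<comment> \<open>Only multiplicities matter, so the schedule is any enumeration of this
    multiset.\<close>
  define M where "M = (\<Sum>i\<in>I. replicate_mset (p i) i) + replicate_mset r i0"
  obtain xs where xs: "mset xs = M" using ex_mset by blast
  have "size M = N" using rN by (simp add: M_def size_multiset_sum)
  then have len: "length xs = N" using xs by (metis size_mset)
  have sM: "set_mset M \<subseteq> I" using I(1) i0 by (auto simp: M_def set_mset_sum)
  have sum: "(\<Sum>j<N. g (xs ! j)) = (\<Sum>i\<in>I. real (p i) * g i) + r * g i0" for g :: "'i \<Rightarrow> real"
  proof -
    have "(\<Sum>j<N. g (xs ! j)) = sum_list (map g xs)" using len by (simp add: sum_list_sum_nth atLeast0LessThan)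
    also have "\<dots> = sum_mset (image_mset g M)" by (metis xs mset_map sum_mset_sum_list)
    also have "image_mset g M = (\<Sum>i\<in>I. replicate_mset (p i) (g i)) + replicate_mset r (g i0)"
      unfolding M_def by (induction I rule: infinite_finite_induct) auto
    also have "sum_mset \<dots> = (\<Sum>i\<in>I. real (p i) * g i) + r * g i0"
      by (induction I rule: infinite_finite_induct) auto
    finally show ?thesis .
  qed
  show ?thesis
  proof (rule that[OF N0, of "\<lambda>j. xs ! j"])
    show "xs ! j \<in> I" if "j < N" for j using that len sM xs by (metis nth_mem set_mset_mset subsetD)
    fix g assume g: "g \<in> G"
    have "(\<Sum>j<N. g (xs ! j)) - N * (\<Sum>i\<in>I. w i * g i)
       = (\<Sum>i\<in>I. (real (p i) - N * w i) * g i) + r * g i0"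
      unfolding sum by (simp add: sum_distrib_left left_diff_distrib sum_subtractf mult.assoc)
    also have "\<bar>\<dots>\<bar> \<le> (\<Sum>i\<in>I. \<bar>real (p i) - N * w i\<bar> * \<bar>g i\<bar>) + r * \<bar>g i0\<bar>"
      by (rule order_trans[OF abs_triangle_ineq]) (auto simp: abs_mult intro!: add_mono order_trans[OF sum_abs])
    also have "\<dots> \<le> (\<Sum>i\<in>I. 1 * B) + card I * B"
    proof -
      have "\<bar>real (p i) - N * w i\<bar> \<le> 1" if "i \<in> I" for i using p[OF that] by linarith
      then show ?thesis using B[OF g] r i0 by (intro add_mono sum_mono mult_mono) auto
    qed
    also have "\<dots> < \<tau> * N" using N' by (simp add: mult_ac)
    finally show "\<bar>(\<Sum>j<N. g (xs ! j)) - N * (\<Sum>i\<in>I. w i * g i)\<bar> < \<tau> * N" .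
  qed
qed

section \<open>Topological entropy\<close>


text \<open>Replaces points by symbols: \<open>\<iota>\<close> picks a nearby ball centre, so that
  equal symbols force closeness. Orbit counts from above go through such codings.\<close>

lemma compact_finite_small_cover:
  assumes "compact (UNIV :: 'a::metric_space set)" and \<epsilon>: "0 < \<epsilon>"
  obtains D :: "'a::metric_space set" and \<iota> :: "'a::metric_space \<Rightarrow> 'a" where "finite D" "\<And>x. \<iota> x \<in> D" "\<And>x y. \<iota> x = \<iota> y \<Longrightarrow> dist x y \<le> \<epsilon>"
proof -
  obtain k :: "'a set" where k: "finite k" "UNIV \<subseteq> (\<Union>x\<in>k. ball x (\<epsilon>/2))"
    using assms(1) unfolding compact_eq_totally_bounded using half_gt_zero[OF \<epsilon>] by blast
  then have "\<forall>x. \<exists>c\<in>k. dist c x < \<epsilon> / 2" unfolding subset_iff UN_iff mem_ball by blast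
  then obtain \<iota> where \<iota>: "\<And>x. \<iota> x \<in> k" "\<And>x. dist (\<iota> x) x < \<epsilon> / 2" by metis
  show ?thesis
  proof (rule that[OF k(1) \<iota>(1)])
    fix x y assume "\<iota> x = \<iota> y"
    then show "dist x y \<le> \<epsilon>" using \<iota>(2)[of x] \<iota>(2)[of y] dist_triangle3[of x y "\<iota> x"] by simp
  qed
qed

lemma MAX_gt_iff:
  fixes g :: "nat \<Rightarrow> real"
  assumes "0 < n"
  shows "(MAX k\<in>{..<n}. g k) > \<epsilon> \<longleftrightarrow> (\<exists>k<n. g k > \<epsilon>)"
  using assms by (subst Max_gr_iff) auto

lemma separated_set_iff:
  assumes "0 < n"
  shows "separated_set f n \<epsilon> E \<longleftrightarrow>
    (\<forall>x\<in>E. \<forall>y\<in>E. x \<noteq> y \<longrightarrow> (\<exists>k<n. dist ((f ^^ k) x) ((f ^^ k) y) > \<epsilon>))"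
  using assms by (simp add: separated_set_def MAX_gt_iff)

text \<open>Points of a separated set have different itineraries through a finite cover. Only with
  this finiteness is the \<open>Max\<close> in \<open>max_separated\<close> a true maximum.\<close>

lemma finite_separated_cards:
  fixes f :: "'a::metric_space \<Rightarrow> 'a"
  assumes cpt: "compact (UNIV :: 'a set)" and n: "0 < n" and \<epsilon>: "0 < \<epsilon>"
  shows "finite {card E | E. E \<subseteq> K \<and> separated_set f n \<epsilon> E}"
proof -
  obtain D :: "'a set" and \<iota> :: "'a \<Rightarrow> 'a" where D: "finite D" "\<And>x. \<iota> x \<in> D" "\<And>x y. \<iota> x = \<iota> y \<Longrightarrow> dist x y \<le> \<epsilon>"
    using compact_finite_small_cover[OF cpt \<epsilon>] by metis
  have fin: "finite (PiE {..<n} (\<lambda>_. D))" using D by (simp add: finite_PiE)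
  have "card E \<le> card (PiE {..<n} (\<lambda>_. D))" if E: "separated_set f n \<epsilon> E" for E
  proof (rule card_inj_on_le[OF _ _ fin])
    show "inj_on (\<lambda>x. restrict (\<lambda>k. \<iota> ((f ^^ k) x)) {..<n}) E"
    proof (rule inj_onI, rule ccontr)
      fix x y assume xy: "x \<in> E" "y \<in> E" "x \<noteq> y"
        and eq: "restrict (\<lambda>k. \<iota> ((f ^^ k) x)) {..<n} = restrict (\<lambda>k. \<iota> ((f ^^ k) y)) {..<n}"
      obtain k where k: "k < n" "dist ((f ^^ k) x) ((f ^^ k) y) > \<epsilon>"
        using E xy n by (auto simp: separated_set_iff)
      have "\<iota> ((f ^^ k) x) = \<iota> ((f ^^ k) y)" using fun_cong[OF eq, of k] k by simp
      from D(3)[OF this] k show False by simp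
    qed
    show "(\<lambda>x. restrict (\<lambda>k. \<iota> ((f ^^ k) x)) {..<n}) ` E \<subseteq> PiE {..<n} (\<lambda>_. D)"
      using D(2) by (intro image_subsetI restrict_PiE_iff[THEN iffD2]) auto
  qed
  then have "{card E | E. E \<subseteq> K \<and> separated_set f n \<epsilon> E} \<subseteq> {..card (PiE {..<n} (\<lambda>_. D))}" by auto
  then show ?thesis by (rule finite_subset) simp
qed

lemma card_le_max_separated:
  fixes f :: "'a::metric_space \<Rightarrow> 'a"
  assumes "compact (UNIV :: 'a set)" "0 < n" "0 < \<epsilon>" "E \<subseteq> K" "separated_set f n \<epsilon> E"
  shows "card E \<le> max_separated K f n \<epsilon>"
  unfolding max_separated_def using assms by (intro Max_ge finite_separated_cards) auto

lemma max_separated_attained: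
  fixes f :: "'a::metric_space \<Rightarrow> 'a"
  assumes "compact (UNIV :: 'a set)" "0 < n" "0 < \<epsilon>"
  obtains E where "E \<subseteq> K" "separated_set f n \<epsilon> E" "card E = max_separated K f n \<epsilon>"
proof -
  have "card {} \<in> {card E | E. E \<subseteq> K \<and> separated_set f n \<epsilon> E}"
    by (intro CollectI exI[of _ "{}"]) (auto simp: separated_set_def)
  then have "max_separated K f n \<epsilon> \<in> {card E | E. E \<subseteq> K \<and> separated_set f n \<epsilon> E}"
    unfolding max_separated_def using finite_separated_cards[OF assms] by (intro Max_in) auto
  then show ?thesis using that by auto
qed

lemma max_separated_antimono:
  fixes f :: "'a::metric_space \<Rightarrow> 'a"
  assumes "compact (UNIV :: 'a set)" "0 < n" "0 < \<epsilon>" "\<epsilon> \<le> \<epsilon>'"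
  shows "max_separated K f n \<epsilon>' \<le> max_separated K f n \<epsilon>"
proof -
  have e': "0 < \<epsilon>'" using assms by simp
  obtain E where E: "E \<subseteq> K" "separated_set f n \<epsilon>' E" "card E = max_separated K f n \<epsilon>'"
    using max_separated_attained[OF assms(1,2) e'] by metis
  have "separated_set f n \<epsilon> E"
    unfolding separated_set_iff[OF assms(2)]
  proof (intro ballI impI)
    fix x y assume "x \<in> E" "y \<in> E" "x \<noteq> y"
    then obtain k where "k < n" "dist ((f ^^ k) x) ((f ^^ k) y) > \<epsilon>'"
      using E(2) unfolding separated_set_iff[OF assms(2)] by blast
    then show "\<exists>k<n. dist ((f ^^ k) x) ((f ^^ k) y) > \<epsilon>" using assms(4) by force
  qed
  then show ?thesis using card_le_max_separated[OF assms(1-3) E(1)] E(3) by simp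
qed

lemma entropy_at_scale_antimono:
  fixes f :: "'a::metric_space \<Rightarrow> 'a"
  assumes "compact (UNIV :: 'a set)" "0 < \<epsilon>" "\<epsilon> \<le> \<epsilon>'"
  shows "entropy_at_scale K f \<epsilon>' \<le> entropy_at_scale K f \<epsilon>"
  unfolding entropy_at_scale_def
proof (rule Limsup_mono, rule eventually_mono[OF eventually_gt_at_top[of 0]])
  fix n :: nat assume n: "0 < n"
  have le: "max_separated K f n \<epsilon>' \<le> max_separated K f n \<epsilon>"
    by (rule max_separated_antimono[OF assms(1) n assms(2,3)])
  \<comment> \<open>The value 0 is treated apart: \<open>ln 0 = 0\<close> lies below the logarithm
    of any natural number, but outside the range where \<open>ln\<close> is monotone.\<close>
  have "ln (real (max_separated K f n \<epsilon>')) \<le> ln (real (max_separated K f n \<epsilon>))"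
  proof (cases "max_separated K f n \<epsilon>' = 0")
    case True
    then show ?thesis by (cases "max_separated K f n \<epsilon> = 0") auto
  next
    case False
    then show ?thesis using le by simp
  qed
  then show "ereal (ln (real (max_separated K f n \<epsilon>')) / real n) \<le> ereal (ln (real (max_separated K f n \<epsilon>)) / real n)"
    by (simp add: divide_right_mono)
qed

text \<open>\<open>Lim\<close> is meaningful only once the limit is known to exist. The entropy
  grows as the scale shrinks, so it tends to its supremum over all scales.\<close>

lemma entropy_at_scale_le_topological_entropy:
  fixes f :: "'a::metric_space \<Rightarrow> 'a"
  assumes cpt: "compact (UNIV :: 'a set)" and \<epsilon>: "0 < \<epsilon>"
  shows "entropy_at_scale K f \<epsilon> \<le> topological_entropy K f"
proof -
  define h where "h = entropy_at_scale K f"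
  define s where "s = (SUP e\<in>{0<..}. h e)"
  have "(h \<longlongrightarrow> s) (at_right 0)"
  proof (rule order_tendstoI)
    fix a assume "a < s"
    then obtain e where e: "0 < e" "a < h e" by (auto simp: s_def less_SUP_iff)
    show "\<forall>\<^sub>F x in at_right 0. a < h x"
      using eventually_at_right_less[of 0] order_tendstoD(2)[OF tendsto_ident_at e(1)]
    proof eventually_elim
      case (elim x)
      then show ?case using e entropy_at_scale_antimono[OF cpt, of x e K f] by (simp add: h_def)
    qed
  next
    fix a assume "s < a"
    show "\<forall>\<^sub>F x in at_right 0. h x < a"
      using eventually_at_right_less[of 0]
    proof eventually_elim
      case (elim x)
      then have "h x \<le> s" by (auto simp: s_def intro: SUP_upper)
      then show ?case using \<open>s < a\<close> by simp
    qed
  qed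
  then have "topological_entropy K f = s"
    unfolding topological_entropy_def h_def[symmetric]
    by (intro tendsto_Lim) (simp_all add: trivial_limit_at_right_real)
  then show ?thesis using \<epsilon> by (auto simp: s_def h_def intro: SUP_upper)
qed

lemma continuous_on_funpow:
  fixes f :: "'a::topological_space \<Rightarrow> 'a"
  assumes f: "continuous_on UNIV f"
  shows "continuous_on UNIV (f ^^ k)"
proof (induction k)
  case (Suc k)
  then show ?case
    using continuous_on_compose[OF Suc.IH continuous_on_subset[OF f subset_UNIV]] by simp
qed (simp add: id_def)

text \<open>Separation is a strict inequality at finitely many continuous iterates, so it survives
  small perturbations of finitely many points. It lets a count on a set bound the count on its
  closure; for the tracking set, the points added by the closure need not trace anything.\<close>

lemma separated_set_closure:
  fixes f :: "'a::metric_space \<Rightarrow> 'a"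
  assumes f: "continuous_on UNIV f" and n: "0 < n" and E: "finite E" "E \<subseteq> closure K" "separated_set f n \<epsilon> E"
  obtains E' where "finite E'" "E' \<subseteq> K" "separated_set f n \<epsilon> E'" "card E' = card E"
proof -
  note cont = continuous_on_funpow[OF f]
  have "\<forall>x\<in>E. \<exists>u. (\<forall>i. u i \<in> K) \<and> u \<longlonglongrightarrow> x" using E(2) by (meson closure_sequential subsetD)
  from bchoice[OF this] obtain u where u: "\<And>x i. x \<in> E \<Longrightarrow> u x i \<in> K" "\<And>x. x \<in> E \<Longrightarrow> u x \<longlonglongrightarrow> x" by blast
  have "\<forall>\<^sub>F i in sequentially. x \<noteq> y \<longrightarrow> (\<exists>k<n. dist ((f ^^ k) (u x i)) ((f ^^ k) (u y i)) > \<epsilon>)"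
    if xy: "x \<in> E" "y \<in> E" for x y
  proof (cases "x = y")
    case False
    then obtain k where k: "k < n" "dist ((f ^^ k) x) ((f ^^ k) y) > \<epsilon>"
      using E(3) xy n by (auto simp: separated_set_iff)
    have t: "(\<lambda>i. (f ^^ k) (u z i)) \<longlonglongrightarrow> (f ^^ k) z" if "z \<in> E" for z
      using continuous_on_tendsto_compose[OF cont[of k] u(2)[OF that]] by simp
    have "\<forall>\<^sub>F i in sequentially. dist ((f ^^ k) (u x i)) ((f ^^ k) (u y i)) > \<epsilon>"
      by (rule order_tendstoD(1)[OF tendsto_dist[OF t t] k(2)]) (use xy in auto)
    then show ?thesis by eventually_elim (use k in auto)
  qed auto
  then have "\<forall>\<^sub>F i in sequentially. \<forall>x\<in>E. \<forall>y\<in>E. x \<noteq> y \<longrightarrow> (\<exists>k<n. dist ((f ^^ k) (u x i)) ((f ^^ k) (u y i)) > \<epsilon>)"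
    using E(1) by (simp add: eventually_ball_finite_distrib)
  \<comment> \<open>For negative \<open>\<epsilon>\<close> separation would not keep the perturbed
    points apart, so distinctness is read off the limits.\<close>
  moreover have "\<forall>\<^sub>F i in sequentially. \<forall>x\<in>E. \<forall>y\<in>E. x \<noteq> y \<longrightarrow> u x i \<noteq> u y i"
  proof -
    have "\<forall>\<^sub>F i in sequentially. x \<noteq> y \<longrightarrow> u x i \<noteq> u y i" if xy: "x \<in> E" "y \<in> E" for x y
    proof (cases "x = y")
      case False
      then have "0 < dist x y" by simp
      from order_tendstoD(1)[OF tendsto_dist[OF u(2)[OF xy(1)] u(2)[OF xy(2)]] this]
      show ?thesis by eventually_elim auto
    qed auto
    then show ?thesis using E(1) by (simp add: eventually_ball_finite_distrib)
  qed
  ultimately have "\<forall>\<^sub>F i in sequentially. (\<forall>x\<in>E. \<forall>y\<in>E. x \<noteq> y \<longrightarrow> (\<exists>k<n. dist ((f ^^ k) (u x i)) ((f ^^ k) (u y i)) > \<epsilon>))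
       \<and> (\<forall>x\<in>E. \<forall>y\<in>E. x \<noteq> y \<longrightarrow> u x i \<noteq> u y i)" by (rule eventually_conj)
  then obtain i where i: "\<forall>x\<in>E. \<forall>y\<in>E. x \<noteq> y \<longrightarrow> (\<exists>k<n. dist ((f ^^ k) (u x i)) ((f ^^ k) (u y i)) > \<epsilon>)"
       "\<forall>x\<in>E. \<forall>y\<in>E. x \<noteq> y \<longrightarrow> u x i \<noteq> u y i"
    using eventually_happens'[OF sequentially_bot] by blast
  show ?thesis
  proof (rule that[of "(\<lambda>x. u x i) ` E"])
    show "separated_set f n \<epsilon> ((\<lambda>x. u x i) ` E)" using i(1) n by (auto simp: separated_set_iff)
    show "card ((\<lambda>x. u x i) ` E) = card E" using i(2) by (intro card_image) (auto simp: inj_on_def)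
  qed (use u E in auto)
qed

section \<open>Metric entropy\<close>


text \<open>Sums the inequality \<open>ln x \<le> x - 1\<close> at \<open>x = q i / p i\<close>.
  Because \<open>ln 0 = 0\<close>, an index with \<open>q i = 0 < p i\<close> would lose its
  infinite penalty; \<open>pq\<close> excludes this.\<close>

lemma gibbs_inequality:
  fixes p q :: "'i \<Rightarrow> real"
  assumes p: "\<And>i. i \<in> I \<Longrightarrow> 0 \<le> p i" "(\<Sum>i\<in>I. p i) = 1"
    and q: "\<And>i. i \<in> I \<Longrightarrow> 0 \<le> q i" "(\<Sum>i\<in>I. q i) \<le> 1"
    and pq: "\<And>i. i \<in> I \<Longrightarrow> 0 < p i \<Longrightarrow> 0 < q i"
  shows "- (\<Sum>i\<in>I. p i * ln (p i)) \<le> - (\<Sum>i\<in>I. p i * ln (q i))"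
proof -
  have "p i * ln (q i) - p i * ln (p i) \<le> q i - p i" if i: "i \<in> I" for i
  proof (cases "p i = 0")
    case False
    then have pos: "0 < p i" "0 < q i" using p(1)[OF i] pq[OF i] by auto
    then have "p i * ln (q i) - p i * ln (p i) = p i * ln (q i / p i)"
      by (simp add: ln_div right_diff_distrib)
    also have "\<dots> \<le> p i * (q i / p i - 1)" using pos by (intro mult_left_mono ln_le_minus_one) auto
    also have "\<dots> = q i - p i" using pos by (simp add: field_simps)
    finally show ?thesis .
  qed (use q(1)[OF i] in simp)
  then have "(\<Sum>i\<in>I. p i * ln (q i) - p i * ln (p i)) \<le> (\<Sum>i\<in>I. q i - p i)" by (rule sum_mono)
  then show ?thesis using p(2) q(2) by (simp add: sum_subtractf)
qed

lemma fekete_subadditive: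
  fixes a :: "nat \<Rightarrow> real"
  assumes sub: "\<And>m n. a (m + n) \<le> a m + a n" and nn: "\<And>n. 0 \<le> a n"
  obtains L where "(\<lambda>n. a n / n) \<longlonglongrightarrow> L"
proof -
  define L where "L = (INF n\<in>{1..}. a n / real n)"
  have bdd: "bdd_below ((\<lambda>n. a n / real n) ` {1..})" by (rule bdd_belowI[of _ 0]) (auto simp: nn)
  have mult: "a (q * m + r) \<le> q * a m + a r" for q m r
  proof (induction q)
    case (Suc q)
    have "a (Suc q * m + r) = a (m + (q * m + r))" by (simp add: algebra_simps)
    also have "\<dots> \<le> a m + (q * a m + a r)" using sub[of m "q * m + r"] Suc by simp
    finally show ?case by (simp add: algebra_simps)
  qed simp
  have "(\<lambda>n. a n / n) \<longlonglongrightarrow> L"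
  proof (rule order_tendstoI)
    fix b assume "b < L"
    have "L \<le> a n / n" if "n > 0" for n using that bdd unfolding L_def by (intro cINF_lower) auto
    then show "\<forall>\<^sub>F n in sequentially. b < a n / n"
      using \<open>b < L\<close> by (intro eventually_mono[OF eventually_gt_at_top[of 0]]) (auto intro: less_le_trans)
  next
    fix b assume "L < b"
    then obtain m where m: "m \<ge> 1" "a m / m < b"
      using cINF_less_iff[OF _ bdd] unfolding L_def by auto
    \<comment> \<open>A bound for every remainder \<open>a (n mod m)\<close>, washed out on division
      by \<open>n\<close>.\<close>
    define C where "C = (\<Sum>r<m. a r)"
    have "(\<lambda>n. a m / m + C / real n) \<longlonglongrightarrow> a m / m + 0"
      by (intro tendsto_intros lim_const_over_n)
    then have "\<forall>\<^sub>F n in sequentially. a m / m + C / real n < b" by (rule order_tendstoD) (use m in simp)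
    then show "\<forall>\<^sub>F n in sequentially. a n / n < b" using eventually_gt_at_top[of 0]
    proof eventually_elim
      case (elim n)
      have "a n \<le> real (n div m) * a m + a (n mod m)" using mult[of "n div m" m "n mod m"] by simp
      also have "a (n mod m) \<le> C" unfolding C_def using m nn by (intro member_le_sum) auto
      also have "real (n div m) * a m \<le> n / m * a m" by (intro mult_right_mono nn of_nat_div_le_of_nat)
      finally have "a n / n \<le> (n / m * a m + C) / n" using elim by (intro divide_right_mono) auto
      also have "\<dots> = a m / m + C / n" using elim by (simp add: add_divide_distrib)
      finally have "a n / n \<le> a m / m + C / n" .
      then show ?case using elim by simp
    qed
  qed
  then show ?thesis by (rule that)
qed

section \<open>Joins of a partition along orbits\<close>

lemma dynamical_join_image:
  "dynamical_join f P n = (\<lambda>c. \<Inter>i<n. (f ^^ i) -` c i) ` (PiE {..<n} (\<lambda>_. P))"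
proof (intro equalityI subsetI)
  fix A assume "A \<in> dynamical_join f P n"
  then obtain c where c: "A = (\<Inter>i<n. (f ^^ i) -` c i)" "\<forall>i<n. c i \<in> P" by (auto simp: dynamical_join_def)
  then show "A \<in> (\<lambda>c. \<Inter>i<n. (f ^^ i) -` c i) ` (PiE {..<n} (\<lambda>_. P))"
    by (intro image_eqI[of _ _ "restrict c {..<n}"]) auto
qed (auto simp: dynamical_join_def PiE_def)

lemma finite_dynamical_join: "finite P \<Longrightarrow> finite (dynamical_join f P n)"
  by (simp add: dynamical_join_image finite_PiE)

lemma card_dynamical_join_le: "finite P \<Longrightarrow> card (dynamical_join f P n) \<le> card P ^ n"
  unfolding dynamical_join_image
  by (rule order_trans[OF card_image_le]) (simp_all add: finite_PiE card_PiE)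

lemma disjoint_dynamical_join:
  assumes "disjoint P"
  shows "disjoint (dynamical_join f P n)"
proof (rule disjointI)
  fix A B assume A: "A \<in> dynamical_join f P n" and B: "B \<in> dynamical_join f P n" and "A \<noteq> B"
  obtain c where c: "A = (\<Inter>i<n. (f ^^ i) -` c i)" "\<forall>i<n. c i \<in> P" using A by (auto simp: dynamical_join_def)
  obtain d where d: "B = (\<Inter>i<n. (f ^^ i) -` d i)" "\<forall>i<n. d i \<in> P" using B by (auto simp: dynamical_join_def)
  show "A \<inter> B = {}"
  proof (rule ccontr)
    assume "A \<inter> B \<noteq> {}"
    then obtain x where x: "x \<in> A" "x \<in> B" by auto
    have "c i = d i" if "i < n" for i
      using disjointD[OF assms, of "c i" "d i"] that x c d by auto
    then have "A = B" using c d by auto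
    with \<open>A \<noteq> B\<close> show False by simp
  qed
qed

lemma Union_dynamical_join:
  assumes "\<Union>P = UNIV"
  shows "\<Union>(dynamical_join f P n) = UNIV"
proof -
  have "x \<in> \<Union>(dynamical_join f P n)" for x
  proof -
    have "\<forall>i. \<exists>C. (f ^^ i) x \<in> C \<and> C \<in> P" using assms by (metis UNIV_I UnionE)
    from choice[OF this] obtain c where c: "\<And>i. (f ^^ i) x \<in> c i" "\<And>i. c i \<in> P" by blast
    then have "(\<Inter>i<n. (f ^^ i) -` c i) \<in> dynamical_join f P n" by (auto simp: dynamical_join_def)
    then show ?thesis using c by (intro UnionI) auto
  qed
  then show ?thesis by blast
qed

text \<open>A name of length \<open>n + m\<close> is cut at time \<open>n\<close>; the second half
  names the orbit of \<open>f ^^ n\<close>. Subadditivity of the entropy rests on this.\<close>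

lemma dynamical_join_add:
  "dynamical_join f P (n + m) = (\<lambda>(A, B). A \<inter> (f ^^ n) -` B) ` (dynamical_join f P n \<times> dynamical_join f P m)"
proof (intro equalityI subsetI)
  fix C assume "C \<in> dynamical_join f P (n + m)"
  then obtain c where c: "C = (\<Inter>i<n+m. (f ^^ i) -` c i)" "\<forall>i<n+m. c i \<in> P" by (auto simp: dynamical_join_def)
  define A where "A = (\<Inter>i<n. (f ^^ i) -` c i)"
  define B where "B = (\<Inter>i<m. (f ^^ i) -` c (n + i))"
  have "A \<in> dynamical_join f P n" unfolding A_def dynamical_join_def using c(2) by auto
  moreover have "B \<in> dynamical_join f P m"
    unfolding B_def dynamical_join_def using c(2) by (intro CollectI exI[of _ "\<lambda>i. c (n + i)"]) auto
  moreover have "C = A \<inter> (f ^^ n) -` B"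
  proof (intro equalityI subsetI)
    fix x assume x: "x \<in> A \<inter> (f ^^ n) -` B"
    have "(f ^^ i) x \<in> c i" if i: "i < n + m" for i
    proof (cases "i < n")
      case False
      have "i - n < m" using False i by simp
      then have "(f ^^ (i - n)) ((f ^^ n) x) \<in> c (n + (i - n))" using x unfolding B_def by blast
      moreover have "(f ^^ (i - n)) ((f ^^ n) x) = (f ^^ i) x"
        using False funpow_add[of "i - n" n f] by simp
      ultimately show ?thesis using False by simp
    qed (use x in \<open>auto simp: A_def\<close>)
    then show "x \<in> C" using c by auto
  next
    fix x assume x: "x \<in> C"
    have "(f ^^ i) ((f ^^ n) x) \<in> c (n + i)" if "i < m" for i
    proof -
      have "(f ^^ (n + i)) x \<in> c (n + i)" using x c that by auto
      then show ?thesis by (simp add: add.commute[of n] funpow_add)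
    qed
    then show "x \<in> A \<inter> (f ^^ n) -` B" using x c by (auto simp: A_def B_def)
  qed
  ultimately show "C \<in> (\<lambda>(A, B). A \<inter> (f ^^ n) -` B) ` (dynamical_join f P n \<times> dynamical_join f P m)"
    by (intro image_eqI[of _ _ "(A, B)"]) auto
next
  fix C assume "C \<in> (\<lambda>(A, B). A \<inter> (f ^^ n) -` B) ` (dynamical_join f P n \<times> dynamical_join f P m)"
  then obtain c d where C: "C = (\<Inter>i<n. (f ^^ i) -` c i) \<inter> (f ^^ n) -` (\<Inter>i<m. (f ^^ i) -` d i)"
     and cd: "\<forall>i<n. c i \<in> P" "\<forall>i<m. d i \<in> P" by (auto simp: dynamical_join_def)
  define e where "e i = (if i < n then c i else d (i - n))" for i
  have "C = (\<Inter>i<n+m. (f ^^ i) -` e i)"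
  proof (intro equalityI subsetI)
    fix x assume x: "x \<in> C"
    have "(f ^^ i) x \<in> e i" if i: "i < n + m" for i
    proof (cases "i < n")
      case False
      have "(f ^^ (i - n)) ((f ^^ n) x) \<in> d (i - n)" using x False i C by auto
      moreover have "(f ^^ (i - n)) ((f ^^ n) x) = (f ^^ i) x"
        using False funpow_add[of "i - n" n f] by simp
      ultimately show ?thesis using False by (simp add: e_def)
    qed (use x C in \<open>auto simp: e_def\<close>)
    then show "x \<in> (\<Inter>i<n+m. (f ^^ i) -` e i)" by auto
  next
    fix x assume x: "x \<in> (\<Inter>i<n+m. (f ^^ i) -` e i)"
    have 1: "(f ^^ i) x \<in> c i" if "i < n" for i
    proof -
      have "(f ^^ i) x \<in> e i" using x that by auto
      then show ?thesis using that by (simp add: e_def)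
    qed
    have 2: "(f ^^ i) ((f ^^ n) x) \<in> d i" if "i < m" for i
    proof -
      have "(f ^^ (n + i)) x \<in> e (n + i)" using x that by auto
      then show ?thesis by (simp add: e_def add.commute[of n] funpow_add)
    qed
    show "x \<in> C" using 1 2 by (auto simp: C)
  qed
  moreover have "\<forall>i<n+m. e i \<in> P" using cd by (auto simp: e_def)
  ultimately show "C \<in> dynamical_join f P (n + m)" by (auto simp: dynamical_join_def)
qed

lemma measurable_dynamical_join:
  assumes f: "f \<in> measurable M M" and sp: "space M = UNIV" and P: "P \<subseteq> sets M"
  shows "dynamical_join f P n \<subseteq> sets M"
proof
  fix A assume "A \<in> dynamical_join f P n"
  then obtain c where c: "A = (\<Inter>i<n. (f ^^ i) -` c i)" "\<forall>i<n. c i \<in> P" by (auto simp: dynamical_join_def)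
  have "(f ^^ i) -` c i \<in> sets M" if "i < n" for i
    using measurable_sets[OF measurable_compose_n[OF f], of "c i" i] P c that sp by auto
  \<comment> \<open>For \<open>n = 0\<close> the only cell is the empty intersection
    \<open>UNIV\<close>, measurable because it is the whole space.\<close>
  then show "A \<in> sets M" unfolding c using sp
    by (cases "n = 0") (auto intro!: sets.finite_INT simp: lessThan_empty_iff sets.top[of M, unfolded sp])
qed

section \<open>Entropy of a measure-preserving map\<close>

locale measure_preserving_map = prob_space M for M :: "'a measure" +
  fixes f :: "'a \<Rightarrow> 'a"
  assumes f_measurable: "f \<in> measurable M M" and space_UNIV: "space M = UNIV" and distr_f: "distr M M f = M"
begin

lemma funpow_measurable: "f ^^ n \<in> measurable M M"
  by (rule measurable_compose_n[OF f_measurable])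

lemma distr_funpow: "distr M M (f ^^ n) = M"
proof (induction n)
  case 0
  show ?case using distr_id by (simp add: id_def)
next
  case (Suc n)
  have "distr M M (f ^^ Suc n) = distr (distr M M (f ^^ n)) M f"
    by (subst distr_distr) (use f_measurable funpow_measurable in simp_all)
  then show ?case by (simp add: Suc distr_f comp_def)
qed

lemma measure_vimage_funpow: "A \<in> sets M \<Longrightarrow> measure M ((f ^^ n) -` A) = measure M A"
  using measure_distr[OF funpow_measurable, of A n] by (simp add: distr_funpow space_UNIV)

lemma partition_entropy_nonneg: "0 \<le> partition_entropy M P"
proof -
  have "measure M A * ln (measure M A) \<le> 0" for A
    by (cases "measure M A = 0") (auto intro!: mult_nonneg_nonpos simp: zero_less_measure_iff)
  then show ?thesis unfolding partition_entropy_def by (simp add: sum_nonpos)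
qed

text \<open>Gibbs' inequality against the product weights \<open>q\<close>, whose logarithm splits
  into the two marginals. The second marginal is the measure of a preimage under
  \<open>f ^^ n\<close>; there invariance enters.\<close>

lemma partition_entropy_join_subadditive:
  assumes P: "finite P" "P \<subseteq> sets M" "disjoint P" "\<Union>P = UNIV"
  shows "partition_entropy M (dynamical_join f P (n + m))
     \<le> partition_entropy M (dynamical_join f P n) + partition_entropy M (dynamical_join f P m)"
proof -
  define J where "J = dynamical_join f P"
  have fin: "finite (J k)" and disj: "disjoint (J k)" and U: "\<Union>(J k) = UNIV" and sets: "J k \<subseteq> sets M" for k
    using P by (auto simp: J_def finite_dynamical_join disjoint_dynamical_join Union_dynamical_join
      dest: subsetD[OF measurable_dynamical_join[OF f_measurable space_UNIV]])
  define p where "p AB = measure M (fst AB \<inter> (f ^^ n) -` snd AB)" for AB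
  define q where "q AB = measure M (fst AB) * measure M (snd AB)" for AB
  have vs: "(f ^^ n) -` B \<in> sets M" if "B \<in> sets M" for B
    using measurable_sets[OF funpow_measurable that] by (simp add: space_UNIV)
  have sum1: "(\<Sum>A\<in>J k. measure M (A \<inter> B)) = measure M B" if B: "B \<in> sets M" for k B
  proof -
    have "(\<Sum>A\<in>J k. measure M (A \<inter> B)) = measure M (\<Union>A\<in>J k. A \<inter> B)"
      using fin disj sets[of k] B
      by (intro finite_measure_finite_Union[symmetric])
         (auto simp: disjoint_family_on_def dest: disjointD)
    also have "(\<Union>A\<in>J k. A \<inter> B) = B" using U[of k] by auto
    finally show ?thesis .
  qed
  have marg1: "(\<Sum>B\<in>J m. p (A, B)) = measure M A" if A: "A \<in> sets M" for A
  proof -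
    have "(\<Sum>B\<in>J m. p (A, B)) = measure M (\<Union>B\<in>J m. A \<inter> (f ^^ n) -` B)"
      unfolding p_def using fin disj[of m] sets[of m] A vs
      by (subst finite_measure_finite_Union) (auto simp: disjoint_family_on_def dest: disjointD)
    also have "(\<Union>B\<in>J m. A \<inter> (f ^^ n) -` B) = A" using U[of m] by auto
    finally show ?thesis .
  qed
  have marg2: "(\<Sum>A\<in>J n. p (A, B)) = measure M B" if B: "B \<in> sets M" for B
    using sum1[OF vs[OF B], of n] measure_vimage_funpow[OF B, of n] by (simp add: p_def)
  have tot: "(\<Sum>A\<in>J k. measure M A) = 1" for k
    using sum1[of UNIV k] sets.top[of M] prob_space by (simp add: space_UNIV)
  \<comment> \<open>Pairs index the cells with repetition, but two different pairs can give the same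
    cell only if it is empty, and empty cells contribute 0.\<close>
  have 1: "(\<Sum>C\<in>J (n + m). measure M C * ln (measure M C)) = (\<Sum>AB\<in>J n \<times> J m. p AB * ln (p AB))"
    unfolding J_def dynamical_join_add
  proof (subst sum.reindex_nontrivial)
    show "finite (dynamical_join f P n \<times> dynamical_join f P m)" using fin by (simp add: J_def)
    fix AB CD assume AB: "AB \<in> dynamical_join f P n \<times> dynamical_join f P m"
      and CD: "CD \<in> dynamical_join f P n \<times> dynamical_join f P m" and ne: "AB \<noteq> CD"
      and eq: "(case AB of (A, B) \<Rightarrow> A \<inter> (f ^^ n) -` B) = (case CD of (A, B) \<Rightarrow> A \<inter> (f ^^ n) -` B)"
    have "(case AB of (A, B) \<Rightarrow> A \<inter> (f ^^ n) -` B) = {}"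
    proof (rule ccontr)
      assume "(case AB of (A, B) \<Rightarrow> A \<inter> (f ^^ n) -` B) \<noteq> {}"
      then obtain x where "x \<in> (case AB of (A, B) \<Rightarrow> A \<inter> (f ^^ n) -` B)" by auto
      with eq have x: "x \<in> fst AB \<inter> fst CD" "(f ^^ n) x \<in> snd AB \<inter> snd CD"
        by (auto split: prod.splits)
      have mem: "fst AB \<in> J n" "fst CD \<in> J n" "snd AB \<in> J m" "snd CD \<in> J m" using AB CD by (auto simp: J_def)
      have "fst AB = fst CD" using disjointD[OF disj mem(1,2)] x(1) by blast
      moreover have "snd AB = snd CD" using disjointD[OF disj mem(3,4)] x(2) by blast
      ultimately show False using ne by (simp add: prod_eq_iff)
    qed
    then show "measure M (case AB of (A, B) \<Rightarrow> A \<inter> (f ^^ n) -` B) * ln (measure M (case AB of (A, B) \<Rightarrow> A \<inter> (f ^^ n) -` B)) = 0"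
      by simp
  next
    show "sum ((\<lambda>C. measure M C * ln (measure M C)) \<circ> (\<lambda>(A, B). A \<inter> (f ^^ n) -` B)) (dynamical_join f P n \<times> dynamical_join f P m)
      = (\<Sum>AB\<in>dynamical_join f P n \<times> dynamical_join f P m. p AB * ln (p AB))"
      by (intro sum.cong) (auto simp: p_def)
  qed
  have ple: "p AB \<le> measure M (fst AB)" "p AB \<le> measure M (snd AB)" if "AB \<in> J n \<times> J m" for AB
  proof -
    have s: "fst AB \<in> sets M" "snd AB \<in> sets M" using that sets[of n] sets[of m] by auto
    show "p AB \<le> measure M (fst AB)" unfolding p_def using s vs by (intro finite_measure_mono) auto
    have "p AB \<le> measure M ((f ^^ n) -` snd AB)" unfolding p_def using s vs by (intro finite_measure_mono) auto
    then show "p AB \<le> measure M (snd AB)" using measure_vimage_funpow s by simp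
  qed
  have "- (\<Sum>AB\<in>J n \<times> J m. p AB * ln (p AB)) \<le> - (\<Sum>AB\<in>J n \<times> J m. p AB * ln (q AB))"
  proof (rule gibbs_inequality)
    have "(\<Sum>AB\<in>J n \<times> J m. p AB) = (\<Sum>A\<in>J n. \<Sum>B\<in>J m. p (A, B))" by (simp add: sum.cartesian_product)
    also have "\<dots> = (\<Sum>A\<in>J n. measure M A)" using sets[of n] by (intro sum.cong refl marg1) auto
    finally show "(\<Sum>AB\<in>J n \<times> J m. p AB) = 1" by (simp add: tot)
    have "(\<Sum>AB\<in>J n \<times> J m. q AB) = (\<Sum>A\<in>J n. measure M A) * (\<Sum>B\<in>J m. measure M B)"
      unfolding q_def by (simp add: sum_product sum.cartesian_product case_prod_unfold)
    then show "(\<Sum>AB\<in>J n \<times> J m. q AB) \<le> 1" by (simp add: tot)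
    fix AB assume "AB \<in> J n \<times> J m" "0 < p AB"
    then show "0 < q AB" using ple[of AB] by (simp add: q_def)
  qed (auto simp: p_def q_def)
  also have "(\<Sum>AB\<in>J n \<times> J m. p AB * ln (q AB)) =
     (\<Sum>AB\<in>J n \<times> J m. p AB * ln (measure M (fst AB)) + p AB * ln (measure M (snd AB)))"
  proof (intro sum.cong refl)
    fix AB assume AB: "AB \<in> J n \<times> J m"
    show "p AB * ln (q AB) = p AB * ln (measure M (fst AB)) + p AB * ln (measure M (snd AB))"
    proof (cases "p AB = 0")
      case False
      then have "0 < p AB" by (simp add: p_def zero_less_measure_iff)
      then have "0 < measure M (fst AB)" "0 < measure M (snd AB)" using ple[OF AB] by auto
      then show ?thesis by (simp add: q_def ln_mult distrib_left)
    qed simp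
  qed
  also have "\<dots> = (\<Sum>A\<in>J n. (\<Sum>B\<in>J m. p (A, B)) * ln (measure M A)) + (\<Sum>B\<in>J m. (\<Sum>A\<in>J n. p (A, B)) * ln (measure M B))"
    by (subst (2) sum_distrib_right, subst sum_distrib_right, subst (2) sum.swap)
       (simp add: sum.distrib sum.cartesian_product case_prod_unfold)
  also have "\<dots> = (\<Sum>A\<in>J n. measure M A * ln (measure M A)) + (\<Sum>B\<in>J m. measure M B * ln (measure M B))"
    using marg1 marg2 sets by (intro arg_cong2[of _ _ _ _ "(+)"] sum.cong) auto
  finally show ?thesis using 1 by (simp add: partition_entropy_def J_def)
qed

text \<open>Subadditivity makes the \<open>lim\<close> in \<open>metric_entropy_partition\<close> a
  genuine limit. A strict inequality between entropies then becomes a linear lower bound for all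
  large \<open>n\<close>, with room between \<open>h\<close> and \<open>h'\<close>.\<close>

lemma metric_entropy_gt_obtain:
  fixes h :: real
  assumes "ereal h < metric_entropy M f"
  obtains P h' where "finite P" "P \<subseteq> sets M" "partition_on UNIV P" "h < h'"
    "\<forall>\<^sub>F n in sequentially. h' * real n < partition_entropy M (dynamical_join f P n)"
proof -
  obtain P where P: "finite P" "P \<subseteq> sets M" "partition_on UNIV P" and gt: "ereal h < metric_entropy_partition M f P"
    using assms by (auto simp: metric_entropy_def less_SUP_iff space_UNIV)
  define a where "a n = partition_entropy M (dynamical_join f P n)" for n
  have "disjoint P" "\<Union>P = UNIV" using P(3) by (auto simp: partition_on_def)
  then have "a (n + m) \<le> a n + a m" for n m
    unfolding a_def using P by (intro partition_entropy_join_subadditive) auto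
  moreover have "0 \<le> a n" for n by (simp add: a_def partition_entropy_nonneg)
  ultimately obtain L where L: "(\<lambda>n. a n / n) \<longlonglongrightarrow> L" by (rule fekete_subadditive)
  then have "(\<lambda>n. ereal (a n / n)) \<longlonglongrightarrow> ereal L" by simp
  then have "metric_entropy_partition M f P = ereal L"
    unfolding metric_entropy_partition_def a_def by (rule limI)
  then have "h < L" using gt by simp
  define h' where "h' = (h + L) / 2"
  have h': "h < h'" "h' < L" using \<open>h < L\<close> by (auto simp: h'_def)
  have "\<forall>\<^sub>F n in sequentially. h' * real n < a n"
    using order_tendstoD(1)[OF L h'(2)] eventually_gt_at_top[of 0]
    by eventually_elim (simp add: field_simps)
  then show ?thesis using that[OF P h'(1)] by (simp add: a_def)
qed

end

text \<open>Refining by the classes of \<open>c\<close> can only raise the entropy, and to describe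
  a refined cell is to name a class and then one of the cells that meet it. While the number of
  classes stays bounded, the first term is negligible against the length of a join, so the entropy
  rate is controlled by an average of growth rates over the classes.\<close>

lemma (in prob_space) partition_entropy_le_classes:
  fixes c :: "'a \<Rightarrow> 'c"
  assumes P: "finite P" "P \<subseteq> sets M" "disjoint P" "\<Union>P = space M"
    and I: "finite (c ` space M)" and c: "\<And>i. i \<in> c ` space M \<Longrightarrow> c -` {i} \<inter> space M \<in> sets M"
  shows "partition_entropy M P \<le> ln (card (c ` space M)) +
    (\<Sum>i\<in>c ` space M. prob (c -` {i} \<inter> space M) * ln (card {A\<in>P. A \<inter> c -` {i} \<noteq> {}}))"
proof -
  define I where "I = c ` space M"
  have fI: "finite I" using I by (simp add: I_def)
  define r where "r = real (card I)"
  have "I \<noteq> {}" using not_empty by (simp add: I_def)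
  then have r: "r > 0" using fI by (simp add: r_def card_gt_0_iff)
  define C where "C i = c -` {i} \<inter> space M" for i
  define S where "S i = {A\<in>P. A \<inter> c -` {i} \<noteq> {}}" for i
  define N where "N i = real (card (S i))" for i
  have Cs: "C i \<in> sets M" if "i \<in> I" for i using c that by (auto simp: C_def I_def)
  have Psp: "A \<subseteq> space M" if "A \<in> P" for A using P(2) that sets.sets_into_space by auto
  have N: "N i > 0" if i: "i \<in> I" for i
  proof -
    obtain x where x: "x \<in> space M" "c x = i" using i by (auto simp: I_def)
    obtain A where "A \<in> P" "x \<in> A" using P(4) x by auto
    then have "A \<in> S i" using x by (auto simp: S_def)
    then show ?thesis using P(1) by (auto simp: N_def S_def card_gt_0_iff)
  qed
  define p where "p Ai = prob (fst Ai \<inter> C (snd Ai))" for Ai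
  define D where "D = P \<times> I"
  have pS: "fst Ai \<in> S (snd Ai)" if "0 < p Ai" "Ai \<in> D" for Ai
  proof (rule ccontr)
    assume "fst Ai \<notin> S (snd Ai)"
    then have "fst Ai \<inter> C (snd Ai) = {}" using that by (auto simp: S_def C_def D_def)
    then show False using that by (simp add: p_def)
  qed
  have marg1: "(\<Sum>i\<in>I. p (A, i)) = prob A" if A: "A \<in> P" for A
  proof -
    have "(\<Sum>i\<in>I. p (A, i)) = prob (\<Union>i\<in>I. A \<inter> C i)"
      unfolding p_def using fI Cs A P(2)
      by (subst finite_measure_finite_Union) (auto simp: disjoint_family_on_def C_def)
    also have "(\<Union>i\<in>I. A \<inter> C i) = A" using Psp[OF A] by (auto simp: C_def I_def)
    finally show ?thesis .
  qed
  have marg2: "(\<Sum>A\<in>P. p (A, i)) = prob (C i)" if i: "i \<in> I" for i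
  proof -
    have "(\<Sum>A\<in>P. p (A, i)) = prob (\<Union>A\<in>P. A \<inter> C i)"
      unfolding p_def using P Cs[OF i]
      by (subst finite_measure_finite_Union) (auto simp: disjoint_family_on_def dest: disjointD)
    also have "(\<Union>A\<in>P. A \<inter> C i) = C i" using P(4) by (auto simp: C_def)
    finally show ?thesis .
  qed
  have tot: "(\<Sum>i\<in>I. prob (C i)) = 1"
  proof -
    have "(\<Sum>i\<in>I. prob (C i)) = prob (\<Union>i\<in>I. C i)"
      using fI Cs by (subst finite_measure_finite_Union) (auto simp: disjoint_family_on_def C_def)
    also have "(\<Union>i\<in>I. C i) = space M" by (auto simp: C_def I_def)
    finally show ?thesis using prob_space by simp
  qed
  have swap: "(\<Sum>Ai\<in>D. g Ai) = (\<Sum>i\<in>I. \<Sum>A\<in>P. g (A, i))" for g :: "_ \<Rightarrow> real"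
    unfolding D_def by (subst sum.swap) (simp add: sum.cartesian_product)
  have "partition_entropy M P = - (\<Sum>A\<in>P. \<Sum>i\<in>I. p (A, i) * ln (prob A))"
    unfolding partition_entropy_def by (subst sum_distrib_right[symmetric]) (simp add: marg1)
  also have "(\<Sum>A\<in>P. \<Sum>i\<in>I. p (A, i) * ln (prob A)) = (\<Sum>Ai\<in>D. p Ai * ln (prob (fst Ai)))"
    by (simp add: D_def sum.cartesian_product case_prod_unfold)
  also have "- (\<Sum>Ai\<in>D. p Ai * ln (prob (fst Ai))) \<le> - (\<Sum>Ai\<in>D. p Ai * ln (p Ai))"
  proof (rule le_imp_neg_le, rule sum_mono)
    fix Ai assume Ai: "Ai \<in> D"
    show "p Ai * ln (p Ai) \<le> p Ai * ln (prob (fst Ai))"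
    proof (cases "p Ai = 0")
      case False
      have "p Ai \<le> prob (fst Ai)" unfolding p_def using Ai P(2) Cs
        by (intro finite_measure_mono) (auto simp: D_def)
      moreover have "0 < p Ai" using False by (simp add: p_def zero_less_measure_iff)
      ultimately show ?thesis by (intro mult_left_mono) auto
    qed simp
  qed
  \<comment> \<open>The reference weights are uniform over the classes and then over the cells meeting a class.\<close>
  also have "\<dots> \<le> - (\<Sum>Ai\<in>D. p Ai * ln (if fst Ai \<in> S (snd Ai) then 1 / (r * N (snd Ai)) else 0))"
  proof (rule gibbs_inequality)
    show "(\<Sum>Ai\<in>D. p Ai) = 1" by (simp add: swap marg2 tot)
    have "(\<Sum>Ai\<in>D. if fst Ai \<in> S (snd Ai) then 1 / (r * N (snd Ai)) else 0) = (\<Sum>i\<in>I. \<Sum>A\<in>P. if A \<in> S i then 1 / (r * N i) else 0)"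
      by (simp only: swap fst_conv snd_conv)
    also have "\<dots> = (\<Sum>i\<in>I. \<Sum>A\<in>S i. 1 / (r * N i))"
      using P(1) by (intro sum.cong refl sum.mono_neutral_cong_right) (auto simp: S_def)
    also have "\<dots> = (\<Sum>i\<in>I. 1 / r)" using N by (intro sum.cong refl) (auto simp: N_def)
    also have "\<dots> = 1" using r by (simp add: r_def)
    finally show "(\<Sum>Ai\<in>D. if fst Ai \<in> S (snd Ai) then 1 / (r * N (snd Ai)) else 0) \<le> 1" by simp
    fix Ai assume Ai: "Ai \<in> D"
    then show "0 \<le> (if fst Ai \<in> S (snd Ai) then 1 / (r * N (snd Ai)) else 0)"
      using r by (auto simp: N_def)
    assume "0 < p Ai"
    then show "0 < (if fst Ai \<in> S (snd Ai) then 1 / (r * N (snd Ai)) else 0)"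
      using pS Ai r N by (auto simp: D_def)
  qed (simp add: p_def)
  also have "\<dots> = (\<Sum>Ai\<in>D. p Ai * (ln r + ln (N (snd Ai))))"
    unfolding sum_negf[symmetric]
  proof (intro sum.cong refl)
    fix Ai assume Ai: "Ai \<in> D"
    show "- (p Ai * ln (if fst Ai \<in> S (snd Ai) then 1 / (r * N (snd Ai)) else 0)) = p Ai * (ln r + ln (N (snd Ai)))"
    proof (cases "p Ai = 0")
      case False
      then have "0 < p Ai" by (simp add: p_def zero_less_measure_iff)
      then have "fst Ai \<in> S (snd Ai)" using pS Ai by auto
      moreover have "N (snd Ai) > 0" using N Ai by (auto simp: D_def)
      ultimately show ?thesis using r by (simp add: ln_div ln_mult algebra_simps)
    qed simp
  qed
  also have "\<dots> = (\<Sum>i\<in>I. prob (C i) * (ln r + ln (N i)))"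
    by (simp add: swap sum_distrib_right[symmetric] marg2)
  also have "\<dots> = ln r + (\<Sum>i\<in>I. prob (C i) * ln (N i))"
    using tot by (simp add: distrib_left sum.distrib sum_distrib_right[symmetric])
  finally show ?thesis by (simp add: r_def N_def C_def S_def I_def)
qed

section \<open>Regularity and weak-star neighbourhoods\<close>


text \<open>Approximation by closed sets from inside together with open sets from outside is stable
  under complements, as inner approximation alone is not; so the induction over Borel sets runs on
  \<open>good\<close>.\<close>

lemma closed_inner_regular:
  fixes M :: "'a::metric_space measure"
  assumes fin: "finite_measure M" and s: "sets M = sets borel" and A: "A \<in> sets borel" and e: "0 < e"
  obtains K where "closed K" "K \<subseteq> A" "measure M (A - K) < e"
proof -
  interpret finite_measure M by (rule fin)
  define good where "good A \<longleftrightarrow> A \<in> sets borel \<and> (\<forall>e>0. \<exists>K U. closed K \<and> open U \<and> K \<subseteq> A \<and> A \<subseteq> U \<and> measure M (U - K) < e)" for A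
  have sp: "space M = UNIV" using sets_eq_imp_space_eq[OF s] by simp
  have op: "good A" if A: "open A" for A
    unfolding good_def
  proof (intro conjI allI impI)
    show "A \<in> sets borel" using A by simp
    fix e :: real assume e: "e > 0"
    show "\<exists>K U. closed K \<and> open U \<and> K \<subseteq> A \<and> A \<subseteq> U \<and> measure M (U - K) < e"
    proof (cases "A = UNIV")
      case True
      then show ?thesis using e by (intro exI[of _ UNIV]) auto
    next
      case False
      \<comment> \<open>Points at distance at least \<open>1 / (n + 1)\<close> from the complement
        exhaust an open set. The whole space is split off because \<open>infdist\<close> to the
        empty set is 0.\<close>
      define K where "K n = {x. inverse (Suc n) \<le> infdist x (- A)}" for n
      have cK: "closed (K n)" for n unfolding K_def
        by (intro closed_Collect_le continuous_intros)
      have KA: "K n \<subseteq> A" for n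
      proof
        fix x assume x: "x \<in> K n"
        show "x \<in> A"
        proof (rule ccontr)
          assume "x \<notin> A"
          then have "infdist x (- A) = 0" by simp
          moreover have "inverse (real (Suc n)) > 0" by simp
          ultimately show False using x by (simp add: K_def)
        qed
      qed
      have empty: "(\<Inter>n. A - K n) = {}"
      proof (rule ccontr)
        assume "(\<Inter>n. A - K n) \<noteq> {}"
        then obtain x where x: "x \<in> A" "\<And>n. x \<notin> K n" by auto
        have "infdist x (- A) \<noteq> 0"
          using in_closed_iff_infdist_zero[of "- A" x] A False x(1) by (auto simp: closed_Compl)
        then have "infdist x (- A) > 0" using infdist_nonneg[of x "- A"] by simp
        then obtain n where "inverse (Suc n) < infdist x (- A)" using reals_Archimedean by blast
        with x(2)[of n] show False by (simp add: K_def)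
      qed
      have "decseq (\<lambda>n. A - K n)"
      proof (intro decseq_SucI Diff_mono subset_refl)
        fix n
        have "inverse (Suc (Suc n)) \<le> inverse (Suc n)" by (simp add: field_simps)
        then show "K n \<subseteq> K (Suc n)" unfolding K_def by (meson Collect_mono order_trans)
      qed
      then have "(\<lambda>n. measure M (A - K n)) \<longlonglongrightarrow> measure M (\<Inter>n. A - K n)"
        using A cK s by (intro finite_Lim_measure_decseq) (auto simp: image_subset_iff)
      then have "(\<lambda>n. measure M (A - K n)) \<longlonglongrightarrow> 0" unfolding empty by simp
      from order_tendstoD(2)[OF this e] obtain n where "measure M (A - K n) < e"
        by (auto dest: eventually_happens)
      then show ?thesis using cK KA A by blast
    qed
  qed
  have "A \<in> sigma_sets UNIV {S. open S}" using A by (simp add: sets_borel)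
  then have "good A"
  proof induction
    case (Basic a)
    then show ?case using op by simp
  next
    case Empty
    show ?case using op by simp
  next
    case (Compl a)
    show ?case unfolding good_def
    proof (intro conjI allI impI)
      show "UNIV - a \<in> sets borel" using Compl.IH by (auto simp: good_def)
      fix e :: real assume "e > 0"
      then obtain K U where KU: "closed K" "open U" "K \<subseteq> a" "a \<subseteq> U" "measure M (U - K) < e"
        using Compl.IH unfolding good_def by blast
      have "(- K) - (- U) = U - K" by auto
      then show "\<exists>K U. closed K \<and> open U \<and> K \<subseteq> UNIV - a \<and> UNIV - a \<subseteq> U \<and> measure M (U - K) < e"
        using KU by (intro exI[of _ "- U"] exI[of _ "- K"]) auto
    qed
  next
    case (Union a)
    show ?case unfolding good_def
    proof (intro conjI allI impI)
      show "(\<Union>i. a i) \<in> sets borel" using Union.IH by (auto simp: good_def)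
      fix e :: real assume e: "e > 0"
      have "\<exists>K U. closed K \<and> open U \<and> K \<subseteq> a i \<and> a i \<subseteq> U \<and> measure M (U - K) < e / 4 * (1/2) ^ i" for i
      proof -
        have "0 < e / 4 * (1/2) ^ i" using e by simp
        then show ?thesis using Union.IH[of i] unfolding good_def by blast
      qed
      then obtain K U where KU: "\<And>i. closed (K i)" "\<And>i. open (U i)" "\<And>i. K i \<subseteq> a i" "\<And>i. a i \<subseteq> U i"
        "\<And>i. measure M (U i - K i) < e / 4 * (1/2) ^ i" by metis
      have m: "U i - K i \<in> sets M" for i using KU s by simp
      \<comment> \<open>A countable union of closed sets may fail to be closed; continuity from
        above along \<open>L\<close> allows keeping only finitely many of them.\<close>
      define L where "L n = (\<Union>i. U i) - (\<Union>i<n. K i)" for n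
      have Lm: "L n \<in> sets M" for n using KU s by (auto simp: L_def)
      have "decseq L" by (intro decseq_SucI) (auto simp: L_def less_Suc_eq)
      then have lim: "(\<lambda>n. measure M (L n)) \<longlonglongrightarrow> measure M (\<Inter>n. L n)"
        using Lm by (intro finite_Lim_measure_decseq) auto
      have "summable (\<lambda>i. e / 4 * (1/2::real) ^ i)" by (intro summable_mult summable_geometric) simp
      then have sm: "summable (\<lambda>i. measure M (U i - K i))"
        by (rule summable_comparison_test'[of _ 0]) (use KU(5) in \<open>auto intro: less_imp_le\<close>)
      have "measure M (\<Inter>n. L n) \<le> measure M (\<Union>i. U i - K i)"
        using m by (intro finite_measure_mono) (auto simp: L_def)
      also have "\<dots> \<le> (\<Sum>i. measure M (U i - K i))"
        using m sm by (intro finite_measure_subadditive_countably) auto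
      also have "\<dots> \<le> (\<Sum>i. e / 4 * (1/2) ^ i)"
        using KU(5) by (intro suminf_le sm) (auto intro: less_imp_le summable_mult summable_geometric)
      also have "\<dots> = e / 4 * (\<Sum>i. (1/2) ^ i)" by (intro suminf_mult summable_geometric) simp
      also have "\<dots> = e / 2" by (simp add: suminf_geometric)
      also have "\<dots> < e" using e by simp
      finally obtain n where n: "measure M (L n) < e"
        using order_tendstoD(2)[OF lim, of e] by (auto dest: eventually_happens)
      have "closed (\<Union>i<n. K i)" using KU by (intro closed_UN) auto
      moreover have "(\<Union>i<n. K i) \<subseteq> (\<Union>i. a i)" "(\<Union>i. a i) \<subseteq> (\<Union>i. U i)" using KU(3,4) by blast+
      moreover have "open (\<Union>i. U i)" using KU by (intro open_UN) auto
      ultimately show "\<exists>K U. closed K \<and> open U \<and> K \<subseteq> (\<Union>i. a i) \<and> (\<Union>i. a i) \<subseteq> U \<and> measure M (U - K) < e"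
        using n unfolding L_def by blast
    qed
  qed
  then obtain K U where KU: "closed K" "open U" "K \<subseteq> A" "A \<subseteq> U" "measure M (U - K) < e"
    using e unfolding good_def by blast
  have "measure M (A - K) \<le> measure M (U - K)" using KU s by (intro finite_measure_mono) auto
  then show ?thesis using that[of K] KU by simp
qed

text \<open>Induction on how an open set is generated from the subbasis. The property is claimed
  only for sets that contain \<mu>, since in a union only the members containing \<mu> are
  controlled.\<close>

lemma weak_star_neighbourhood:
  fixes f :: "'a::topological_space \<Rightarrow> 'a"
  assumes \<mu>: "\<mu> \<in> weak_star_topology f interior_of U"
  obtains F \<eta> where "finite F" "\<And>\<phi>. \<phi> \<in> F \<Longrightarrow> continuous_on UNIV (\<phi> :: 'a \<Rightarrow> real)" "(0::real) < \<eta>"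
    "\<And>\<nu>. \<nu> \<in> invariant_measures f \<Longrightarrow> (\<And>\<phi>. \<phi> \<in> F \<Longrightarrow> \<bar>(\<integral>x. \<phi> x \<partial>\<nu>) - (\<integral>x. \<phi> x \<partial>\<mu>)\<bar> < \<eta>) \<Longrightarrow> \<nu> \<in> U"
proof -
  define S where "S = {{\<mu> \<in> invariant_measures f. (\<integral>x. \<phi> x \<partial>\<mu>) \<in> V} | \<phi> V.
        continuous_on UNIV (\<phi> :: 'a \<Rightarrow> real) \<and> open V}"
  define basic where "basic V \<longleftrightarrow> (\<exists>F \<eta>. finite F \<and> (\<forall>\<phi>\<in>F. continuous_on UNIV (\<phi> :: 'a \<Rightarrow> real)) \<and> (0::real) < \<eta> \<and>
    (\<forall>\<nu>\<in>invariant_measures f. (\<forall>\<phi>\<in>F. \<bar>(\<integral>x. \<phi> x \<partial>\<nu>) - (\<integral>x. \<phi> x \<partial>\<mu>)\<bar> < \<eta>) \<longrightarrow> \<nu> \<in> V))" for V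
  have "\<mu> \<in> V \<longrightarrow> basic V" if "generate_topology_on S V" for V
    using that
  proof induction
    case Empty
    show ?case by simp
  next
    case (Int a b)
    show ?case
    proof
      assume "\<mu> \<in> a \<inter> b"
      then have "basic a" "basic b" using Int.IH by auto
      then obtain F \<eta> G \<theta> where "finite F" "\<forall>\<phi>\<in>F. continuous_on UNIV (\<phi> :: 'a \<Rightarrow> real)" "0 < \<eta>"
        "\<forall>\<nu>\<in>invariant_measures f. (\<forall>\<phi>\<in>F. \<bar>(\<integral>x. \<phi> x \<partial>\<nu>) - (\<integral>x. \<phi> x \<partial>\<mu>)\<bar> < \<eta>) \<longrightarrow> \<nu> \<in> a"
        "finite G" "\<forall>\<phi>\<in>G. continuous_on UNIV (\<phi> :: 'a \<Rightarrow> real)" "0 < \<theta>"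
        "\<forall>\<nu>\<in>invariant_measures f. (\<forall>\<phi>\<in>G. \<bar>(\<integral>x. \<phi> x \<partial>\<nu>) - (\<integral>x. \<phi> x \<partial>\<mu>)\<bar> < \<theta>) \<longrightarrow> \<nu> \<in> b"
        unfolding basic_def by metis
      then show "basic (a \<inter> b)" unfolding basic_def
        by (intro exI[of _ "F \<union> G"] exI[of _ "min \<eta> \<theta>"]) auto
    qed
  next
    case (UN K)
    show ?case
    proof
      assume "\<mu> \<in> \<Union>K"
      then obtain k where k: "k \<in> K" "\<mu> \<in> k" by auto
      then have "basic k" using UN.IH by auto
      then show "basic (\<Union>K)" unfolding basic_def using k(1) by (meson UnionI)
    qed
  next
    case (Basis s)
    show ?case
    proof
      assume "\<mu> \<in> s"
      then obtain \<phi> :: "'a \<Rightarrow> real" and V where s: "s = {\<mu> \<in> invariant_measures f. (\<integral>x. \<phi> x \<partial>\<mu>) \<in> V}"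
        "continuous_on UNIV \<phi>" "open V" "(\<integral>x. \<phi> x \<partial>\<mu>) \<in> V" using Basis unfolding S_def by blast
      then obtain e where "e > 0" "\<And>y. dist y (\<integral>x. \<phi> x \<partial>\<mu>) < e \<Longrightarrow> y \<in> V" by (meson open_dist)
      then show "basic s" unfolding basic_def using s
        by (intro exI[of _ "{\<phi>}"] exI[of _ e]) (auto simp: dist_real_def)
    qed
  qed
  moreover obtain V where V: "openin (weak_star_topology f) V" "V \<subseteq> U" "\<mu> \<in> V"
    using \<mu> by (auto simp: interior_of_def)
  moreover have "generate_topology_on S V"
    using V(1) unfolding weak_star_topology_def openin_topology_generated_by_iff S_def by simp
  ultimately have "basic V" by simp
  then obtain F \<eta> where "finite F" "\<forall>\<phi>\<in>F. continuous_on UNIV (\<phi> :: 'a \<Rightarrow> real)" "0 < \<eta>"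
    "\<forall>\<nu>\<in>invariant_measures f. (\<forall>\<phi>\<in>F. \<bar>(\<integral>x. \<phi> x \<partial>\<nu>) - (\<integral>x. \<phi> x \<partial>\<mu>)\<bar> < \<eta>) \<longrightarrow> \<nu> \<in> V"
    unfolding basic_def by blast
  then show ?thesis using V(2) by (intro that[of F \<eta>]) auto
qed

lemma invariant_measures_imp_measure_preserving:
  assumes "\<mu> \<in> invariant_measures f" "continuous_on UNIV f"
  shows "measure_preserving_map \<mu> f"
proof -
  have s: "sets \<mu> = sets borel" "prob_space \<mu>" "distr \<mu> \<mu> f = \<mu>" using assms by (auto simp: invariant_measures_def)
  have "f \<in> measurable \<mu> \<mu>"
    using borel_measurable_continuous_onI[OF assms(2)] measurable_cong_sets[OF s(1) s(1)] by simp
  moreover have "space \<mu> = UNIV" using sets_eq_imp_space_eq[OF s(1)] by simp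
  ultimately show ?thesis using s by (simp add: measure_preserving_map_def measure_preserving_map_axioms_def)
qed

section \<open>Orbit sums under an invariant measure\<close>

context measure_preserving_map begin

lemma integrable_compose_funpow: "integrable M (\<phi> :: 'a \<Rightarrow> real) \<Longrightarrow> integrable M (\<lambda>x. \<phi> ((f ^^ i) x))"
  using integrable_distr[OF funpow_measurable[of i], of \<phi>] by (simp add: distr_funpow)

lemma integral_compose_funpow:
  assumes "integrable M (\<phi> :: 'a \<Rightarrow> real)"
  shows "(\<integral>x. \<phi> ((f ^^ i) x) \<partial>M) = (\<integral>x. \<phi> x \<partial>M)"
  using integral_distr[OF funpow_measurable[of i], of \<phi>] assms by (simp add: distr_funpow)

lemma integral_orbit_sum:
  assumes "integrable M (\<phi> :: 'a \<Rightarrow> real)"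
  shows "(\<integral>x. (\<Sum>i<n. \<phi> ((f ^^ i) x)) \<partial>M) = n * (\<integral>x. \<phi> x \<partial>M)"
  using assms by (subst Bochner_Integration.integral_sum) (simp_all add: integrable_compose_funpow integral_compose_funpow)

text \<open>Markov's inequality for the number of visits, whose mean is
  \<open>n * measure M B\<close> by invariance. The bound is the same for all \<open>n\<close>: if
  \<open>B\<close> has measure at most \<open>\<kappa> * \<kappa>\<close>, its frequent visitors
  have measure at most \<open>\<kappa>\<close>.\<close>

lemma measure_frequent_visits_le:
  fixes \<kappa> :: real and n :: nat
  assumes B: "B \<in> sets M" and \<kappa>: "0 < \<kappa>" and n: "0 < n"
  shows "{x. \<kappa> * n < card {i\<in>{..<n}. (f ^^ i) x \<in> B}} \<in> sets M"
    and "measure M {x. \<kappa> * n < card {i\<in>{..<n}. (f ^^ i) x \<in> B}} \<le> measure M B / \<kappa>"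
proof -
  define v where "v x = (\<Sum>i<n. indicator B ((f ^^ i) x) :: real)" for x
  have v: "real (card {i\<in>{..<n}. (f ^^ i) x \<in> B}) = v x" for x
    by (simp add: v_def indicator_def sum.If_cases Int_def)
  have int: "integrable M (indicator B :: 'a \<Rightarrow> real)"
    using B by (intro integrable_real_indicator) (simp_all add: less_top[symmetric])
  have iv: "integrable M v" unfolding v_def using int by (intro Bochner_Integration.integrable_sum integrable_compose_funpow)
  have m: "{x. \<kappa> * n < v x} \<in> sets M"
    using borel_measurable_integrable[OF iv] measurable_sets[of v M borel "{\<kappa> * n <..}"] by (simp add: space_UNIV vimage_def)
  then show "{x. \<kappa> * n < card {i\<in>{..<n}. (f ^^ i) x \<in> B}} \<in> sets M" unfolding v .
  have "(\<kappa> * n) * measure M {x. \<kappa> * n < v x} = (\<integral>x. \<kappa> * n * indicator {x. \<kappa> * n < v x} x \<partial>M)" using m by simp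
  also have "\<dots> \<le> (\<integral>x. v x \<partial>M)"
  proof (rule integral_mono)
    show "integrable M (\<lambda>x. \<kappa> * n * indicator {x. \<kappa> * n < v x} x)"
      using m by (intro integrable_mult_right integrable_real_indicator) (simp_all add: less_top[symmetric])
    show "\<kappa> * n * indicator {x. \<kappa> * n < v x} x \<le> v x" for x
      by (auto simp: indicator_def v_def intro: sum_nonneg)
  qed (rule iv)
  also have "\<dots> = n * measure M B" unfolding v_def using integral_orbit_sum[OF int, of n] B by simp
  finally show "measure M {x. \<kappa> * n < card {i\<in>{..<n}. (f ^^ i) x \<in> B}} \<le> measure M B / \<kappa>"
    unfolding v using n \<kappa> by (simp add: field_simps)
qed

end

section \<open>Sets traced by words\<close>


lemma spaced_step:
  assumes "spaced n \<delta>\<^sub>1 t"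
  shows "t k + n \<le> t (Suc k)" "real (t (Suc k)) \<le> t k + n * (1 + \<delta>\<^sub>1)"
proof -
  have m: "t k < t (Suc k)" and a: "n \<le> t (Suc k) - t k" "real (t (Suc k) - t k) < real n * (1 + \<delta>\<^sub>1)"
    using assms by (auto simp: spaced_def strict_mono_Suc_iff)
  show "t k + n \<le> t (Suc k)" using a m by simp
  show "real (t (Suc k)) \<le> t k + n * (1 + \<delta>\<^sub>1)" using a(2) m by (simp add: of_nat_diff)
qed

lemma spaced_bounds:
  assumes "spaced n \<delta>\<^sub>1 t"
  shows "t k + m * n \<le> t (k + m)" "real (t (k + m)) \<le> t k + m * (n * (1 + \<delta>\<^sub>1))"
proof -
  show "t k + m * n \<le> t (k + m)"
  proof (induction m)
    case (Suc m)
    then show ?case using spaced_step(1)[OF assms, of "k + m"] by simp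
  qed simp
  show "real (t (k + m)) \<le> t k + m * (n * (1 + \<delta>\<^sub>1))"
  proof (induction m)
    case (Suc m)
    then show ?case using spaced_step(2)[OF assms, of "k + m"] by (simp add: algebra_simps)
  qed simp
qed

lemma spaced_shift:
  assumes "spaced n \<delta>\<^sub>1 t"
  shows "spaced n \<delta>\<^sub>1 (\<lambda>k. t (k + m) - t m)"
proof -
  have sm: "strict_mono t" using assms by (simp add: spaced_def)
  have le: "t m \<le> t (k + m)" for k using sm by (simp add: strict_mono_less_eq)
  have "t (k + m) - t m < t (Suc k + m) - t m" for k
    using le[of k] strict_monoD[OF sm, of "k + m" "Suc k + m"] by simp
  moreover have "(t (Suc k + m) - t m) - (t (k + m) - t m) = t (Suc (k + m)) - t (k + m)" for k
    using le[of k] by simp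
  ultimately show ?thesis using assms unfolding spaced_def strict_mono_Suc_iff by simp
qed

lemma traced_shift:
  assumes "traced f n \<delta>\<^sub>1 \<delta>\<^sub>2 t e x z"
  shows "traced f n \<delta>\<^sub>1 \<delta>\<^sub>2 (\<lambda>k. t (k + m) - t m) e (\<lambda>k. x (k + m)) ((f ^^ t m) z)"
proof -
  have sp: "spaced n \<delta>\<^sub>1 t" using assms by (simp add: traced_def)
  have le: "t m \<le> t (k + m)" for k using sp by (simp add: spaced_def strict_mono_less_eq)
  have "(f ^^ (t (k + m) - t m + j)) ((f ^^ t m) z) = (f ^^ (t (k + m) + j)) z" for k j
  proof -
    have "(f ^^ (t (k + m) - t m + j)) ((f ^^ t m) z) = (f ^^ (t (k + m) - t m + j + t m)) z"
      by (simp only: funpow_add o_apply)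
    also have "t (k + m) - t m + j + t m = t (k + m) + j" using le[of k] by simp
    finally show ?thesis .
  qed
  then show ?thesis using assms spaced_shift[OF sp] by (simp add: traced_def)
qed

text \<open>A bad time lies in a gap or is a tracing error. Each step of the time sequence brings at
  most \<open>n * \<delta>\<^sub>1\<close> times of the first kind and
  \<open>n * \<delta>\<^sub>2\<close> of the second.\<close>

lemma traced_bad_times:
  assumes tr: "traced f n \<delta>\<^sub>1 \<delta>\<^sub>2 t e x z"
  shows "real (card {i\<in>{..<t k}. \<not> (\<exists>l j. j < n \<and> i = t l + j \<and> dist ((f ^^ i) z) ((f ^^ j) (x l)) \<le> e)})
           \<le> k * (n * (\<delta>\<^sub>1 + \<delta>\<^sub>2))"
proof (induction k)
  case 0
  have "t 0 = 0" using tr by (simp add: traced_def spaced_def)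
  then show ?case by simp
next
  case (Suc k)
  have sp: "spaced n \<delta>\<^sub>1 t" using tr by (simp add: traced_def)
  define good where "good i \<longleftrightarrow> (\<exists>l j. j < n \<and> i = t l + j \<and> dist ((f ^^ i) z) ((f ^^ j) (x l)) \<le> e)" for i
  define E where "E = {j\<in>{..<n}. dist ((f ^^ (t k + j)) z) ((f ^^ j) (x k)) > e}"
  have "{i\<in>{..<t (Suc k)}. \<not> good i} \<subseteq> {i\<in>{..<t k}. \<not> good i} \<union> (\<lambda>j. t k + j) ` E \<union> {t k + n..<t (Suc k)}"
  proof
    fix i assume i: "i \<in> {i\<in>{..<t (Suc k)}. \<not> good i}"
    consider "i < t k" | "t k + n \<le> i" | j where "j < n" "i = t k + j"
      by (metis le_add_diff_inverse nat_add_left_cancel_less not_le)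
    then show "i \<in> {i\<in>{..<t k}. \<not> good i} \<union> (\<lambda>j. t k + j) ` E \<union> {t k + n..<t (Suc k)}"
    proof cases
      case (3 j)
      then have "\<not> dist ((f ^^ i) z) ((f ^^ j) (x k)) \<le> e" using i by (auto simp: good_def)
      then show ?thesis using 3 by (auto simp: E_def)
    qed (use i in auto)
  qed
  then have "card {i\<in>{..<t (Suc k)}. \<not> good i} \<le> card ({i\<in>{..<t k}. \<not> good i} \<union> (\<lambda>j. t k + j) ` E \<union> {t k + n..<t (Suc k)})"
    by (intro card_mono) (auto simp: E_def)
  also have "\<dots> \<le> card {i\<in>{..<t k}. \<not> good i} + card ((\<lambda>j. t k + j) ` E) + card {t k + n..<t (Suc k)}"
    by (intro order_trans[OF card_Un_le] add_right_mono card_Un_le)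
  also have "card ((\<lambda>j. t k + j) ` E) = card E" by (intro card_image) auto
  finally have "real (card {i\<in>{..<t (Suc k)}. \<not> good i})
     \<le> real (card {i\<in>{..<t k}. \<not> good i}) + real (card E) + real (t (Suc k) - (t k + n))" by simp
  also have "real (t (Suc k) - (t k + n)) \<le> n * \<delta>\<^sub>1"
    using spaced_step[OF sp, of k] by (simp add: of_nat_diff algebra_simps)
  also have "real (card E) \<le> n * \<delta>\<^sub>2"
    using tr by (simp add: E_def traced_def mult.commute less_imp_le)
  also have "real (card {i\<in>{..<t k}. \<not> good i}) \<le> k * (n * (\<delta>\<^sub>1 + \<delta>\<^sub>2))" using Suc by (simp add: good_def)
  finally have "real (card {i\<in>{..<t (Suc k)}. \<not> good i}) \<le> real (Suc k) * (n * (\<delta>\<^sub>1 + \<delta>\<^sub>2))"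
    by (simp add: algebra_simps)
  then show ?case by (simp only: good_def)
qed

text \<open>Correct times change the sum by at most \<open>\<omega>\<close> each, tracing errors by
  \<open>2 * B\<close>, and gap times, which have no counterpart in the segment, by
  \<open>B\<close>.\<close>

lemma traced_block_sum:
  fixes \<phi> :: "'a::metric_space \<Rightarrow> real" and B \<omega> :: real
  assumes tr: "traced f n \<delta>\<^sub>1 \<delta>\<^sub>2 t e x z"
    and B: "\<And>y. \<bar>\<phi> y\<bar> \<le> B" and \<omega>: "\<And>y y'. dist y y' \<le> e \<Longrightarrow> \<bar>\<phi> y - \<phi> y'\<bar> \<le> \<omega>" "0 \<le> \<omega>"
  shows "\<bar>(\<Sum>i\<in>{t k..<t (Suc k)}. \<phi> ((f ^^ i) z)) - (\<Sum>j<n. \<phi> ((f ^^ j) (x k)))\<bar> \<le> n * (\<omega> + 2 * B * \<delta>\<^sub>2 + B * \<delta>\<^sub>1)"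
proof -
  have sp: "spaced n \<delta>\<^sub>1 t" using tr by (simp add: traced_def)
  have B0: "0 \<le> B" using B[of undefined] by linarith
  define E where "E = {j\<in>{..<n}. dist ((f ^^ (t k + j)) z) ((f ^^ j) (x k)) > e}"
  define g where "g i = \<phi> ((f ^^ i) z)" for i
  define d where "d j = g (t k + j) - \<phi> ((f ^^ j) (x k))" for j
  have "(\<Sum>i\<in>{t k..<t (Suc k)}. g i) = (\<Sum>i\<in>{t k..<t k + n}. g i) + (\<Sum>i\<in>{t k + n..<t (Suc k)}. g i)"
    using spaced_step[OF sp, of k] by (intro sum.atLeastLessThan_concat[symmetric]) auto
  also have "(\<Sum>i\<in>{t k..<t k + n}. g i) = (\<Sum>j<n. g (t k + j))"
    using sum.shift_bounds_nat_ivl[of g 0 "t k" n] by (simp add: atLeast0LessThan add.commute)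
  finally have eq: "(\<Sum>i\<in>{t k..<t (Suc k)}. g i) - (\<Sum>j<n. \<phi> ((f ^^ j) (x k)))
     = (\<Sum>j<n. d j) + (\<Sum>i\<in>{t k + n..<t (Suc k)}. g i)" by (simp add: d_def sum_subtractf)
  have "\<bar>d j\<bar> \<le> \<omega> + (if j \<in> E then 2 * B else 0)" if "j < n" for j
  proof (cases "j \<in> E")
    case True
    have "\<bar>d j\<bar> \<le> B + B" unfolding d_def g_def by (intro order_trans[OF abs_triangle_ineq4] add_mono B)
    then show ?thesis using True \<omega> by simp
  next
    case False
    then show ?thesis using that \<omega>(1) by (auto simp: d_def g_def E_def)
  qed
  then have "(\<Sum>j<n. \<bar>d j\<bar>) \<le> (\<Sum>j<n. \<omega> + (if j \<in> E then 2 * B else 0))" by (intro sum_mono) auto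
  also have "\<dots> = n * \<omega> + 2 * B * card E"
    by (simp add: sum.distrib sum.If_cases E_def Int_def)
  also have "\<dots> \<le> n * \<omega> + 2 * B * (\<delta>\<^sub>2 * n)"
    using tr B0 by (intro add_left_mono mult_left_mono) (auto simp: E_def traced_def less_imp_le)
  finally have 1: "\<bar>\<Sum>j<n. d j\<bar> \<le> n * \<omega> + 2 * B * (\<delta>\<^sub>2 * n)" using sum_abs[of d "{..<n}"] by linarith
  have "\<bar>\<Sum>i\<in>{t k + n..<t (Suc k)}. g i\<bar> \<le> (\<Sum>i\<in>{t k + n..<t (Suc k)}. B)"
    by (intro order_trans[OF sum_abs] sum_mono) (simp add: g_def B)
  also have "\<dots> = B * real (t (Suc k) - (t k + n))" by simp
  also have "\<dots> \<le> B * (n * \<delta>\<^sub>1)"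
    using spaced_step[OF sp, of k] B0 by (intro mult_left_mono) (auto simp: of_nat_diff algebra_simps)
  finally show ?thesis using 1 eq unfolding g_def by (simp add: algebra_simps abs_le_iff)
qed

text \<open>A word \<open>w\<close> stands for the \<open>N\<close> orbit segments of length
  \<open>n\<close> that start at \<open>w 0\<close>, ..., \<open>w (N - 1)\<close>. With
  \<open>\<delta>\<^sub>1 \<le> 1\<close> every step of a time sequence is shorter than
  \<open>2 * n\<close>, so phases and increments range over finite sets that do not depend on the
  words.\<close>

locale block_words =
  fixes f :: "'a::metric_space \<Rightarrow> 'a" and n N :: nat and \<delta>\<^sub>1 \<delta>\<^sub>2 e :: real and W :: "(nat \<Rightarrow> 'a) set"
  assumes n_pos: "0 < n" and N_pos: "0 < N" and \<delta>\<^sub>1: "0 < \<delta>\<^sub>1" "\<delta>\<^sub>1 \<le> 1" and \<delta>\<^sub>2: "0 < \<delta>\<^sub>2"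
    and finite_W: "finite W" and W_nonempty: "W \<noteq> {}"
    and compact_space: "compact (UNIV :: 'a set)" and continuous: "continuous_on UNIV f"
begin

definition letter :: "(nat \<Rightarrow> nat \<Rightarrow> 'a) \<Rightarrow> nat \<Rightarrow> 'a" where
  "letter u k = u (k div N) (k mod N)"

definition tracers :: "'a set" where
  "tracers = {z. \<exists>u t. (\<forall>m. u m \<in> W) \<and> traced f n \<delta>\<^sub>1 \<delta>\<^sub>2 t e (letter u) z}"

text \<open>Since \<open>f ^^ t N\<close> maps a tracer to a tracer and \<open>0 < t N \<le> 2nN\<close>, finitely many shifts already
  give an invariant set.\<close>

definition core :: "'a set" where
  "core = {(f ^^ s) z | s z. s < 2 * n * N \<and> z \<in> tracers}"

definition tracking_set :: "'a set" where
  "tracking_set = closure core"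

lemma spaced_diff_le:
  assumes "spaced n \<delta>\<^sub>1 t"
  shows "t (k + m) \<le> t k + m * (2 * n)"
proof -
  have "real (t (k + m)) \<le> t k + m * (n * (1 + \<delta>\<^sub>1))" by (rule spaced_bounds(2)[OF assms])
  also have "\<dots> \<le> t k + real m * (n * 2)" using \<delta>\<^sub>1 by (intro add_left_mono mult_left_mono) (auto intro!: mult_left_mono)
  also have "\<dots> = real (t k + m * (2 * n))" by simp
  finally show ?thesis by (simp only: of_nat_le_iff)
qed

lemma tracers_shift:
  assumes "z \<in> tracers"
  obtains p where "0 < p" "p \<le> 2 * n * N" "(f ^^ p) z \<in> tracers"
proof -
  obtain u t where u: "\<And>m. u m \<in> W" and tr: "traced f n \<delta>\<^sub>1 \<delta>\<^sub>2 t e (letter u) z"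
    using assms by (auto simp: tracers_def)
  have sp: "spaced n \<delta>\<^sub>1 t" using tr by (simp add: traced_def)
  have "letter (\<lambda>m. u (Suc m)) = (\<lambda>k. letter u (k + N))"
    using N_pos by (auto simp: letter_def)
  then have "(f ^^ t N) z \<in> tracers"
    unfolding tracers_def using traced_shift[OF tr, of N] u
    by (intro CollectI exI[of _ "\<lambda>m. u (Suc m)"] exI[of _ "\<lambda>k. t (k + N) - t N"]) auto
  moreover have "t 0 = 0" using sp by (simp add: spaced_def)
  then have "N * n \<le> t N" "t N \<le> 2 * n * N"
    using spaced_bounds(1)[OF sp, of 0 N] spaced_diff_le[OF sp, of 0 N] by (simp_all add: ac_simps)
  moreover from this(1) have "0 < t N" using mult_pos_pos[OF N_pos n_pos] by linarith
  ultimately show ?thesis using that by blast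
qed

lemma core_invariant: "f ` core \<subseteq> core"
proof
  fix y assume "y \<in> f ` core"
  then obtain s z where y: "y = f ((f ^^ s) z)" and s: "s < 2 * n * N" and z: "z \<in> tracers"
    by (auto simp: core_def)
  show "y \<in> core"
  proof (cases "Suc s < 2 * n * N")
    case True
    then show ?thesis using y z unfolding core_def by (intro CollectI exI[of _ "Suc s"] exI[of _ z]) simp
  next
    case False
    \<comment> \<open>Here \<open>Suc s = 2 * n * N\<close>, and \<open>p\<close> does not exceed
      it, so the truncated subtraction below is exact.\<close>
    obtain p where p: "0 < p" "p \<le> 2 * n * N" "(f ^^ p) z \<in> tracers" using tracers_shift[OF z] .
    have "y = (f ^^ (Suc s - p + p)) z" using p False y by simp
    also have "\<dots> = (f ^^ (Suc s - p)) ((f ^^ p) z)" by (simp only: funpow_add o_apply)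
    finally have "y = (f ^^ (Suc s - p)) ((f ^^ p) z)" .
    moreover have "Suc s - p < 2 * n * N" using p False s by simp
    ultimately show ?thesis using p(3) unfolding core_def by blast
  qed
qed

lemma compact_tracking_set: "compact tracking_set"
  using compact_Int_closed[OF compact_space, of tracking_set] by (simp add: tracking_set_def)

lemma closed_tracking_set: "closed tracking_set"
  by (simp add: tracking_set_def)

lemma tracking_set_invariant: "f ` tracking_set \<subseteq> tracking_set"
proof -
  have "f ` closure core \<subseteq> closure (f ` core)"
    by (intro continuous_image_closure_subset[OF continuous]) auto
  also have "\<dots> \<subseteq> closure core" by (rule closure_mono[OF core_invariant])
  finally show ?thesis by (simp add: tracking_set_def)
qed

lemma tracers_subset: "tracers \<subseteq> tracking_set"
proof
  fix z assume "z \<in> tracers"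
  then have "z \<in> core" unfolding core_def using n_pos N_pos by (intro CollectI exI[of _ 0] exI[of _ z]) simp
  then show "z \<in> tracking_set" unfolding tracking_set_def using closure_subset by auto
qed

text \<open>Complete words contribute \<open>\<eta>\<close> per unit time, errors and gaps
  \<open>\<omega> + 2 * B * \<delta>\<^sub>2 + B * \<delta>\<^sub>1\<close>, and the unfinished last
  word a constant. As the sums are compared with 0 and not with a multiple of \<open>T\<close>, it
  suffices that the elapsed time is at least the total length of the traced segments.\<close>

lemma tracers_orbit_sum:
  fixes \<phi> :: "'a \<Rightarrow> real" and B \<omega> \<eta> :: real
  assumes z: "z \<in> tracers"
    and B: "\<And>y. \<bar>\<phi> y\<bar> \<le> B" and \<omega>: "\<And>y y'. dist y y' \<le> e \<Longrightarrow> \<bar>\<phi> y - \<phi> y'\<bar> \<le> \<omega>" "0 \<le> \<omega>"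
    and W: "\<And>w. w \<in> W \<Longrightarrow> \<bar>\<Sum>j<N. \<Sum>i<n. \<phi> ((f ^^ i) (w j))\<bar> \<le> n * N * \<eta>" and \<eta>: "0 \<le> \<eta>"
  shows "\<bar>\<Sum>i<T. \<phi> ((f ^^ i) z)\<bar> \<le> (\<eta> + \<omega> + 2 * B * \<delta>\<^sub>2 + B * \<delta>\<^sub>1) * T + 2 * n * N * B"
proof -
  obtain u t where u: "\<And>m. u m \<in> W" and tr: "traced f n \<delta>\<^sub>1 \<delta>\<^sub>2 t e (letter u) z"
    using z by (auto simp: tracers_def)
  have sp: "spaced n \<delta>\<^sub>1 t" using tr by (simp add: traced_def)
  then have t0: "t 0 = 0" by (simp add: spaced_def)
  have B0: "0 \<le> B" using B[of undefined] by linarith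
  define S where "S y = (\<Sum>j<n. \<phi> ((f ^^ j) y))" for y
  define c where "c = \<omega> + 2 * B * \<delta>\<^sub>2 + B * \<delta>\<^sub>1"
  have c0: "0 \<le> c" using \<omega>(2) B0 \<delta>\<^sub>1 \<delta>\<^sub>2 by (simp add: c_def)
  define g where "g i = \<phi> ((f ^^ i) z)" for i
  have 1: "\<bar>(\<Sum>i<t k. g i) - (\<Sum>l<k. S (letter u l))\<bar> \<le> k * (n * c)" for k
  proof (induction k)
    case (Suc k)
    have "(\<Sum>i<t (Suc k). g i) = (\<Sum>i<t k. g i) + (\<Sum>i\<in>{t k..<t (Suc k)}. g i)"
      using sum.atLeastLessThan_concat[of 0 "t k" "t (Suc k)" g] spaced_step(1)[OF sp, of k]
      by (simp add: atLeast0LessThan)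
    moreover have "\<bar>(\<Sum>i\<in>{t k..<t (Suc k)}. g i) - S (letter u k)\<bar> \<le> n * c"
      using traced_block_sum[where k = k, OF tr B \<omega>] by (simp add: g_def S_def c_def)
    ultimately show ?case using Suc by (simp add: algebra_simps abs_le_iff)
  qed (simp add: t0)
  have 2: "\<bar>\<Sum>l<K * N. S (letter u l)\<bar> \<le> K * (n * N * \<eta>)" for K
  proof -
    have "(\<Sum>l<K * N. S (letter u l)) = (\<Sum>m<K. \<Sum>l\<in>{m * N..<m * N + N}. S (letter u l))"
      by (rule sum.nat_group[symmetric])
    also have "\<dots> = (\<Sum>m<K. \<Sum>j<N. S (u m j))"
    proof (rule sum.cong[OF refl])
      fix m
      have "(\<Sum>l\<in>{m * N..<m * N + N}. S (letter u l)) = (\<Sum>j<N. S (letter u (j + m * N)))"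
        using sum.shift_bounds_nat_ivl[of "\<lambda>l. S (letter u l)" 0 "m * N" N] by (simp add: atLeast0LessThan add.commute)
      also have "\<dots> = (\<Sum>j<N. S (u m j))" by (intro sum.cong) (auto simp: letter_def)
      finally show "(\<Sum>l\<in>{m * N..<m * N + N}. S (letter u l)) = (\<Sum>j<N. S (u m j))" .
    qed
    finally have "\<bar>\<Sum>l<K * N. S (letter u l)\<bar> \<le> (\<Sum>m<K. \<bar>\<Sum>j<N. S (u m j)\<bar>)" by simp
    also have "\<dots> \<le> (\<Sum>m<K. n * N * \<eta>)"
      using W[OF u] by (intro sum_mono) (simp add: S_def)
    finally show ?thesis by simp
  qed
  \<comment> \<open>Starting times are unbounded, so the \<open>LEAST\<close> below is
    attained.\<close>
  have tK: "K \<le> t (Suc K * N)" for K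
  proof -
    have "K \<le> Suc K * N * n" using n_pos N_pos by (metis One_nat_def Suc_leD Suc_leI le_trans mult_le_mono nat_mult_1_right order_refl)
    then show ?thesis using spaced_bounds(1)[OF sp, of 0 "Suc K * N"] by simp
  qed
  \<comment> \<open>The number of complete words traced by time \<open>T\<close>.\<close>
  define K where "K = (LEAST K. T < t (Suc K * N))"
  have "T < t (Suc (Suc T) * N)" using tK[of "Suc T"] by simp
  then have K1: "T < t (Suc K * N)" unfolding K_def by (rule LeastI)
  have K2: "t (K * N) \<le> T"
  proof (cases K)
    case (Suc K')
    then have "\<not> T < t (Suc K' * N)" using not_less_Least[of K' "\<lambda>K. T < t (Suc K * N)"] by (simp add: K_def)
    then show ?thesis using Suc by simp
  qed (simp add: t0)
  have K3: "T - t (K * N) \<le> 2 * n * N" using K1 spaced_diff_le[OF sp, of "K * N" N] by (simp add: algebra_simps)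
  have "(\<Sum>i<T. g i) = (\<Sum>i<t (K * N). g i) + (\<Sum>i\<in>{t (K * N)..<T}. g i)"
    using sum.atLeastLessThan_concat[of 0 "t (K * N)" T g] K2 by (simp add: atLeast0LessThan)
  moreover have "\<bar>\<Sum>i\<in>{t (K * N)..<T}. g i\<bar> \<le> 2 * n * N * B"
  proof -
    have "\<bar>\<Sum>i\<in>{t (K * N)..<T}. g i\<bar> \<le> (\<Sum>i\<in>{t (K * N)..<T}. B)"
      by (intro order_trans[OF sum_abs] sum_mono) (simp add: g_def B)
    also have "\<dots> = real (T - t (K * N)) * B" by simp
    also have "\<dots> \<le> real (2 * n * N) * B" using K3 B0 by (intro mult_right_mono) (simp_all only: of_nat_le_iff)
    finally show ?thesis by simp
  qed
  moreover have "\<bar>\<Sum>i<t (K * N). g i\<bar> \<le> (\<eta> + c) * T"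
  proof -
    have "\<bar>\<Sum>i<t (K * N). g i\<bar> \<le> K * (n * N * \<eta>) + (K * N) * (n * c)" using 1[of "K * N"] 2[of K] by linarith
    also have "\<dots> = (\<eta> + c) * (K * N * n)" by (simp add: algebra_simps)
    also have "K * N * n \<le> T" using spaced_bounds(1)[OF sp, of 0 "K * N"] K2 by simp
    then have "(\<eta> + c) * real (K * N * n) \<le> (\<eta> + c) * real T" using \<eta> c0 by (intro mult_left_mono) (simp_all only: of_nat_le_iff)
    finally show ?thesis by simp
  qed
  ultimately have "\<bar>\<Sum>i<T. g i\<bar> \<le> (\<eta> + c) * T + 2 * n * N * B" by linarith
  then show ?thesis by (simp add: g_def c_def algebra_simps)
qed

text \<open>A bound on a finite orbit sum is a closed condition, so it passes from
  \<open>core\<close> to its closure. Integration against an invariant measure turns the orbit sum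
  into \<open>T\<close> times the integral, and the additive constant, which does not grow with
  \<open>T\<close>, disappears for large \<open>T\<close>.\<close>

lemma invariant_measure_on_tracking_set:
  fixes \<phi> :: "'a \<Rightarrow> real" and B \<omega> \<eta> :: real
  assumes \<nu>: "\<nu> \<in> invariant_measures_on tracking_set f" and cont: "continuous_on UNIV \<phi>"
    and B: "\<And>y. \<bar>\<phi> y\<bar> \<le> B" and \<omega>: "\<And>y y'. dist y y' \<le> e \<Longrightarrow> \<bar>\<phi> y - \<phi> y'\<bar> \<le> \<omega>" "0 \<le> \<omega>"
    and W: "\<And>w. w \<in> W \<Longrightarrow> \<bar>\<Sum>j<N. \<Sum>i<n. \<phi> ((f ^^ i) (w j))\<bar> \<le> n * N * \<eta>" and \<eta>: "0 \<le> \<eta>"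
  shows "\<bar>\<integral>x. \<phi> x \<partial>\<nu>\<bar> \<le> \<eta> + \<omega> + 2 * B * \<delta>\<^sub>2 + B * \<delta>\<^sub>1"
proof -
  have \<nu>': "\<nu> \<in> invariant_measures f" "emeasure \<nu> tracking_set = 1"
    using \<nu> invariant_measures_on_eq[OF continuous closed_tracking_set tracking_set_invariant] by auto
  interpret measure_preserving_map \<nu> f by (rule invariant_measures_imp_measure_preserving[OF \<nu>'(1) continuous])
  have s: "sets \<nu> = sets borel" using \<nu>'(1) by (simp add: invariant_measures_def)
  have B0: "0 \<le> B" using B[of undefined] by linarith
  define a where "a = \<eta> + \<omega> + 2 * B * \<delta>\<^sub>2 + B * \<delta>\<^sub>1"
  have a0: "0 \<le> a" using \<omega>(2) B0 \<delta>\<^sub>1 \<delta>\<^sub>2 \<eta> by (simp add: a_def)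
  \<comment> \<open>A point of \<open>core\<close> is a tracer shifted by fewer than
    \<open>2 * n * N\<close> steps, so its orbit sum is a difference of two orbit sums of the
    tracer; \<open>C\<close> absorbs the shift and both constants.\<close>
  define C where "C = 2 * a * (2 * n * N) + 2 * (2 * n * N * B)"
  have core: "\<bar>\<Sum>i<T. \<phi> ((f ^^ i) y)\<bar> \<le> a * T + C" if yc: "y \<in> core" for y T
  proof -
    obtain s z where y: "y = (f ^^ s) z" and s: "s < 2 * n * N" and z: "z \<in> tracers" using yc unfolding core_def by blast
    have "(\<Sum>i<T. \<phi> ((f ^^ i) y)) = (\<Sum>i<T. \<phi> ((f ^^ (i + s)) z))" by (simp add: y funpow_add)
    also have "\<dots> = (\<Sum>i\<in>{s..<T + s}. \<phi> ((f ^^ i) z))"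
      using sum.shift_bounds_nat_ivl[of "\<lambda>i. \<phi> ((f ^^ i) z)" 0 s T] by (simp add: atLeast0LessThan)
    also have "\<dots> = (\<Sum>i<T + s. \<phi> ((f ^^ i) z)) - (\<Sum>i<s. \<phi> ((f ^^ i) z))"
      using sum.atLeastLessThan_concat[of 0 s "T + s" "\<lambda>i. \<phi> ((f ^^ i) z)"] by (simp add: atLeast0LessThan)
    finally have "\<bar>\<Sum>i<T. \<phi> ((f ^^ i) y)\<bar> \<le> \<bar>\<Sum>i<T + s. \<phi> ((f ^^ i) z)\<bar> + \<bar>\<Sum>i<s. \<phi> ((f ^^ i) z)\<bar>" by linarith
    also have "\<dots> \<le> (a * (T + s) + 2 * n * N * B) + (a * s + 2 * n * N * B)"
      unfolding a_def by (intro add_mono order_trans[OF tracers_orbit_sum[OF z B \<omega> W \<eta>]]) auto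
    also have "\<dots> = a * T + 2 * a * s + 2 * (2 * n * N * B)" by (simp add: algebra_simps)
    also have "2 * a * real s \<le> 2 * a * real (2 * n * N)"
      using s a0 by (intro mult_left_mono) (auto simp only: of_nat_le_iff less_imp_le mult_nonneg_nonneg zero_le_numeral)
    finally show ?thesis by (simp add: C_def)
  qed
  have tr: "\<bar>\<Sum>i<T. \<phi> ((f ^^ i) y)\<bar> \<le> a * T + C" if "y \<in> tracking_set" for y T
  proof -
    have "closed {y. \<bar>\<Sum>i<T. \<phi> ((f ^^ i) y)\<bar> \<le> a * T + C}"
      by (intro closed_Collect_le continuous_intros continuous_on_compose2[OF cont continuous_on_funpow[OF continuous]]) auto
    then have "tracking_set \<subseteq> {y. \<bar>\<Sum>i<T. \<phi> ((f ^^ i) y)\<bar> \<le> a * T + C}"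
      unfolding tracking_set_def using core by (intro closure_minimal) auto
    then show ?thesis using that by auto
  qed
  have "\<phi> \<in> borel_measurable \<nu>"
    using borel_measurable_continuous_onI[OF cont] by (subst measurable_cong_sets[OF s refl])
  then have int: "integrable \<nu> \<phi>" using B by (intro integrable_const_bound[of _ B]) auto
  have "AE x in \<nu>. x \<in> tracking_set"
    using \<nu>'(2) closed_tracking_set s by (simp add: AE_in_set_eq_1 emeasure_eq_measure)
  then have bnd: "\<bar>\<integral>x. (\<Sum>i<T. \<phi> ((f ^^ i) x)) \<partial>\<nu>\<bar> \<le> a * T + C" for T
  proof -
    have i: "integrable \<nu> (\<lambda>x. \<Sum>i<T. \<phi> ((f ^^ i) x))" by (intro Bochner_Integration.integrable_sum integrable_compose_funpow int)
    have "\<bar>\<integral>x. (\<Sum>i<T. \<phi> ((f ^^ i) x)) \<partial>\<nu>\<bar> \<le> (\<integral>x. \<bar>\<Sum>i<T. \<phi> ((f ^^ i) x)\<bar> \<partial>\<nu>)" by (rule integral_abs_bound)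
    also have "\<dots> \<le> (\<integral>x. a * T + C \<partial>\<nu>)"
      using i \<open>AE x in \<nu>. x \<in> tracking_set\<close> by (intro integral_mono_AE) (auto elim!: eventually_mono intro: tr)
    finally show ?thesis using prob_space by simp
  qed
  have lin: "real T * \<bar>\<integral>x. \<phi> x \<partial>\<nu>\<bar> \<le> a * T + C" for T :: nat
    using bnd[of T] by (simp add: integral_orbit_sum[OF int] abs_mult)
  show ?thesis
  proof (rule ccontr)
    assume "\<not> ?thesis"
    then have "\<bar>\<integral>x. \<phi> x \<partial>\<nu>\<bar> - a > 0" by (simp add: a_def)
    then obtain T :: nat where "C < T * (\<bar>\<integral>x. \<phi> x \<partial>\<nu>\<bar> - a)" using ex_less_of_nat_mult by blast
    with lin[of T] show False by (simp add: algebra_simps)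
  qed
qed

end

section \<open>Orbit counts of the tracking set\<close>


lemma sum_fibre_bound:
  assumes A: "finite A" and D: "finite D" "d ` A \<subseteq> D" and b: "\<And>c. c \<in> D \<Longrightarrow> card {a\<in>A. d a = c} \<le> b"
  shows "card A \<le> card D * b"
proof -
  have "A = (\<Union>c\<in>D. {a\<in>A. d a = c})" using D by auto
  then have "card A \<le> (\<Sum>c\<in>D. card {a\<in>A. d a = c})" using card_UN_le[OF D(1), of "\<lambda>c. {a\<in>A. d a = c}"] by simp
  also have "\<dots> \<le> (\<Sum>c\<in>D. b)" by (intro sum_mono b)
  finally show ?thesis by simp
qed

lemma increments_determine:
  fixes t t' :: "nat \<Rightarrow> nat"
  assumes "strict_mono t" "strict_mono t'" "t 0 = t' 0"
    and "\<And>k. k < K \<Longrightarrow> t (Suc k) - t k = t' (Suc k) - t' k" and "k \<le> K"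
  shows "t k = t' k"
  using \<open>k \<le> K\<close>
proof (induction k)
  case (Suc k)
  have "t k = t' k" using Suc by simp
  moreover have "t (Suc k) - t k = t' (Suc k) - t' k" using assms(4)[of k] Suc.prems by simp
  moreover have "t k < t (Suc k)" "t' k < t' (Suc k)" using assms(1,2) by (auto simp: strict_mono_Suc_iff)
  ultimately show ?case by simp
qed (use assms in simp)

text \<open>Starting times are at least \<open>n\<close> apart, so the blocks of length
  \<open>n\<close> are disjoint.\<close>

lemma spaced_decomposition_unique:
  assumes sp: "spaced n \<delta>\<^sub>1 t" and j: "j < n" "j' < n" and eq: "t l + j = t l' + j'"
  shows "l = l' \<and> j = j'"
proof -
  have *: False if "j < n" "t l + j = t l' + j'" "l < l'" for l l' j j'
  proof -
    have "t l + n \<le> t (Suc l)" by (rule spaced_step(1)[OF sp])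
    also have "\<dots> \<le> t l'" using sp that(3) by (simp add: spaced_def strict_mono_less_eq)
    finally show False using that by simp
  qed
  have "\<not> l < l'" "\<not> l' < l" using *[of j l l' j'] *[of j' l' l j] j eq by auto
  then show ?thesis using eq by auto
qed

context block_words begin

lemma increments_mem:
  assumes sp: "spaced n \<delta>\<^sub>1 t"
  shows "t (Suc k) - t k \<in> {n..<2 * n}"
proof -
  have "n \<le> t (Suc k) - t k" "real (t (Suc k) - t k) < real n * (1 + \<delta>\<^sub>1)" using sp by (auto simp: spaced_def)
  moreover have "real n * (1 + \<delta>\<^sub>1) \<le> real n * 2" using \<delta>\<^sub>1 by (intro mult_left_mono) auto
  ultimately have "real (t (Suc k) - t k) < real (2 * n)" by simp
  then have "t (Suc k) - t k < 2 * n" by (simp only: of_nat_less_iff)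
  with \<open>n \<le> t (Suc k) - t k\<close> show ?thesis by simp
qed

text \<open>Tracers with equal increments run through corresponding blocks at the same times. In
  some block their words are more than \<open>\<gamma>\<^sub>0\<close> apart at
  \<open>\<zeta> * n\<close> times at least, and fewer than \<open>2 * \<delta>\<^sub>2 * n\<close>
  times are spoilt for one of the tracers, so at some time both are correct and the triangle
  inequality separates them. The factor \<open>n ^ (K * N)\<close> counts the increment
  patterns.\<close>

lemma card_word_power_le:
  fixes \<zeta> \<gamma>\<^sub>0 \<epsilon>' :: real
  assumes tracing: "\<And>x. \<exists>t z. traced f n \<delta>\<^sub>1 \<delta>\<^sub>2 t e x z"
    and sep: "\<And>w w'. w \<in> W \<Longrightarrow> w' \<in> W \<Longrightarrow> w \<noteq> w' \<Longrightarrow>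
      \<exists>j<N. \<zeta> * n \<le> card {i\<in>{..<n}. dist ((f ^^ i) (w j)) ((f ^^ i) (w' j)) > \<gamma>\<^sub>0}"
    and \<zeta>: "2 * \<delta>\<^sub>2 \<le> \<zeta>" and \<gamma>: "2 * e + \<epsilon>' \<le> \<gamma>\<^sub>0" and \<epsilon>': "0 < \<epsilon>'"
    and K: "0 < K" and T: "real (K * N) * (n * (1 + \<delta>\<^sub>1)) \<le> real T"
  shows "card W ^ K \<le> n ^ (K * N) * max_separated tracking_set f T \<epsilon>'"
proof -
  obtain w0 where w0: "w0 \<in> W" using W_nonempty by auto
  \<comment> \<open>Tracing concerns infinite sequences, so a finite tuple of words is continued by
    a fixed word.\<close>
  define ext where "ext v m = (if m < K then v m else w0)" for v :: "nat \<Rightarrow> nat \<Rightarrow> 'a" and m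
  have "\<forall>x. \<exists>p. traced f n \<delta>\<^sub>1 \<delta>\<^sub>2 (fst p) e x (snd p)" using tracing by simp
  then obtain p where p: "\<And>x. traced f n \<delta>\<^sub>1 \<delta>\<^sub>2 (fst (p x)) e x (snd (p x))" by metis
  define t where "t v = fst (p (letter (ext v)))" for v
  define z where "z v = snd (p (letter (ext v)))" for v
  have tr: "traced f n \<delta>\<^sub>1 \<delta>\<^sub>2 (t v) e (letter (ext v)) (z v)" for v using p by (simp add: t_def z_def)
  then have sp: "spaced n \<delta>\<^sub>1 (t v)" for v by (simp add: traced_def)
  have Tpos: "0 < T"
  proof -
    have "0 < real (K * N) * (n * (1 + \<delta>\<^sub>1))" using K N_pos n_pos \<delta>\<^sub>1 by simp
    then show ?thesis using T by simp
  qed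
  have tT: "t v (K * N) \<le> T" for v
    using spaced_bounds(2)[OF sp, of v 0 "K * N"] sp[of v] T by (simp add: spaced_def)
  define V where "V = PiE {..<K} (\<lambda>_. W)"
  define D where "D = PiE {..<K * N} (\<lambda>_. {n..<2 * n})"
  \<comment> \<open>The time sequence depends on the traced word, so words are compared only when their increments agree.\<close>
  define d where "d v = restrict (\<lambda>k. t v (Suc k) - t v k) {..<K * N}" for v
  have fV: "finite V" unfolding V_def using finite_W by (simp add: finite_PiE)
  have zt: "z v \<in> tracers" if "v \<in> V" for v
  proof -
    have "ext v m \<in> W" for m using that w0 by (auto simp: ext_def V_def PiE_iff)
    then show ?thesis using tr[of v] by (auto simp: tracers_def)
  qed
  have apart: "\<exists>i<T. dist ((f ^^ i) (z v)) ((f ^^ i) (z v')) > \<epsilon>'" if v: "v \<in> V" "v' \<in> V" "v \<noteq> v'" and dd: "d v = d v'" for v v'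
  proof -
    have "\<exists>m\<in>{..<K}. v m \<noteq> v' m" using v by (metis PiE_ext V_def)
    then obtain m where m: "m < K" "v m \<noteq> v' m" by auto
    have vm: "v m \<in> W" "v' m \<in> W" using v m by (auto simp: V_def PiE_iff)
    obtain j where j: "j < N" and far: "\<zeta> * n \<le> card {i\<in>{..<n}. dist ((f ^^ i) (v m j)) ((f ^^ i) (v' m j)) > \<gamma>\<^sub>0}"
      using sep[OF vm m(2)] by auto
    define k where "k = m * N + j"
    have kK: "k < K * N"
    proof -
      have "k < m * N + N" using j by (simp add: k_def)
      also have "\<dots> = Suc m * N" by simp
      also have "\<dots> \<le> K * N" using m by (intro mult_le_mono1) simp
      finally show ?thesis .
    qed
    have x: "letter (ext v) k = v m j" "letter (ext v') k = v' m j"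
      using j m by (simp_all add: letter_def k_def ext_def)
    have teq: "t v k = t v' k"
    proof (rule increments_determine[of "t v" "t v'" "K * N" k])
      show "t v (Suc l) - t v l = t v' (Suc l) - t v' l" if "l < K * N" for l
        using fun_cong[OF dd, of l] that by (simp add: d_def)
    qed (use sp kK in \<open>auto simp: spaced_def\<close>)
    define A where "A = {i\<in>{..<n}. dist ((f ^^ i) (v m j)) ((f ^^ i) (v' m j)) > \<gamma>\<^sub>0}"
    define E where "E v = {i\<in>{..<n}. dist ((f ^^ (t v k + i)) (z v)) ((f ^^ i) (letter (ext v) k)) > e}" for v
    have E: "real (card (E v)) < \<delta>\<^sub>2 * n" for v using tr[of v] by (simp add: traced_def E_def)
    have "\<not> A \<subseteq> E v \<union> E v'"
    proof
      assume "A \<subseteq> E v \<union> E v'"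
      then have "card A \<le> card (E v \<union> E v')" by (intro card_mono) (auto simp: E_def)
      also have "\<dots> \<le> card (E v) + card (E v')" by (rule card_Un_le)
      finally have "real (card A) \<le> real (card (E v)) + real (card (E v'))" by simp
      also have "\<dots> < 2 * \<delta>\<^sub>2 * n" using E[of v] E[of v'] by simp
      also have "\<dots> \<le> \<zeta> * n" using \<zeta> by (intro mult_right_mono) auto
      finally show False using far by (simp add: A_def)
    qed
    then obtain i where i: "i \<in> A" "i \<notin> E v" "i \<notin> E v'" by auto
    have in': "i < n" using i by (simp add: A_def)
    let ?i = "t v k + i"
    have "?i < t v (Suc k)" using spaced_step(1)[OF sp[of v], of k] in' by simp
    also have "\<dots> \<le> t v (K * N)" using kK sp[of v] by (simp add: spaced_def strict_mono_less_eq)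
    also have "\<dots> \<le> T" by (rule tT)
    finally have iT: "?i < T" .
    have 1: "dist ((f ^^ ?i) (z v)) ((f ^^ i) (v m j)) \<le> e" using i(2) in' x by (simp add: E_def)
    have 2: "dist ((f ^^ ?i) (z v')) ((f ^^ i) (v' m j)) \<le> e" using i(3) in' x teq by (simp add: E_def)
    have 3: "dist ((f ^^ i) (v m j)) ((f ^^ i) (v' m j)) > \<gamma>\<^sub>0" using i(1) by (simp add: A_def)
    have "dist ((f ^^ i) (v m j)) ((f ^^ i) (v' m j)) \<le> dist ((f ^^ i) (v m j)) ((f ^^ ?i) (z v))
        + dist ((f ^^ ?i) (z v)) ((f ^^ ?i) (z v')) + dist ((f ^^ ?i) (z v')) ((f ^^ i) (v' m j))"
      using dist_triangle[of "(f ^^ i) (v m j)" "(f ^^ i) (v' m j)" "(f ^^ ?i) (z v)"]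
            dist_triangle[of "(f ^^ ?i) (z v)" "(f ^^ i) (v' m j)" "(f ^^ ?i) (z v')"] by linarith
    then have "dist ((f ^^ ?i) (z v)) ((f ^^ ?i) (z v')) > \<epsilon>'"
      using 1 2 3 \<gamma> by (simp add: dist_commute)
    then show ?thesis using iT by blast
  qed
  have "card V \<le> card D * max_separated tracking_set f T \<epsilon>'"
  proof (rule sum_fibre_bound[OF fV, where d = d])
    show "finite D" by (simp add: D_def finite_PiE)
    show "d ` V \<subseteq> D" unfolding D_def d_def using increments_mem[OF sp]
      by (intro image_subsetI restrict_PiE_iff[THEN iffD2] ballI)
    fix c assume "c \<in> D"
    let ?F = "{v\<in>V. d v = c}"
    have ap: "\<exists>i<T. dist ((f ^^ i) (z v)) ((f ^^ i) (z v')) > \<epsilon>'" if "v \<in> ?F" "v' \<in> ?F" "v \<noteq> v'" for v v'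
      using apart that by auto
    have "inj_on z ?F"
    proof (rule inj_onI, rule ccontr)
      fix v v' assume *: "v \<in> ?F" "v' \<in> ?F" "z v = z v'" "v \<noteq> v'"
      from ap[OF *(1,2,4)] show False using *(3) \<epsilon>' by auto
    qed
    then have "card ?F = card (z ` ?F)" by (simp add: card_image)
    also have "\<dots> \<le> max_separated tracking_set f T \<epsilon>'"
    proof (rule card_le_max_separated[OF compact_space Tpos \<epsilon>'])
      show "z ` ?F \<subseteq> tracking_set" using zt tracers_subset by blast
      show "separated_set f T \<epsilon>' (z ` ?F)" unfolding separated_set_iff[OF Tpos] using ap by blast
    qed
    finally show "card ?F \<le> max_separated tracking_set f T \<epsilon>'" .
  qed
  then show ?thesis by (simp add: V_def D_def card_PiE)
qed

text \<open>A point of the core is coded by its phase, its words, the increments of its time sequence, and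
  the covering element visited at each gap or error time; the last component lies in a Hamming ball.\<close>

lemma max_separated_tracking_set_le:
  fixes D :: "'a set" and \<iota> :: "'a \<Rightarrow> 'a" and \<gamma> \<rho> \<sigma> :: real
  assumes D: "finite D" "\<And>x. \<iota> x \<in> D" "\<And>x y. \<iota> x = \<iota> y \<Longrightarrow> dist x y \<le> \<gamma>"
    and \<gamma>: "0 < \<gamma>" "2 * e \<le> \<gamma>" and \<rho>: "\<delta>\<^sub>1 + \<delta>\<^sub>2 \<le> \<rho>"
    and ball: "\<And>(I :: nat set) u. finite I \<Longrightarrow> (\<And>i. i \<in> I \<Longrightarrow> u i \<in> insert None (Some ` D)) \<Longrightarrow>
       real (card {v \<in> PiE I (\<lambda>_. insert None (Some ` D)). real (card {i\<in>I. v i \<noteq> u i}) \<le> \<rho> * card I}) \<le> exp (\<sigma> * card I)"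
    and T: "0 < T" and K: "T + 2 * n * N \<le> K * N * n"
  shows "real (max_separated tracking_set f T \<gamma>) \<le> real (2 * n * N) * real (card W) ^ K * real n ^ (K * N) * exp (\<sigma> * (K * N * n))"
proof -
  obtain E0 where E0: "E0 \<subseteq> tracking_set" "separated_set f T \<gamma> E0" "card E0 = max_separated tracking_set f T \<gamma>"
    by (rule max_separated_attained[where K = tracking_set and f = f, OF compact_space T \<gamma>(1)])
  show ?thesis
  proof (cases "finite E0")
    case False
    then show ?thesis using E0(3) by simp
  next
    case True
    \<comment> \<open>Points of the closure need not trace words; the separated set is first moved
      into \<open>core\<close>, where codes exist.\<close>
    obtain E where E: "finite E" "E \<subseteq> core" "separated_set f T \<gamma> E" "card E = card E0"
      by (rule separated_set_closure[OF continuous T True E0(1)[unfolded tracking_set_def] E0(2)])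
    define L where "L = K * N * n"
    have "\<forall>y\<in>E. \<exists>q. (case q of (s, z, u, t) \<Rightarrow> (f ^^ s) z = y \<and> s < 2 * n * N \<and> (\<forall>m. u m \<in> W) \<and> traced f n \<delta>\<^sub>1 \<delta>\<^sub>2 t e (letter u) z)"
    proof
      fix y assume "y \<in> E"
      then obtain s z where 1: "y = (f ^^ s) z" "s < 2 * n * N" "z \<in> tracers" using E(2) unfolding core_def by blast
      then obtain u t where "\<forall>m. u m \<in> W" "traced f n \<delta>\<^sub>1 \<delta>\<^sub>2 t e (letter u) z" unfolding tracers_def by blast
      then show "\<exists>q. (case q of (s, z, u, t) \<Rightarrow> (f ^^ s) z = y \<and> s < 2 * n * N \<and> (\<forall>m. u m \<in> W) \<and> traced f n \<delta>\<^sub>1 \<delta>\<^sub>2 t e (letter u) z)"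
        using 1 by (intro exI[of _ "(s, z, u, t)"]) simp
    qed
    from bchoice[OF this] obtain q where q: "\<forall>y\<in>E.
        (case q y of (s, z, u, t) \<Rightarrow> (f ^^ s) z = y \<and> s < 2 * n * N \<and> (\<forall>m. u m \<in> W) \<and> traced f n \<delta>\<^sub>1 \<delta>\<^sub>2 t e (letter u) z)" by blast
    define s where "s y = fst (q y)" for y
    define z where "z y = fst (snd (q y))" for y
    define u where "u y = fst (snd (snd (q y)))" for y
    define t where "t y = snd (snd (snd (q y)))" for y
    have q': "(f ^^ s y) (z y) = y \<and> s y < 2 * n * N \<and> (\<forall>m. u y m \<in> W) \<and> traced f n \<delta>\<^sub>1 \<delta>\<^sub>2 (t y) e (letter (u y)) (z y)"
      if "y \<in> E" for y
      using bspec[OF q that] unfolding s_def z_def u_def t_def case_prod_unfold .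
    have sz: "(f ^^ s y) (z y) = y" and s: "s y < 2 * n * N" and u: "u y m \<in> W"
      and tr: "traced f n \<delta>\<^sub>1 \<delta>\<^sub>2 (t y) e (letter (u y)) (z y)" if "y \<in> E" for y m
      using q'[OF that] by blast+
    have sp: "spaced n \<delta>\<^sub>1 (t y)" if "y \<in> E" for y using tr[OF that] unfolding traced_def by blast
    define good where "good y i \<longleftrightarrow> (\<exists>l j. j < n \<and> i = t y l + j \<and> dist ((f ^^ i) (z y)) ((f ^^ j) (letter (u y) l)) \<le> e)" for y i
    \<comment> \<open>At good times the words and increments already locate the orbit up to
      \<open>e\<close>, so a neutral symbol suffices there. Hence \<open>g y\<close> differs from
      the constant word \<open>None\<close> only at bad times, which puts it into the Hamming ball
      \<open>G\<close>.\<close>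
    define g where "g y = restrict (\<lambda>i. if good y i then None else Some (\<iota> ((f ^^ i) (z y)))) {..<L}" for y
    define d where "d y = restrict (\<lambda>k. t y (Suc k) - t y k) {..<K * N}" for y
    define code where "code y = (s y, restrict (u y) {..<K}, d y, g y)" for y
    define G where "G = {v \<in> PiE {..<L} (\<lambda>_. insert None (Some ` D)). real (card {i\<in>{..<L}. v i \<noteq> None}) \<le> \<rho> * card {..<L}}"
    define C where "C = {..<2 * n * N} \<times> PiE {..<K} (\<lambda>_. W) \<times> PiE {..<K * N} (\<lambda>_. {n..<2 * n}) \<times> G"
    have fG: "finite G" unfolding G_def using D(1) by (simp add: finite_PiE)
    have fC: "finite C" unfolding C_def using fG finite_W by (simp add: finite_PiE)
    have gG: "g y \<in> G" if y: "y \<in> E" for y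
    proof -
      have "L \<le> t y (K * N)" using spaced_bounds(1)[OF sp[OF y], of 0 "K * N"] by (simp add: L_def)
      then have "card {i\<in>{..<L}. g y i \<noteq> None} \<le> card {i\<in>{..<t y (K * N)}. \<not> good y i}"
        by (intro card_mono) (auto simp: g_def split: if_splits)
      then have "real (card {i\<in>{..<L}. g y i \<noteq> None}) \<le> real (K * N) * (n * (\<delta>\<^sub>1 + \<delta>\<^sub>2))"
        using traced_bad_times[OF tr[OF y], of "K * N"] by (simp add: good_def)
      also have "\<dots> = (\<delta>\<^sub>1 + \<delta>\<^sub>2) * real L" by (simp add: L_def)
      also have "\<dots> \<le> \<rho> * real L" using \<rho> by (intro mult_right_mono) auto
      finally show ?thesis using D(2) by (auto simp: G_def g_def)
    qed
    have "inj_on code E"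
    proof (rule inj_onI, rule ccontr)
      fix y y' assume y: "y \<in> E" "y' \<in> E" and eq: "code y = code y'" and ne: "y \<noteq> y'"
      have es: "s y = s y'" and eu: "restrict (u y) {..<K} = restrict (u y') {..<K}" and ed: "d y = d y'" and eg: "g y = g y'"
        using eq by (auto simp: code_def)
      obtain l where l: "l < T" "dist ((f ^^ l) y) ((f ^^ l) y') > \<gamma>"
        using E(3) y ne T by (auto simp: separated_set_iff)
      define i where "i = s y + l"
      \<comment> \<open>The phase is below \<open>2 * n * N\<close>, so the separating time falls
        into the coded window.\<close>
      have iL: "i < L" using l(1) s[OF y(1)] K by (simp add: i_def L_def)
      have far: "dist ((f ^^ i) (z y)) ((f ^^ i) (z y')) > \<gamma>"
      proof -
        have "(f ^^ l) ((f ^^ s y) (z y)) = (f ^^ i) (z y)"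
          by (simp add: i_def add.commute[of "s y"] funpow_add)
        moreover have "(f ^^ l) ((f ^^ s y') (z y')) = (f ^^ i) (z y')"
          by (simp add: i_def es add.commute[of "s y'"] funpow_add)
        ultimately show ?thesis using l(2) by (simp only: sz[OF y(1)] sz[OF y(2)])
      qed
      have gi: "g y i = g y' i" using eg by simp
      show False
      proof (cases "good y i")
        case False
        then have "\<not> good y' i" "\<iota> ((f ^^ i) (z y)) = \<iota> ((f ^^ i) (z y'))"
          using gi iL by (auto simp: g_def split: if_splits)
        then show False using D(3) far by force
      next
        case True
        then have "good y' i" using gi iL by (auto simp: g_def split: if_splits)
        then obtain k' j' where 2: "j' < n" "i = t y' k' + j'" "dist ((f ^^ i) (z y')) ((f ^^ j') (letter (u y') k')) \<le> e"
          by (auto simp: good_def)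
        obtain k j where 1: "j < n" "i = t y k + j" "dist ((f ^^ i) (z y)) ((f ^^ j) (letter (u y) k)) \<le> e"
          using True by (auto simp: good_def)
        \<comment> \<open>Blocks from number \<open>K * N\<close> on start after the window, so any
          block containing \<open>i\<close> belongs to a recorded word and has a start fixed by the
          recorded increments.\<close>
        have small: "k < K * N" if "y \<in> E" "i = t y k + j" for y k j
        proof (rule ccontr)
          assume "\<not> k < K * N"
          then have "t y (K * N) \<le> t y k" using sp[OF that(1)] by (simp add: spaced_def strict_mono_less_eq)
          moreover have "L \<le> t y (K * N)" using spaced_bounds(1)[OF sp[OF that(1)], of 0 "K * N"] by (simp add: L_def)
          ultimately show False using that(2) iL by simp
        qed
        have teq: "t y l = t y' l" if "l \<le> K * N" for l
        proof (rule increments_determine[of "t y" "t y'" "K * N" l])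
          show "t y (Suc l) - t y l = t y' (Suc l) - t y' l" if "l < K * N" for l
            using fun_cong[OF ed, of l] that by (simp add: d_def)
        qed (use sp y that in \<open>auto simp: spaced_def\<close>)
        have kK: "k < K * N" "k' < K * N" using small[OF y(1) 1(2)] small[OF y(2) 2(2)] by auto
        \<comment> \<open>Equal starting times and disjoint blocks put \<open>i\<close> at the same
          place of the same letter for both points, which are then within
          \<open>2 * e \<le> \<gamma>\<close>.\<close>
        have "t y k + j = t y k' + j'" using 1(2) 2(2) teq[of k'] kK by simp
        then have kj: "k = k'" "j = j'" using spaced_decomposition_unique[OF sp[OF y(1)] 1(1) 2(1)] by auto
        have "k div N < K" using kK N_pos by (simp add: less_mult_imp_div_less)
        then have "letter (u y) k = letter (u y') k" using fun_cong[OF eu, of "k div N"] by (simp add: letter_def)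
        then have "dist ((f ^^ i) (z y)) ((f ^^ i) (z y')) \<le> e + e"
          using 1(3) 2(3) kj dist_triangle2[of "(f ^^ i) (z y)" "(f ^^ i) (z y')" "(f ^^ j) (letter (u y) k)"] by simp
        then show False using far \<gamma> by simp
      qed
    qed
    moreover have "d y \<in> PiE {..<K * N} (\<lambda>_. {n..<2 * n})" if "y \<in> E" for y
      unfolding d_def using increments_mem[OF sp[OF that]] by (intro restrict_PiE_iff[THEN iffD2] ballI)
    then have "code ` E \<subseteq> C"
      using s u gG by (auto simp: code_def C_def)
    ultimately have "card E \<le> card C" using fC by (intro card_inj_on_le)
    also have "card C = 2 * n * N * (card W ^ K * (n ^ (K * N) * card G))"
      by (simp add: C_def card_cartesian_product card_PiE)
    finally have "real (card E) \<le> real (2 * n * N * (card W ^ K * (n ^ (K * N) * card G)))" by (simp only: of_nat_le_iff)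
    also have "\<dots> = real (2 * n * N) * real (card W) ^ K * real n ^ (K * N) * real (card G)" by simp
    also have "\<dots> \<le> real (2 * n * N) * real (card W) ^ K * real n ^ (K * N) * exp (\<sigma> * (K * N * n))"
      using ball[of "{..<L}" "\<lambda>_. None"] by (intro mult_left_mono) (auto simp: G_def L_def)
    finally show ?thesis using E E0 by simp
  qed
qed

text \<open>Per unit time a code costs \<open>b\<close> for the words, \<open>ln n / n\<close> for
  the increments and \<open>\<sigma>\<close> for the bad times. The phase and the overshoot beyond
  \<open>T\<close> cost a constant, which vanishes in the limit.\<close>

lemma entropy_at_scale_tracking_set_le:
  fixes D :: "'a set" and \<iota> :: "'a \<Rightarrow> 'a" and \<gamma> \<rho> \<sigma> b :: real
  assumes D: "finite D" "\<And>x. \<iota> x \<in> D" "\<And>x y. \<iota> x = \<iota> y \<Longrightarrow> dist x y \<le> \<gamma>"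
    and \<gamma>: "0 < \<gamma>" "2 * e \<le> \<gamma>" and \<rho>: "\<delta>\<^sub>1 + \<delta>\<^sub>2 \<le> \<rho>"
    and ball: "\<And>(I :: nat set) u. finite I \<Longrightarrow> (\<And>i. i \<in> I \<Longrightarrow> u i \<in> insert None (Some ` D)) \<Longrightarrow>
       real (card {v \<in> PiE I (\<lambda>_. insert None (Some ` D)). real (card {i\<in>I. v i \<noteq> u i}) \<le> \<rho> * card I}) \<le> exp (\<sigma> * card I)"
    and \<sigma>: "0 < \<sigma>" and W: "ln (real (card W)) \<le> n * N * b" and b: "0 \<le> b"
  shows "entropy_at_scale tracking_set f \<gamma> \<le> ereal (b + ln n / n + \<sigma>)"
proof -
  define b' where "b' = b + ln n / n + \<sigma>"
  have b': "0 \<le> b'" using b n_pos \<sigma> by (simp add: b'_def)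
  define C where "C = ln (2 * n * N) + 3 * n * N * b'"
  have "1 \<le> 2 * n * N" using n_pos N_pos by (simp add: Suc_le_eq)
  then have "1 \<le> real (2 * n * N)" by (metis of_nat_1 of_nat_le_iff)
  then have lnN: "0 \<le> ln (real (2 * n * N))" by simp
  then have C0: "0 \<le> C" using b' by (simp add: C_def)
  have cW: "0 < card W" using finite_W W_nonempty by (simp add: card_gt_0_iff)
  have bnd: "ln (real (max_separated tracking_set f T \<gamma>)) \<le> C + T * b'" if T: "0 < T" for T
  proof (cases "max_separated tracking_set f T \<gamma> = 0")
    case True
    then show ?thesis using C0 b' by simp
  next
    case False
    \<comment> \<open>Enough words to cover time \<open>T\<close> plus the largest phase; rounding
      up to whole words keeps the overshoot within \<open>3 * n * N\<close>.\<close>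
    define K where "K = (T + 2 * n * N) div (N * n) + 1"
    have Nn: "0 < N * n" using n_pos N_pos by simp
    have Kge: "T + 2 * n * N \<le> K * N * n"
    proof -
      have "T + 2 * n * N < (T + 2 * n * N) div (N * n) * (N * n) + N * n"
        using Nn by (metis add_strict_left_mono div_mult_mod_eq mod_less_divisor)
      also have "\<dots> = K * N * n" by (simp add: K_def algebra_simps)
      finally show ?thesis by simp
    qed
    have Kle: "K * N * n \<le> T + 3 * n * N"
    proof -
      have "K * N * n = (T + 2 * n * N) div (N * n) * (N * n) + N * n" by (simp add: K_def algebra_simps)
      also have "\<dots> \<le> (T + 2 * n * N) + N * n" by (intro add_right_mono div_times_less_eq_dividend)
      finally show ?thesis by (simp add: algebra_simps)
    qed
    have "real (max_separated tracking_set f T \<gamma>) \<le> real (2 * n * N) * real (card W) ^ K * real n ^ (K * N) * exp (\<sigma> * (K * N * n))"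
      by (rule max_separated_tracking_set_le[OF D \<gamma> \<rho> ball T Kge])
    then have "ln (real (max_separated tracking_set f T \<gamma>)) \<le> ln (real (2 * n * N) * real (card W) ^ K * real n ^ (K * N) * exp (\<sigma> * (K * N * n)))"
      using False by (intro ln_mono) auto
    also have "\<dots> = ln (real (2 * n * N)) + K * ln (real (card W)) + K * N * ln n + \<sigma> * (K * N * n)"
      using cW n_pos N_pos by (simp add: ln_mult ln_realpow)
    also have "\<dots> \<le> ln (real (2 * n * N)) + K * (n * N * b) + K * N * ln n + \<sigma> * (K * N * n)"
      using mult_left_mono[OF W, of "real K"] by simp
    also have "\<dots> = ln (real (2 * n * N)) + real (K * N * n) * b'"
      using n_pos by (simp add: b'_def field_simps)
    also have "\<dots> \<le> ln (real (2 * n * N)) + real (T + 3 * n * N) * b'"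
      using Kle b' by (intro add_left_mono mult_right_mono) (simp_all only: of_nat_le_iff)
    also have "\<dots> = C + T * b'" by (simp add: C_def algebra_simps)
    finally show ?thesis .
  qed
  have lim: "(\<lambda>T. ereal (C / real T + b')) \<longlonglongrightarrow> ereal (0 + b')"
    by (intro tendsto_ereal tendsto_add lim_const_over_n tendsto_const)
  have "entropy_at_scale tracking_set f \<gamma> \<le> limsup (\<lambda>T. ereal (C / real T + b'))"
    unfolding entropy_at_scale_def
  proof (rule Limsup_mono, rule eventually_mono[OF eventually_gt_at_top[of 0]])
    fix T :: nat assume T: "0 < T"
    have "ln (real (max_separated tracking_set f T \<gamma>)) / T \<le> (C + T * b') / T"
      using bnd[OF T] by (intro divide_right_mono) auto
    then show "ereal (ln (real (max_separated tracking_set f T \<gamma>)) / real T) \<le> ereal (C / real T + b')"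
      using T by (simp add: add_divide_distrib)
  qed
  also have "\<dots> = ereal b'" using lim_imp_Limsup[OF sequentially_bot lim] by simp
  finally show ?thesis by (simp add: b'_def)
qed

text \<open>A limsup can be bounded below along a subsequence, here the times \<open>T K\<close> by
  which \<open>K\<close> words have surely been traced. Gaps stretch time by
  \<open>1 + \<delta>\<^sub>1\<close>; the second \<open>\<delta>\<^sub>1\<close> absorbs the
  rounding to an integer, by \<open>n\<delta>\<close>.\<close>

lemma entropy_at_scale_tracking_set_ge:
  fixes \<zeta> \<gamma>\<^sub>0 \<epsilon>' b :: real
  assumes tracing: "\<And>x. \<exists>t z. traced f n \<delta>\<^sub>1 \<delta>\<^sub>2 t e x z"
    and sep: "\<And>w w'. w \<in> W \<Longrightarrow> w' \<in> W \<Longrightarrow> w \<noteq> w' \<Longrightarrow>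
      \<exists>j<N. \<zeta> * n \<le> card {i\<in>{..<n}. dist ((f ^^ i) (w j)) ((f ^^ i) (w' j)) > \<gamma>\<^sub>0}"
    and \<zeta>: "2 * \<delta>\<^sub>2 \<le> \<zeta>" and \<gamma>: "2 * e + \<epsilon>' \<le> \<gamma>\<^sub>0" and \<epsilon>': "0 < \<epsilon>'"
    and W: "n * N * b \<le> ln (real (card W))" and b: "ln n / n \<le> b" and n\<delta>: "1 \<le> n * \<delta>\<^sub>1"
  shows "ereal ((b - ln n / n) / (1 + 2 * \<delta>\<^sub>1)) \<le> entropy_at_scale tracking_set f \<epsilon>'"
proof -
  define c where "c = b - ln n / n"
  define T where "T K = nat \<lceil>real (K * N) * (n * (1 + \<delta>\<^sub>1))\<rceil>" for K
  define x where "x T = ln (real (max_separated tracking_set f T \<epsilon>')) / real T" for T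
  have c: "0 \<le> c" using b by (simp add: c_def)
  have cW: "0 < card W" using finite_W W_nonempty by (simp add: card_gt_0_iff)
  have TK: "K \<le> T K" "c / (1 + 2 * \<delta>\<^sub>1) \<le> x (T K)" if K: "0 < K" for K
  proof -
    have T1: "real (K * N) * (n * (1 + \<delta>\<^sub>1)) \<le> T K" by (simp add: T_def real_nat_ceiling_ge)
    have "1 \<le> K * N" "K \<le> K * N" "1 \<le> n" using K N_pos n_pos by (auto simp: Suc_le_eq)
    then have KN: "1 \<le> real (K * N)" "real K \<le> real (K * N)" "1 \<le> real n"
      by (metis of_nat_1 of_nat_le_iff)+
    have "real K \<le> real (K * N) * (n * (1 + \<delta>\<^sub>1))"
    proof -
      have "1 * 1 \<le> n * (1 + \<delta>\<^sub>1)" using KN \<delta>\<^sub>1 by (intro mult_mono) auto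
      then have "real (K * N) * 1 \<le> real (K * N) * (n * (1 + \<delta>\<^sub>1))" by (intro mult_left_mono) auto
      then show ?thesis using KN by simp
    qed
    then show KT: "K \<le> T K" using T1 by linarith
    have T2: "real (T K) \<le> real (K * N * n) * (1 + 2 * \<delta>\<^sub>1)"
    proof -
      define r where "r = real (K * N) * (n * (1 + \<delta>\<^sub>1))"
      have "0 \<le> r" using \<delta>\<^sub>1 by (simp add: r_def)
      then have "real (nat \<lceil>r\<rceil>) = real_of_int \<lceil>r\<rceil>" by simp
      then have "real (T K) \<le> r + 1" using ceiling_correct[of r] unfolding T_def r_def by linarith
      then have "real (T K) \<le> real (K * N) * (n * (1 + \<delta>\<^sub>1)) + 1" by (simp only: r_def)
      moreover have "1 * 1 \<le> real (K * N) * (n * \<delta>\<^sub>1)" using KN(1) n\<delta> by (intro mult_mono) auto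
      ultimately show ?thesis by (simp add: algebra_simps)
    qed
    have "card W ^ K \<le> n ^ (K * N) * max_separated tracking_set f (T K) \<epsilon>'"
      by (rule card_word_power_le[OF tracing sep \<zeta> \<gamma> \<epsilon>' K T1])
    then have le: "real (card W ^ K) \<le> real (n ^ (K * N) * max_separated tracking_set f (T K) \<epsilon>')"
      by (rule of_nat_mono)
    have pos: "0 < real (card W ^ K)" using cW by simp
    have s: "0 < real (max_separated tracking_set f (T K) \<epsilon>')"
    proof (rule ccontr)
      assume "\<not> ?thesis"
      then have "real (n ^ (K * N) * max_separated tracking_set f (T K) \<epsilon>') = 0" by simp
      with le pos show False by linarith
    qed
    have "ln (real (card W ^ K)) \<le> ln (real (n ^ (K * N) * max_separated tracking_set f (T K) \<epsilon>'))"
      using le pos by (intro ln_mono)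
    then have "K * ln (real (card W)) \<le> K * N * ln n + ln (real (max_separated tracking_set f (T K) \<epsilon>'))"
      using cW n_pos s by (simp add: ln_mult ln_realpow)
    moreover have "K * (n * N * b) \<le> K * ln (real (card W))" using W by (intro mult_left_mono) auto
    moreover have "K * (n * N * b) - K * N * ln n = real (K * N * n) * c" using n_pos by (simp add: c_def field_simps)
    ultimately have "real (K * N * n) * c \<le> ln (real (max_separated tracking_set f (T K) \<epsilon>'))" by linarith
    then have "real (K * N * n) * c / T K \<le> x (T K)" unfolding x_def by (intro divide_right_mono) auto
    moreover have "c / (1 + 2 * \<delta>\<^sub>1) \<le> real (K * N * n) * c / T K"
    proof -
      have Tpos: "0 < real (T K)" using KT K by simp
      have "c * real (T K) \<le> c * (real (K * N * n) * (1 + 2 * \<delta>\<^sub>1))" using T2 c by (intro mult_left_mono)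
      then show ?thesis using Tpos \<delta>\<^sub>1 by (simp add: field_simps)
    qed
    ultimately show "c / (1 + 2 * \<delta>\<^sub>1) \<le> x (T K)" by linarith
  qed
  show ?thesis
  proof (rule ccontr)
    assume "\<not> ?thesis"
    then have "limsup (\<lambda>T. ereal (x T)) < ereal (c / (1 + 2 * \<delta>\<^sub>1))"
      by (simp add: entropy_at_scale_def x_def c_def)
    then have "\<forall>\<^sub>F T in sequentially. ereal (x T) < ereal (c / (1 + 2 * \<delta>\<^sub>1))" by (rule Limsup_lessD)
    then obtain T0 where T0: "\<And>T. T0 \<le> T \<Longrightarrow> x T < c / (1 + 2 * \<delta>\<^sub>1)" by (auto simp: eventually_sequentially)
    show False using TK[of "Suc T0"] T0[of "T (Suc T0)"] by simp
  qed
qed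

end

section \<open>Word selection\<close>


text \<open>One point is taken from each cell that meets \<open>C\<close>, so their names are
  distinct. Off \<open>B\<^sub>0\<close>, points of different cells are more than
  \<open>\<gamma>\<^sub>0\<close> apart; hence two points that are far apart at fewer than
  \<open>\<zeta> * n\<close> times have names within Hamming distance
  \<open>(2 * \<kappa> + \<zeta>) * n\<close>. At most \<open>exp (\<sigma> * n)\<close> names are
  that near to a given one, and the greedy bound applies.\<close>

lemma hamming_separated_subset:
  fixes f :: "'a::metric_space \<Rightarrow> 'a" and \<kappa> \<zeta> \<rho> \<sigma> \<gamma>\<^sub>0 :: real
  assumes P: "finite P" "\<And>z. z \<in> cell z" "\<And>z. cell z \<in> P" "\<And>z A. A \<in> P \<Longrightarrow> z \<in> A \<Longrightarrow> cell z = A"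
    and far: "\<And>x y. x \<notin> B\<^sub>0 \<Longrightarrow> y \<notin> B\<^sub>0 \<Longrightarrow> cell x \<noteq> cell y \<Longrightarrow> \<gamma>\<^sub>0 < dist x y"
    and ball: "\<And>(I :: nat set) u. finite I \<Longrightarrow> (\<And>i. i \<in> I \<Longrightarrow> u i \<in> P) \<Longrightarrow>
       real (card {v \<in> PiE I (\<lambda>_. P). real (card {i\<in>I. v i \<noteq> u i}) \<le> \<rho> * card I}) \<le> exp (\<sigma> * card I)"
    and C: "C \<noteq> {}" "\<And>x. x \<in> C \<Longrightarrow> card {i\<in>{..<n}. (f ^^ i) x \<in> B\<^sub>0} \<le> \<kappa> * n"
    and n: "0 < n" and \<zeta>: "0 < \<zeta>" "2 * \<kappa> + \<zeta> \<le> \<rho>" and \<gamma>\<^sub>0: "0 < \<gamma>\<^sub>0"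
  obtains E where "finite E" "E \<noteq> {}" "E \<subseteq> C"
    "\<And>x y. x \<in> E \<Longrightarrow> y \<in> E \<Longrightarrow> x \<noteq> y \<Longrightarrow> \<zeta> * n \<le> card {i\<in>{..<n}. \<gamma>\<^sub>0 < dist ((f ^^ i) x) ((f ^^ i) y)}"
    "real (card {A \<in> dynamical_join f P n. A \<inter> C \<noteq> {}}) \<le> card E * exp (\<sigma> * n)"
proof -
  define S where "S = {A \<in> dynamical_join f P n. A \<inter> C \<noteq> {}}"
  have fS: "finite S" using finite_dynamical_join[OF P(1)] by (simp add: S_def)
  have "\<forall>A\<in>S. \<exists>x. x \<in> A \<inter> C" by (auto simp: S_def)
  from bchoice[OF this] obtain r where r: "\<And>A. A \<in> S \<Longrightarrow> r A \<in> A" "\<And>A. A \<in> S \<Longrightarrow> r A \<in> C" by blast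
  define name where "name x = restrict (\<lambda>i. cell ((f ^^ i) x)) {..<n}" for x
  have A: "A = (\<Inter>i<n. (f ^^ i) -` name (r A) i)" if A: "A \<in> S" for A
  proof -
    obtain c where c: "A = (\<Inter>i<n. (f ^^ i) -` c i)" "\<forall>i<n. c i \<in> P" using A by (auto simp: S_def dynamical_join_def)
    have "c i = name (r A) i" if "i < n" for i
    proof -
      have "(f ^^ i) (r A) \<in> c i" using r(1)[OF A] c(1) that by auto
      then show ?thesis using P(4)[of "c i" "(f ^^ i) (r A)"] c(2) that by (simp add: name_def)
    qed
    then show ?thesis using c(1) by auto
  qed
  have inj_name: "inj_on (\<lambda>A. name (r A)) S"
  proof (rule inj_onI)
    fix A1 A2 assume "A1 \<in> S" "A2 \<in> S" and eq: "name (r A1) = name (r A2)"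
    then show "A1 = A2" using trans[OF A[of A1, unfolded eq] A[of A2, symmetric]] by simp
  qed
  then have inj_r: "inj_on r S" and inj_nr: "inj_on name (r ` S)"
    by (auto simp: inj_on_def)
  define Y where "Y = r ` S"
  have fY: "finite Y" using fS by (simp add: Y_def)
  have YC: "Y \<subseteq> C" using r(2) by (auto simp: Y_def)
  define R where "R x y \<longleftrightarrow> card {i\<in>{..<n}. \<gamma>\<^sub>0 < dist ((f ^^ i) x) ((f ^^ i) y)} < \<zeta> * n" for x y
  have ballY: "real (card {x\<in>Y. R x y}) \<le> exp (\<sigma> * n)" if y: "y \<in> Y" for y
  proof -
    define V where "V = {v \<in> PiE {..<n} (\<lambda>_. P). real (card {i\<in>{..<n}. v i \<noteq> name y i}) \<le> \<rho> * card {..<n}}"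
    have fV: "finite V" using P(1) by (simp add: V_def finite_PiE)
    have "name x \<in> V" if x: "x \<in> Y" "R x y" for x
    proof -
      have "{i\<in>{..<n}. name x i \<noteq> name y i} \<subseteq> {i\<in>{..<n}. (f ^^ i) x \<in> B\<^sub>0} \<union> {i\<in>{..<n}. (f ^^ i) y \<in> B\<^sub>0}
         \<union> {i\<in>{..<n}. \<gamma>\<^sub>0 < dist ((f ^^ i) x) ((f ^^ i) y)}"
        using far by (auto simp: name_def)
      then have "card {i\<in>{..<n}. name x i \<noteq> name y i} \<le> card ({i\<in>{..<n}. (f ^^ i) x \<in> B\<^sub>0} \<union> {i\<in>{..<n}. (f ^^ i) y \<in> B\<^sub>0}
         \<union> {i\<in>{..<n}. \<gamma>\<^sub>0 < dist ((f ^^ i) x) ((f ^^ i) y)})" by (intro card_mono) auto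
      also have "\<dots> \<le> card {i\<in>{..<n}. (f ^^ i) x \<in> B\<^sub>0} + card {i\<in>{..<n}. (f ^^ i) y \<in> B\<^sub>0}
         + card {i\<in>{..<n}. \<gamma>\<^sub>0 < dist ((f ^^ i) x) ((f ^^ i) y)}"
        by (intro order_trans[OF card_Un_le] add_right_mono card_Un_le)
      finally have "real (card {i\<in>{..<n}. name x i \<noteq> name y i}) \<le> real (card {i\<in>{..<n}. (f ^^ i) x \<in> B\<^sub>0}) + card {i\<in>{..<n}. (f ^^ i) y \<in> B\<^sub>0}
         + card {i\<in>{..<n}. \<gamma>\<^sub>0 < dist ((f ^^ i) x) ((f ^^ i) y)}" by simp
      also have "\<dots> \<le> \<kappa> * n + \<kappa> * n + \<zeta> * n"
        using C(2)[of x] C(2)[of y] x y YC by (intro add_mono) (auto simp: R_def)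
      also have "\<dots> = (2 * \<kappa> + \<zeta>) * n" by (simp add: algebra_simps)
      also have "\<dots> \<le> \<rho> * n" using \<zeta> by (intro mult_right_mono) auto
      finally show ?thesis using P(3) by (simp add: V_def name_def)
    qed
    then have "card {x\<in>Y. R x y} \<le> card V"
      using inj_nr fV by (intro card_inj_on_le[of name]) (auto simp: Y_def intro: inj_on_subset)
    also have "real (card V) \<le> exp (\<sigma> * n)"
      using ball[of "{..<n}" "name y"] P(3) by (simp add: V_def name_def)
    finally show ?thesis by simp
  qed
  have "symp R" by (auto simp: R_def symp_def dist_commute)
  moreover have "reflp R" using \<zeta>(1) n \<gamma>\<^sub>0 by (auto simp: R_def reflp_def)
  ultimately obtain E where E: "E \<subseteq> Y" "\<forall>x\<in>E. \<forall>y\<in>E. x \<noteq> y \<longrightarrow> \<not> R x y" "real (card Y) \<le> card E * exp (\<sigma> * n)"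
    using separated_subset_of_ball_bound[where R = R, OF fY _ _ ballY] by blast
  have cY: "card Y = card S" using inj_r by (simp add: Y_def card_image)
  have "S \<noteq> {}"
  proof -
    obtain x where x: "x \<in> C" using C(1) by auto
    have "(\<Inter>i<n. (f ^^ i) -` cell ((f ^^ i) x)) \<in> dynamical_join f P n"
      unfolding dynamical_join_def by (intro CollectI exI[of _ "\<lambda>i. cell ((f ^^ i) x)"]) (simp add: P(3))
    moreover have "x \<in> (\<Inter>i<n. (f ^^ i) -` cell ((f ^^ i) x))" using P(2) by simp
    ultimately have "(\<Inter>i<n. (f ^^ i) -` cell ((f ^^ i) x)) \<in> S" unfolding S_def using x by blast
    then show ?thesis by auto
  qed
  then have "E \<noteq> {}" using E(3) cY fS by (auto simp: card_gt_0_iff)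
  then show ?thesis
  proof (rule that[rotated 1])
    show "finite E" using E(1) fY finite_subset by blast
    show "E \<subseteq> C" using E(1) YC by blast
    show "\<zeta> * n \<le> card {i\<in>{..<n}. \<gamma>\<^sub>0 < dist ((f ^^ i) x) ((f ^^ i) y)}" if "x \<in> E" "y \<in> E" "x \<noteq> y" for x y
      using E(2) that by (auto simp: R_def not_less)
    show "real (card {A \<in> dynamical_join f P n. A \<inter> C \<noteq> {}}) \<le> card E * exp (\<sigma> * n)"
      using E(3) cY by (simp add: S_def)
  qed
qed

text \<open>Each pair of disjoint compact sets has a positive gap; arguing with all sufficiently
  small numbers avoids a minimum over a possibly empty set of pairs.\<close>

lemma disjoint_compact_family_gap:
  fixes B :: "'i \<Rightarrow> 'a::metric_space set"
  assumes I: "finite I" and B: "\<And>i. i \<in> I \<Longrightarrow> compact (B i)" and disj: "\<And>i j. i \<in> I \<Longrightarrow> j \<in> I \<Longrightarrow> i \<noteq> j \<Longrightarrow> B i \<inter> B j = {}"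
  obtains \<gamma> :: real where "0 < \<gamma>" "\<And>i j x y. i \<in> I \<Longrightarrow> j \<in> I \<Longrightarrow> i \<noteq> j \<Longrightarrow> x \<in> B i \<Longrightarrow> y \<in> B j \<Longrightarrow> \<gamma> < dist x y"
proof -
  have "\<forall>\<^sub>F d in at_right (0::real). i \<noteq> j \<longrightarrow> (\<forall>x\<in>B i. \<forall>y\<in>B j. d < dist x y)" if ij: "i \<in> I" "j \<in> I" for i j
  proof (cases "i = j")
    case False
    have "\<exists>d0>0. \<forall>x\<in>B i. \<forall>y\<in>B j. d0 \<le> dist x y"
    proof (cases "B i \<times> B j = {}")
      case ne: False
      have "compact (B i \<times> B j)" using B ij by (intro compact_Times) auto
      moreover have "continuous_on (B i \<times> B j) (\<lambda>p. dist (fst p) (snd p))" by (intro continuous_intros)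
      ultimately obtain p where p: "p \<in> B i \<times> B j" "\<And>q. q \<in> B i \<times> B j \<Longrightarrow> dist (fst p) (snd p) \<le> dist (fst q) (snd q)"
        using continuous_attains_inf[OF _ ne] by blast
      have "0 < dist (fst p) (snd p)" using p(1) disj[OF ij False] by auto
      moreover have "dist (fst p) (snd p) \<le> dist x y" if "x \<in> B i" "y \<in> B j" for x y
        using p(2)[of "(x, y)"] that by simp
      ultimately show ?thesis by blast
    qed (auto intro: exI[of _ 1])
    then obtain d0 where d0: "d0 > 0" "\<forall>x\<in>B i. \<forall>y\<in>B j. d0 \<le> dist x y" by blast
    have "\<forall>\<^sub>F d in at_right (0::real). d < d0" by (rule order_tendstoD(2)[OF tendsto_ident_at d0(1)])
    then show ?thesis by eventually_elim (use d0 in force)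
  qed auto
  then have "\<forall>\<^sub>F d in at_right (0::real). \<forall>i\<in>I. \<forall>j\<in>I. i \<noteq> j \<longrightarrow> (\<forall>x\<in>B i. \<forall>y\<in>B j. d < dist x y)"
    using I by (simp add: eventually_ball_finite_distrib)
  then have "\<forall>\<^sub>F d in at_right (0::real). 0 < d \<and> (\<forall>i\<in>I. \<forall>j\<in>I. i \<noteq> j \<longrightarrow> (\<forall>x\<in>B i. \<forall>y\<in>B j. d < dist x y))"
    using eventually_at_right_less by (rule eventually_conj[rotated])
  from eventually_happens'[OF trivial_limit_at_right_real this]
  obtain d :: real where "0 < d" "\<forall>i\<in>I. \<forall>j\<in>I. i \<noteq> j \<longrightarrow> (\<forall>x\<in>B i. \<forall>y\<in>B j. d < dist x y)" by auto
  then show ?thesis by (intro that[of d]) auto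
qed


text \<open>The budget \<open>\<tau>\<close> is spent in quarters: the choice of a class, the
  Hamming balls, the bad classes, and the rounding of the schedule. Likewise \<open>\<eta>\<close>
  is spent in thirds: the spread within a class, the rounding of the schedule, and the distance of
  the averaged class means from 0. The left side of \<open>Q\<close> bounds the logarithm of the
  number of classes and is the same for all \<open>n\<close>.\<close>

lemma block_words_exist:
  fixes f :: "'a::metric_space \<Rightarrow> 'a" and M :: "'a measure" and F :: "('a \<Rightarrow> real) set"
    and \<kappa> \<zeta> \<rho> \<gamma>\<^sub>0 \<tau> \<eta> B h :: real and n :: nat
  assumes mp: "measure_preserving_map M f"
    and P: "finite P" "P \<subseteq> sets M" "partition_on UNIV P"
    and cell: "\<And>z. z \<in> cell z" "\<And>z. cell z \<in> P" "\<And>z A. A \<in> P \<Longrightarrow> z \<in> A \<Longrightarrow> cell z = A"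
    and far: "\<And>x y. x \<notin> B\<^sub>0 \<Longrightarrow> y \<notin> B\<^sub>0 \<Longrightarrow> cell x \<noteq> cell y \<Longrightarrow> \<gamma>\<^sub>0 < dist x y"
    and ball: "\<And>(I :: nat set) u. finite I \<Longrightarrow> (\<And>i. i \<in> I \<Longrightarrow> u i \<in> P) \<Longrightarrow>
       real (card {v \<in> PiE I (\<lambda>_. P). real (card {i\<in>I. v i \<noteq> u i}) \<le> \<rho> * card I}) \<le> exp (\<tau> / 4 * card I)"
    and B\<^sub>0: "B\<^sub>0 \<in> sets M" "measure M B\<^sub>0 \<le> \<kappa> * \<kappa>"
    and \<kappa>: "0 < \<kappa>" "\<kappa> * ln (card P) \<le> \<tau> / 4" and \<zeta>: "0 < \<zeta>" "2 * \<kappa> + \<zeta> \<le> \<rho>" and \<gamma>\<^sub>0: "0 < \<gamma>\<^sub>0"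
    and F: "finite F" "\<And>\<phi>. \<phi> \<in> F \<Longrightarrow> integrable M \<phi>" "\<And>\<phi>. \<phi> \<in> F \<Longrightarrow> (\<integral>x. \<phi> x \<partial>M) = 0" "\<And>\<phi> x. \<phi> \<in> F \<Longrightarrow> \<bar>\<phi> x\<bar> \<le> B"
    and \<tau>: "0 < \<tau>" and \<eta>: "0 < \<eta>" and n: "0 < n"
    and h: "h * n < partition_entropy M (dynamical_join f P n)"
    and Q: "ln (card ((UNIV :: bool set) \<times> PiE F (\<lambda>_. {\<lfloor>- (B / (\<eta> / 3))\<rfloor>..\<lfloor>B / (\<eta> / 3)\<rfloor>}))) \<le> n * (\<tau> / 4)"
  shows "\<exists>N W. 0 < N \<and> finite W \<and> W \<noteq> {} \<and> n * N * (h - \<tau>) \<le> ln (real (card W)) \<and>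
     (\<forall>w\<in>W. \<forall>\<phi>\<in>F. \<bar>\<Sum>j<N. \<Sum>i<n. \<phi> ((f ^^ i) (w j))\<bar> \<le> n * N * \<eta>) \<and>
     (\<forall>w\<in>W. \<forall>w'\<in>W. w \<noteq> w' \<longrightarrow> (\<exists>j<N. \<zeta> * n \<le> card {i\<in>{..<n}. \<gamma>\<^sub>0 < dist ((f ^^ i) (w j)) ((f ^^ i) (w' j))}))"
proof -
  interpret measure_preserving_map M f by (rule mp)
  have disjP: "disjoint P" and UP: "\<Union>P = UNIV" using P(3) by (auto simp: partition_on_def)
  \<comment> \<open>Bad points visit \<open>B\<^sub>0\<close> too often for their names to be read off the orbit; each bad class
    contributes one point only, which is harmless as the bad points have measure at most \<open>\<kappa>\<close>.\<close>
  define J where "J = dynamical_join f P n"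
  have J: "finite J" "J \<subseteq> sets M" "disjoint J" "\<Union>J = space M"
    unfolding J_def using P disjP UP space_UNIV
    by (simp_all add: finite_dynamical_join disjoint_dynamical_join Union_dynamical_join measurable_dynamical_join[OF f_measurable])
  have cP: "1 \<le> card P"
  proof -
    have "P \<noteq> {}" using UP by auto
    then show ?thesis using P(1) by (simp add: Suc_le_eq card_gt_0_iff)
  qed
  define \<theta> where "\<theta> = \<eta> / 3"
  have \<theta>: "0 < \<theta>" using \<eta> by (simp add: \<theta>_def)
  define bad where "bad x \<longleftrightarrow> \<kappa> * n < card {i\<in>{..<n}. (f ^^ i) x \<in> B\<^sub>0}" for x
  define S where "S \<phi> x = (\<Sum>i<n. \<phi> ((f ^^ i) x))" for \<phi> :: "'a \<Rightarrow> real" and x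
  define c where "c x = (bad x, restrict (\<lambda>\<phi>. \<lfloor>S \<phi> x / (n * \<theta>)\<rfloor>) F)" for x
  define I where "I = range c"
  define C where "C i = c -` {i}" for i
  have badm: "{x. bad x} \<in> sets M" and badk: "measure M {x. bad x} \<le> \<kappa>"
  proof -
    show "{x. bad x} \<in> sets M" unfolding bad_def by (rule measure_frequent_visits_le(1)[OF B\<^sub>0(1) \<kappa>(1) n])
    have "measure M {x. bad x} \<le> measure M B\<^sub>0 / \<kappa>" unfolding bad_def by (rule measure_frequent_visits_le(2)[OF B\<^sub>0(1) \<kappa>(1) n])
    also have "\<dots> \<le> \<kappa> * \<kappa> / \<kappa>" using B\<^sub>0(2) \<kappa>(1) by (intro divide_right_mono) auto
    finally show "measure M {x. bad x} \<le> \<kappa>" using \<kappa>(1) by simp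
  qed
  have Sint: "integrable M (S \<phi>)" if "\<phi> \<in> F" for \<phi>
    unfolding S_def using F(2)[OF that] by (intro Bochner_Integration.integrable_sum integrable_compose_funpow)
  have "I \<subseteq> (UNIV :: bool set) \<times> PiE F (\<lambda>_. {\<lfloor>- (B / \<theta>)\<rfloor>..\<lfloor>B / \<theta>\<rfloor>})"
  proof -
    have "\<lfloor>S \<phi> x / (n * \<theta>)\<rfloor> \<in> {\<lfloor>- (B / \<theta>)\<rfloor>..\<lfloor>B / \<theta>\<rfloor>}" if \<phi>: "\<phi> \<in> F" for \<phi> x
    proof -
      have "\<bar>S \<phi> x\<bar> \<le> (\<Sum>i<n. B)" unfolding S_def by (intro order_trans[OF sum_abs] sum_mono F(4)[OF \<phi>])
      then have "\<bar>S \<phi> x\<bar> / (n * \<theta>) \<le> (n * B) / (n * \<theta>)" using \<theta> by (intro divide_right_mono) auto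
      also have "\<dots> = B / \<theta>" using n by simp
      finally have "\<bar>S \<phi> x / (n * \<theta>)\<bar> \<le> B / \<theta>" using \<theta> by (simp add: abs_divide abs_mult)
      then have "- (B / \<theta>) \<le> S \<phi> x / (n * \<theta>)" "S \<phi> x / (n * \<theta>) \<le> B / \<theta>"
        by (simp_all only: abs_le_iff minus_le_iff)
      then show ?thesis by (simp add: floor_mono)
    qed
    then have restr: "restrict (\<lambda>\<phi>. \<lfloor>S \<phi> x / (n * \<theta>)\<rfloor>) F \<in> PiE F (\<lambda>_. {\<lfloor>- (B / \<theta>)\<rfloor>..\<lfloor>B / \<theta>\<rfloor>})" for x
      by (intro restrict_PiE_iff[THEN iffD2] ballI)
    show ?thesis unfolding I_def c_def by (intro image_subsetI SigmaI UNIV_I restr)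
  qed
  moreover have fQ: "finite ((UNIV :: bool set) \<times> PiE F (\<lambda>_. {\<lfloor>- (B / \<theta>)\<rfloor>..\<lfloor>B / \<theta>\<rfloor>}))"
    using F(1) by (simp add: finite_PiE)
  ultimately have fI: "finite I" and cI: "card I \<le> card ((UNIV :: bool set) \<times> PiE F (\<lambda>_. {\<lfloor>- (B / \<theta>)\<rfloor>..\<lfloor>B / \<theta>\<rfloor>}))"
    by (auto intro: finite_subset card_mono)
  have Ine: "I \<noteq> {}" by (simp add: I_def)
  have lnI: "ln (real (card I)) \<le> n * (\<tau> / 4)"
  proof -
    have "0 < card I" using fI Ine by (simp add: card_gt_0_iff)
    then have "ln (real (card I)) \<le> ln (real (card ((UNIV :: bool set) \<times> PiE F (\<lambda>_. {\<lfloor>- (B / \<theta>)\<rfloor>..\<lfloor>B / \<theta>\<rfloor>}))))"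
      using cI by (intro ln_mono) (simp_all only: of_nat_le_iff of_nat_0_less_iff)
    then show ?thesis using Q by (simp only: \<theta>_def)
  qed
  have Cm: "C i \<in> sets M" if i: "i \<in> I" for i
  proof -
    have "C i = {x. bad x = fst i} \<inter> {x\<in>space M. \<forall>\<phi>\<in>F. \<lfloor>S \<phi> x / (n * \<theta>)\<rfloor> = snd i \<phi>}"
    proof -
      have "restrict g F = snd i \<longleftrightarrow> (\<forall>\<phi>\<in>F. g \<phi> = snd i \<phi>)" for g
      proof -
        obtain y where "snd i = restrict (\<lambda>\<phi>. \<lfloor>S \<phi> y / (n * \<theta>)\<rfloor>) F" using i by (auto simp: I_def c_def)
        then show ?thesis by (auto simp: restrict_def fun_eq_iff)
      qed
      then show ?thesis by (auto simp: C_def c_def prod_eq_iff space_UNIV)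
    qed
    also have "\<dots> \<in> sets M"
    proof (intro sets.Int sets.sets_Collect_finite_All F(1))
      show "{x. bad x = fst i} \<in> sets M"
      proof (cases "fst i")
        case False
        have "{x. bad x = fst i} = space M - {x. bad x}" using False by (auto simp: space_UNIV)
        then show ?thesis using badm by simp
      qed (use badm in simp)
      fix \<phi> assume "\<phi> \<in> F"
      have [measurable]: "S \<phi> \<in> borel_measurable M" using Sint[OF \<open>\<phi> \<in> F\<close>] by simp
      show "{x \<in> space M. \<lfloor>S \<phi> x / (n * \<theta>)\<rfloor> = snd i \<phi>} \<in> sets M" unfolding floor_eq_iff by measurable
    qed
    finally show ?thesis .
  qed
  define w where "w i = measure M (C i)" for i
  have disjC: "disjoint_family_on C A" for A by (auto simp: disjoint_family_on_def C_def)
  have w1: "(\<Sum>i\<in>I. w i) = 1"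
  proof -
    have "(\<Sum>i\<in>I. w i) = measure M (\<Union>i\<in>I. C i)"
      unfolding w_def using fI Cm disjC by (subst finite_measure_finite_Union) auto
    also have "(\<Union>i\<in>I. C i) = space M" by (auto simp: C_def I_def space_UNIV)
    finally show ?thesis using prob_space by simp
  qed
  have wbad: "(\<Sum>i\<in>I. w i * (if fst i then 1 else 0)) \<le> \<kappa>"
  proof -
    have "(\<Sum>i\<in>I. w i * (if fst i then 1 else 0)) = (\<Sum>i\<in>{i\<in>I. fst i}. w i)"
      using fI by (intro sum.mono_neutral_cong_right) auto
    also have "\<dots> = measure M (\<Union>i\<in>{i\<in>I. fst i}. C i)"
      unfolding w_def using fI Cm disjC by (subst finite_measure_finite_Union) auto
    also have "\<dots> \<le> measure M {x. bad x}"
      using badm by (intro finite_measure_mono) (auto simp: C_def c_def)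
    finally show ?thesis using badk by linarith
  qed
  define Nn where "Nn i = card {A\<in>J. A \<inter> C i \<noteq> {}}" for i
  define sepd where "sepd E \<longleftrightarrow> (\<forall>x\<in>E. \<forall>y\<in>E. x \<noteq> y \<longrightarrow> \<zeta> * n \<le> card {i\<in>{..<n}. \<gamma>\<^sub>0 < dist ((f ^^ i) x) ((f ^^ i) y)})" for E
  have "\<exists>E. finite E \<and> E \<noteq> {} \<and> E \<subseteq> C i \<and> sepd E \<and>
      ln (real (Nn i)) \<le> ln (real (card E)) + \<tau> / 4 * n + n * ln (real (card P)) * (if fst i then 1 else 0)" if i: "i \<in> I" for i
  proof -
    have Cne: "C i \<noteq> {}" using i by (auto simp: I_def C_def)
    show ?thesis
    proof (cases "fst i")
      case True
      obtain x where x: "x \<in> C i" using Cne by auto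
      have "Nn i \<le> card J" unfolding Nn_def using J(1) by (intro card_mono) auto
      also have "\<dots> \<le> card P ^ n" unfolding J_def by (rule card_dynamical_join_le[OF P(1)])
      finally have le: "Nn i \<le> card P ^ n" .
      have "ln (real (Nn i)) \<le> n * ln (real (card P))"
      proof (cases "Nn i = 0")
        case False
        then have "ln (real (Nn i)) \<le> ln (real (card P ^ n))"
          using le by (intro ln_mono) (simp_all only: of_nat_le_iff of_nat_0_less_iff)
        then show ?thesis using cP by (simp add: ln_realpow)
      qed (use cP in simp)
      moreover have "0 \<le> \<tau> / 4 * n" using \<tau> by simp
      ultimately have "ln (real (Nn i)) \<le> ln (real (card {x})) + \<tau> / 4 * n + n * ln (real (card P)) * (if fst i then 1 else 0)"
        using True by simp
      then show ?thesis using x by (intro exI[of _ "{x}"]) (auto simp: sepd_def)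
    next
      case False
      have good: "real (card {j\<in>{..<n}. (f ^^ j) x \<in> B\<^sub>0}) \<le> \<kappa> * n" if "x \<in> C i" for x
      proof -
        have "\<not> bad x" using that False by (auto simp: C_def c_def)
        then show ?thesis by (simp add: bad_def)
      qed
      obtain E where E: "finite E" "E \<noteq> {}" "E \<subseteq> C i" "sepd E" "real (Nn i) \<le> card E * exp (\<tau> / 4 * n)"
      proof (rule hamming_separated_subset[where P = P and cell = cell and \<gamma>\<^sub>0 = \<gamma>\<^sub>0 and B\<^sub>0 = B\<^sub>0 and \<rho> = \<rho>
            and \<sigma> = "\<tau> / 4" and C = "C i" and f = f and n = n and \<kappa> = \<kappa> and \<zeta> = \<zeta>, OF P(1) cell far ball Cne good n \<zeta> \<gamma>\<^sub>0])
        fix E assume "finite E" "E \<noteq> {}" "E \<subseteq> C i"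
          "\<And>x y. x \<in> E \<Longrightarrow> y \<in> E \<Longrightarrow> x \<noteq> y \<Longrightarrow> \<zeta> * real n \<le> real (card {i\<in>{..<n}. \<gamma>\<^sub>0 < dist ((f ^^ i) x) ((f ^^ i) y)})"
          "real (card {A \<in> dynamical_join f P n. A \<inter> C i \<noteq> {}}) \<le> real (card E) * exp (\<tau> / 4 * real n)"
        then show thesis by (intro that[of E]) (auto simp: sepd_def Nn_def J_def)
      qed
      have cE: "0 < card E" using E(1,2) by (simp add: card_gt_0_iff)
      have "ln (real (Nn i)) \<le> ln (real (card E)) + \<tau> / 4 * n"
      proof (cases "Nn i = 0")
        case True
        have "0 \<le> ln (real (card E))" using cE by simp
        then show ?thesis using True \<tau> by simp
      next
        case False
        then have "ln (real (Nn i)) \<le> ln (card E * exp (\<tau> / 4 * n))" using E(5) by (intro ln_mono) auto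
        then show ?thesis using cE by (simp add: ln_mult)
      qed
      then show ?thesis using E False by (intro exI[of _ E]) simp
    qed
  qed
  then have "\<forall>i\<in>I. \<exists>E. finite E \<and> E \<noteq> {} \<and> E \<subseteq> C i \<and> sepd E \<and>
      ln (real (Nn i)) \<le> ln (real (card E)) + \<tau> / 4 * n + n * ln (real (card P)) * (if fst i then 1 else 0)" by blast
  from bchoice[OF this] obtain E where E: "\<forall>i\<in>I. finite (E i) \<and> E i \<noteq> {} \<and> E i \<subseteq> C i \<and> sepd (E i) \<and>
      ln (real (Nn i)) \<le> ln (real (card (E i))) + \<tau> / 4 * n + n * ln (real (card P)) * (if fst i then 1 else 0)" ..
  define lE where "lE i = ln (real (card (E i)))" for i
  \<comment> \<open>The fourth quarter of \<open>\<tau>\<close> is kept for rounding the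
    schedule.\<close>
  have ent: "n * (h - 3 * \<tau> / 4) \<le> (\<Sum>i\<in>I. w i * lE i)"
  proof -
    have csm: "c -` {i} \<inter> space M \<in> sets M" if "i \<in> c ` space M" for i using Cm[of i] that by (simp add: C_def I_def space_UNIV)
    have lin: "(\<Sum>i\<in>I. w i * (lE i + A + D * b i)) = (\<Sum>i\<in>I. w i * lE i) + A * (\<Sum>i\<in>I. w i) + D * (\<Sum>i\<in>I. w i * b i)"
      for A D and b :: "_ \<Rightarrow> real"
      by (simp add: sum_distrib_left sum.distrib[symmetric] algebra_simps)
    have "partition_entropy M J \<le> ln (card I) + (\<Sum>i\<in>I. w i * ln (Nn i))"
      using partition_entropy_le_classes[of J c, OF J _ csm] fI unfolding I_def w_def C_def Nn_def by (simp add: space_UNIV)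
    also have "(\<Sum>i\<in>I. w i * ln (Nn i)) \<le> (\<Sum>i\<in>I. w i * (lE i + \<tau> / 4 * n + n * ln (real (card P)) * (if fst i then 1 else 0)))"
      using E by (intro sum_mono mult_left_mono) (auto simp: lE_def w_def)
    also have "\<dots> = (\<Sum>i\<in>I. w i * lE i) + \<tau> / 4 * n * (\<Sum>i\<in>I. w i) + n * ln (real (card P)) * (\<Sum>i\<in>I. w i * (if fst i then 1 else 0))"
      by (rule lin)
    also have "\<dots> \<le> (\<Sum>i\<in>I. w i * lE i) + \<tau> / 4 * n + n * ln (real (card P)) * \<kappa>"
      using wbad cP by (intro add_mono mult_left_mono) (auto simp: w1)
    also have "n * ln (real (card P)) * \<kappa> \<le> n * (\<tau> / 4)"
      using mult_left_mono[OF \<kappa>(2), of "real n"] by (simp add: mult_ac)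
    finally have "partition_entropy M J \<le> ln (card I) + ((\<Sum>i\<in>I. w i * lE i) + \<tau> / 4 * n + n * (\<tau> / 4))" by simp
    then show ?thesis using lnI h by (simp add: J_def algebra_simps)
  qed
  \<comment> \<open>A class fixes the empirical means only up to a grid cell. Evaluating at a
    representative makes them functions of the class, to which the schedule can be applied.\<close>
  define rep where "rep i = (SOME x. x \<in> E i)" for i
  have rep: "rep i \<in> C i" if "i \<in> I" for i
  proof -
    have "rep i \<in> E i" using E that unfolding rep_def by (simp add: some_in_eq)
    then show ?thesis using E that by blast
  qed
  define a where "a \<phi> i = S \<phi> (rep i) / n" for \<phi> i
  have close: "\<bar>S \<phi> x / n - a \<phi> i\<bar> \<le> \<theta>" if \<phi>: "\<phi> \<in> F" and i: "i \<in> I" and x: "x \<in> C i" for \<phi> i x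
  proof -
    have "c x = c (rep i)" using rep[OF i] x by (simp add: C_def)
    then have "snd (c x) \<phi> = snd (c (rep i)) \<phi>" by simp
    then have "\<lfloor>S \<phi> x / (n * \<theta>)\<rfloor> = \<lfloor>S \<phi> (rep i) / (n * \<theta>)\<rfloor>" using \<phi> by (simp add: c_def)
    then have "\<bar>S \<phi> x / (n * \<theta>) - S \<phi> (rep i) / (n * \<theta>)\<bar> \<le> 1" by linarith
    also have "S \<phi> x / (n * \<theta>) - S \<phi> (rep i) / (n * \<theta>) = (S \<phi> x / n - a \<phi> i) / \<theta>"
      by (simp add: a_def diff_divide_distrib)
    finally show ?thesis using \<theta> by (simp add: abs_divide)
  qed
  have mean: "\<bar>\<Sum>i\<in>I. w i * a \<phi> i\<bar> \<le> \<theta>" if \<phi>: "\<phi> \<in> F" for \<phi>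
  proof -
    \<comment> \<open>The step function with the representative's mean on each class is uniformly
      \<open>\<theta>\<close>-close to the empirical mean of \<open>\<phi>\<close>, whose integral
      is 0 by invariance and \<open>F(3)\<close>.\<close>
    define g where "g x = (\<Sum>i\<in>I. a \<phi> i * indicator (C i) x)" for x
    have gi: "g x = a \<phi> (c x)" for x
    proof -
      have "g x = (\<Sum>i\<in>I. if i = c x then a \<phi> i else 0)"
        unfolding g_def by (intro sum.cong) (auto simp: C_def indicator_def)
      also have "\<dots> = a \<phi> (c x)" using fI by (simp add: I_def)
      finally show ?thesis .
    qed
    have ind: "integrable M (indicator (C i) :: 'a \<Rightarrow> real)" if "i \<in> I" for i
      using Cm[OF that] by (intro integrable_real_indicator) (simp_all add: less_top[symmetric])
    have gint: "integrable M g" unfolding g_def using ind by (intro Bochner_Integration.integrable_sum integrable_mult_right) auto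
    have "(\<integral>x. g x \<partial>M) = (\<Sum>i\<in>I. w i * a \<phi> i)"
      unfolding g_def using ind Cm by (subst Bochner_Integration.integral_sum) (auto simp: w_def mult.commute intro!: sum.cong)
    moreover have "(\<integral>x. S \<phi> x / n \<partial>M) = 0" using integral_orbit_sum[OF F(2)[OF \<phi>], of n] F(3)[OF \<phi>] by (simp add: S_def)
    moreover have "\<bar>\<integral>x. g x - S \<phi> x / n \<partial>M\<bar> \<le> \<theta>"
    proof -
      have int: "integrable M (\<lambda>x. g x - S \<phi> x / n)" using gint Sint[OF \<phi>] by simp
      have "\<bar>\<integral>x. g x - S \<phi> x / n \<partial>M\<bar> \<le> (\<integral>x. \<bar>g x - S \<phi> x / n\<bar> \<partial>M)" by (rule integral_abs_bound)
      also have "\<dots> \<le> (\<integral>x. \<theta> \<partial>M)"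
      proof (rule integral_mono)
        fix x
        have "\<bar>S \<phi> x / n - a \<phi> (c x)\<bar> \<le> \<theta>" by (rule close[OF \<phi>]) (auto simp: I_def C_def)
        then show "\<bar>g x - S \<phi> x / n\<bar> \<le> \<theta>" by (simp add: gi abs_minus_commute)
      qed (use int in auto)
      finally show ?thesis using prob_space by simp
    qed
    ultimately show ?thesis using gint Sint[OF \<phi>] n by auto
  qed
  \<comment> \<open>One schedule has to balance the logarithmic counts \<open>lE\<close> and the
    means of all test functions at once.\<close>
  have G: "finite (insert lE (a ` F))" using F(1) by simp
  have tol: "0 < min (\<tau> / 4) \<theta>" using \<tau> \<theta> by simp
  obtain N :: nat and s where N: "0 < N" and sI: "\<And>j. j < N \<Longrightarrow> s j \<in> I"
    and avg: "\<And>g. g \<in> insert lE (a ` F) \<Longrightarrow> \<bar>(\<Sum>j<N. g (s j)) - N * (\<Sum>i\<in>I. w i * g i)\<bar> < min (\<tau> / 4) \<theta> * N"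
  proof (rule finite_average_approximation[OF fI Ine _ w1 G tol])
    show "0 \<le> w i" for i by (simp add: w_def)
    fix N :: nat and s
    assume "0 < N" "\<And>j. j < N \<Longrightarrow> s j \<in> I"
      "\<And>g. g \<in> insert lE (a ` F) \<Longrightarrow> \<bar>(\<Sum>j<N. g (s j)) - N * (\<Sum>i\<in>I. w i * g i)\<bar> < min (\<tau> / 4) \<theta> * N"
    then show thesis by (rule that[of N s])
  qed
  define W where "W = PiE {..<N} (\<lambda>j. E (s j))"
  have fW: "finite W" unfolding W_def using E sI by (intro finite_PiE) auto
  have Wne: "W \<noteq> {}" unfolding W_def using E sI by (auto simp: PiE_eq_empty_iff)
  have cardW: "n * N * (h - \<tau>) \<le> ln (real (card W))"
  proof -
    have "ln (real (card W)) = (\<Sum>j<N. lE (s j))"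
    proof -
      have "real (card W) = (\<Prod>j<N. real (card (E (s j))))" by (simp add: W_def card_PiE)
      moreover have "0 < real (card (E (s j)))" if "j < N" for j using E sI[OF that] by (simp add: card_gt_0_iff)
      ultimately show ?thesis unfolding lE_def by (simp only:) (rule ln_prod, auto)
    qed
    also have "\<dots> \<ge> N * (\<Sum>i\<in>I. w i * lE i) - min (\<tau> / 4) \<theta> * N" using avg[of lE] by simp
    finally have "N * (\<Sum>i\<in>I. w i * lE i) - min (\<tau> / 4) \<theta> * N \<le> ln (real (card W))" .
    moreover have "N * (n * (h - 3 * \<tau> / 4)) \<le> N * (\<Sum>i\<in>I. w i * lE i)" using ent by (intro mult_left_mono) auto
    moreover have "min (\<tau> / 4) \<theta> * N \<le> \<tau> / 4 * (N * n)"
    proof -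
      have "min (\<tau> / 4) \<theta> * N \<le> \<tau> / 4 * N" by (intro mult_right_mono) auto
      also have "real N \<le> real (N * n)" using n by (simp only: of_nat_le_iff) simp
      then have "\<tau> / 4 * real N \<le> \<tau> / 4 * real (N * n)" using \<tau> by (intro mult_left_mono) auto
      finally show ?thesis by simp
    qed
    ultimately show ?thesis by (simp add: algebra_simps)
  qed
  have sums: "\<bar>\<Sum>j<N. \<Sum>i<n. \<phi> ((f ^^ i) (v j))\<bar> \<le> n * N * \<eta>" if v: "v \<in> W" and \<phi>: "\<phi> \<in> F" for v \<phi>
  proof -
    have vC: "v j \<in> C (s j)" if "j < N" for j
      using v that E sI[OF that] by (auto simp: W_def PiE_iff)
    have "\<bar>(\<Sum>j<N. S \<phi> (v j) / n) - (\<Sum>j<N. a \<phi> (s j))\<bar> \<le> (\<Sum>j<N. \<bar>S \<phi> (v j) / n - a \<phi> (s j)\<bar>)"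
      by (subst sum_subtractf[symmetric]) (rule sum_abs)
    also have "\<dots> \<le> (\<Sum>j<N. \<theta>)" using close[OF \<phi>] sI vC by (intro sum_mono) auto
    finally have 1: "\<bar>(\<Sum>j<N. S \<phi> (v j) / n) - (\<Sum>j<N. a \<phi> (s j))\<bar> \<le> N * \<theta>" by simp
    have "\<bar>(\<Sum>j<N. a \<phi> (s j)) - N * (\<Sum>i\<in>I. w i * a \<phi> i)\<bar> < min (\<tau> / 4) \<theta> * N" using avg[of "a \<phi>"] \<phi> by simp
    also have "\<dots> \<le> N * \<theta>" by (subst mult.commute) (intro mult_left_mono, auto)
    finally have 2: "\<bar>(\<Sum>j<N. a \<phi> (s j)) - N * (\<Sum>i\<in>I. w i * a \<phi> i)\<bar> \<le> N * \<theta>" by simp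
    have 3: "\<bar>N * (\<Sum>i\<in>I. w i * a \<phi> i)\<bar> \<le> N * \<theta>" using mean[OF \<phi>] by (simp add: abs_mult mult_left_mono)
    have "\<bar>\<Sum>j<N. S \<phi> (v j) / n\<bar> \<le> 3 * (N * \<theta>)" using 1 2 3 by linarith
    then have "\<bar>(\<Sum>j<N. S \<phi> (v j)) / n\<bar> \<le> N * \<eta>" by (simp add: \<theta>_def sum_divide_distrib)
    then show ?thesis using n by (simp add: abs_divide S_def field_simps)
  qed
  have sep: "\<exists>j<N. \<zeta> * n \<le> card {i\<in>{..<n}. \<gamma>\<^sub>0 < dist ((f ^^ i) (v j)) ((f ^^ i) (v' j))}"
    if v: "v \<in> W" "v' \<in> W" "v \<noteq> v'" for v v'
  proof -
    have "\<exists>j\<in>{..<N}. v j \<noteq> v' j" using v by (metis PiE_ext W_def)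
    then obtain j where j: "j < N" "v j \<noteq> v' j" by auto
    have "v j \<in> E (s j)" "v' j \<in> E (s j)" using v j by (auto simp: W_def PiE_iff)
    moreover have "sepd (E (s j))" using E sI[OF j(1)] by blast
    ultimately show ?thesis using j unfolding sepd_def by blast
  qed
  show ?thesis by (intro exI[of _ N] exI[of _ W] conjI ballI impI N fW Wne cardW sums sep)
qed

text \<open>The rates \<open>\<zeta>\<close> and \<open>\<gamma>\<^sub>0\<close> must not depend on
  \<open>n\<close>, because the accuracy of tracing is derived from them before \<open>n\<close> is
  chosen. Cells of \<open>P\<close> may touch, so proximity of orbits reveals names only inside
  closed subsets of the cells; what remains is collected in \<open>B\<^sub>0\<close>.\<close>

lemma block_word_selection:
  fixes f :: "'a::metric_space \<Rightarrow> 'a" and M :: "'a measure" and F :: "('a \<Rightarrow> real) set"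
    and \<tau> \<eta> B h :: real
  assumes mp: "measure_preserving_map M f" and s: "sets M = sets borel" and cpt: "compact (UNIV :: 'a set)"
    and P: "finite P" "P \<subseteq> sets M" "partition_on UNIV P"
    and h: "\<forall>\<^sub>F n in sequentially. h * n < partition_entropy M (dynamical_join f P n)"
    and F: "finite F" "\<And>\<phi>. \<phi> \<in> F \<Longrightarrow> integrable M \<phi>" "\<And>\<phi>. \<phi> \<in> F \<Longrightarrow> (\<integral>x. \<phi> x \<partial>M) = 0" "\<And>\<phi> x. \<phi> \<in> F \<Longrightarrow> \<bar>\<phi> x\<bar> \<le> B"
    and \<tau>: "0 < \<tau>" and \<eta>: "0 < \<eta>"
  obtains \<zeta> \<gamma>\<^sub>0 :: real where "0 < \<zeta>" "0 < \<gamma>\<^sub>0"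
    "\<forall>\<^sub>F n in sequentially. \<exists>N W. 0 < N \<and> finite W \<and> W \<noteq> {} \<and> n * N * (h - \<tau>) \<le> ln (real (card W)) \<and>
     (\<forall>w\<in>W. \<forall>\<phi>\<in>F. \<bar>\<Sum>j<N. \<Sum>i<n. \<phi> ((f ^^ i) (w j))\<bar> \<le> n * N * \<eta>) \<and>
     (\<forall>w\<in>W. \<forall>w'\<in>W. w \<noteq> w' \<longrightarrow> (\<exists>j<N. \<zeta> * n \<le> card {i\<in>{..<n}. \<gamma>\<^sub>0 < dist ((f ^^ i) (w j)) ((f ^^ i) (w' j))}))"
proof -
  interpret measure_preserving_map M f by (rule mp)
  have disjP: "disjoint P" and UP: "\<Union>P = UNIV" using P(3) by (auto simp: partition_on_def)
  have cP: "1 \<le> card P"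
  proof -
    have "P \<noteq> {}" using UP by auto
    then show ?thesis using P(1) by (simp add: Suc_le_eq card_gt_0_iff)
  qed
  have "\<forall>z. \<exists>A. z \<in> A \<and> A \<in> P" using UP by (metis UNIV_I UnionE)
  from choice[OF this] obtain cell where cell: "\<And>z. z \<in> cell z" "\<And>z. cell z \<in> P" by blast
  have cell_eq: "cell z = A" if "A \<in> P" "z \<in> A" for z A
    using disjointD[OF disjP cell(2)[of z] that(1)] cell(1)[of z] that(2) by blast
  have \<tau>4: "0 < \<tau> / 4" using \<tau> by simp
  obtain \<rho> :: real where \<rho>: "0 < \<rho>" and ball: "\<And>(I :: nat set) u. finite I \<Longrightarrow> (\<And>i. i \<in> I \<Longrightarrow> u i \<in> P) \<Longrightarrow>
       real (card {v \<in> PiE I (\<lambda>_. P). real (card {i\<in>I. v i \<noteq> u i}) \<le> \<rho> * card I}) \<le> exp (\<tau> / 4 * card I)"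
  proof (rule hamming_ball_card_exp[OF P(1) \<tau>4, where 'i = nat])
    fix \<rho> :: real
    assume "0 < \<rho>" "\<And>(I :: nat set) u. finite I \<Longrightarrow> (\<And>i. i \<in> I \<Longrightarrow> u i \<in> P) \<Longrightarrow>
       real (card {v \<in> PiE I (\<lambda>_. P). real (card {i\<in>I. v i \<noteq> u i}) \<le> \<rho> * card I}) \<le> exp (\<tau> / 4 * card I)"
    then show thesis by (rule that)
  qed
  \<comment> \<open>\<open>\<rho>\<close> is shared among the visits of two points to
    \<open>B\<^sub>0\<close> and the separation rate \<open>\<zeta>\<close>, which is taken to be
    \<open>\<kappa>\<close> itself. The other bound makes bad classes affordable.\<close>
  define \<kappa> where "\<kappa> = min (\<rho> / 3) (\<tau> / 4 / (ln (card P) + 1))"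
  have lnP: "0 \<le> ln (real (card P))" using cP by simp
  have \<kappa>: "0 < \<kappa>" using \<rho> \<tau> lnP by (simp add: \<kappa>_def)
  have \<kappa>ln: "\<kappa> * ln (card P) \<le> \<tau> / 4"
  proof -
    have "\<kappa> * ln (card P) \<le> (\<tau> / 4 / (ln (card P) + 1)) * (ln (card P) + 1)"
      using lnP \<tau> \<kappa> by (intro mult_mono) (auto simp: \<kappa>_def)
    also have "\<dots> = \<tau> / 4"
    proof -
      have cancel: "x / y * y = x" if "y \<noteq> 0" for x y :: real using that by simp
      show ?thesis using lnP by (intro cancel) linarith
    qed
    finally show ?thesis .
  qed
  have \<kappa>\<rho>: "2 * \<kappa> + \<kappa> \<le> \<rho>" by (simp add: \<kappa>_def)
  \<comment> \<open>Summed over the cells, the remainders have measure at most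
    \<open>\<kappa> * \<kappa>\<close>, for which Markov's inequality leaves bad points of measure
    at most \<open>\<kappa>\<close>.\<close>
  have "\<exists>K. closed K \<and> K \<subseteq> A \<and> measure M (A - K) < \<kappa> * \<kappa> / card P" if "A \<in> P" for A
  proof -
    have "0 < \<kappa> * \<kappa> / card P" using \<kappa> cP by simp
    moreover have "A \<in> sets borel" using P(2) that s by auto
    ultimately show ?thesis using closed_inner_regular[OF finite_measure_axioms s] by metis
  qed
  then obtain K where K: "\<And>A. A \<in> P \<Longrightarrow> closed (K A)" "\<And>A. A \<in> P \<Longrightarrow> K A \<subseteq> A"
    "\<And>A. A \<in> P \<Longrightarrow> measure M (A - K A) < \<kappa> * \<kappa> / card P" by metis
  define B\<^sub>0 where "B\<^sub>0 = (\<Union>A\<in>P. A - K A)"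
  have Dm: "A - K A \<in> sets M" if "A \<in> P" for A using P(2) K(1) that s by auto
  have B0m: "B\<^sub>0 \<in> sets M" unfolding B\<^sub>0_def using P(1) Dm by (intro sets.finite_UN) auto
  have B0s: "measure M B\<^sub>0 \<le> \<kappa> * \<kappa>"
  proof -
    have "measure M B\<^sub>0 \<le> (\<Sum>A\<in>P. measure M (A - K A))"
      unfolding B\<^sub>0_def using P(1) Dm by (intro finite_measure_subadditive_finite) auto
    also have "\<dots> \<le> (\<Sum>A\<in>P. \<kappa> * \<kappa> / card P)" using K(3) by (intro sum_mono) (auto intro: less_imp_le)
    also have "\<dots> = \<kappa> * \<kappa>" using cP by simp
    finally show ?thesis .
  qed
  have Kc: "compact (K A)" if "A \<in> P" for A using compact_Int_closed[OF cpt K(1)[OF that]] by simp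
  have Kdisj: "K A \<inter> K A' = {}" if "A \<in> P" "A' \<in> P" "A \<noteq> A'" for A A'
    using disjointD[OF disjP that] K(2)[OF that(1)] K(2)[OF that(2)] by blast
  obtain \<gamma>\<^sub>0 :: real where \<gamma>\<^sub>0: "0 < \<gamma>\<^sub>0"
    and gap: "\<And>A A' x y. A \<in> P \<Longrightarrow> A' \<in> P \<Longrightarrow> A \<noteq> A' \<Longrightarrow> x \<in> K A \<Longrightarrow> y \<in> K A' \<Longrightarrow> \<gamma>\<^sub>0 < dist x y"
  proof (rule disjoint_compact_family_gap[where I = P and B = K, OF P(1) Kc Kdisj])
    fix \<gamma> :: real
    assume "0 < \<gamma>" "\<And>A A' x y. A \<in> P \<Longrightarrow> A' \<in> P \<Longrightarrow> A \<noteq> A' \<Longrightarrow> x \<in> K A \<Longrightarrow> y \<in> K A' \<Longrightarrow> \<gamma> < dist x y"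
    then show thesis by (rule that)
  qed
  have mem: "x \<in> K (cell x)" if "x \<notin> B\<^sub>0" for x using that cell by (auto simp: B\<^sub>0_def)
  have far: "\<gamma>\<^sub>0 < dist x y" if "x \<notin> B\<^sub>0" "y \<notin> B\<^sub>0" "cell x \<noteq> cell y" for x y
    using gap[OF cell(2) cell(2) that(3) mem[OF that(1)] mem[OF that(2)]] .
  \<comment> \<open>The number of possible classes is independent of \<open>n\<close>, so its
    logarithm eventually stays below \<open>n * (\<tau> / 4)\<close>.\<close>
  define q where "q = ln (real (card ((UNIV :: bool set) \<times> PiE F (\<lambda>_. {\<lfloor>- (B / (\<eta> / 3))\<rfloor>..\<lfloor>B / (\<eta> / 3)\<rfloor>}))))"
  obtain n0 :: nat where n0: "q / (\<tau> / 4) < n0" using reals_Archimedean2 by blast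
  have "\<forall>\<^sub>F n in sequentially. \<exists>N W. 0 < N \<and> finite W \<and> W \<noteq> {} \<and> n * N * (h - \<tau>) \<le> ln (real (card W)) \<and>
     (\<forall>w\<in>W. \<forall>\<phi>\<in>F. \<bar>\<Sum>j<N. \<Sum>i<n. \<phi> ((f ^^ i) (w j))\<bar> \<le> n * N * \<eta>) \<and>
     (\<forall>w\<in>W. \<forall>w'\<in>W. w \<noteq> w' \<longrightarrow> (\<exists>j<N. \<kappa> * n \<le> card {i\<in>{..<n}. \<gamma>\<^sub>0 < dist ((f ^^ i) (w j)) ((f ^^ i) (w' j))}))"
    using h eventually_gt_at_top[of 0] eventually_ge_at_top[of n0]
  proof eventually_elim
    case (elim n)
    have "q / (\<tau> / 4) \<le> n" using n0 elim(3) by linarith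
    then have "q \<le> n * (\<tau> / 4)" using \<tau>4 by (simp add: field_simps)
    note qn = this[unfolded q_def]
    show ?case
    proof (rule block_words_exist[where M = M and f = f and P = P and cell = cell and B\<^sub>0 = B\<^sub>0 and F = F and B = B
        and \<rho> = \<rho> and \<tau> = \<tau> and \<eta> = \<eta> and h = h and n = n and \<kappa> = \<kappa> and \<zeta> = \<kappa> and \<gamma>\<^sub>0 = \<gamma>\<^sub>0])
      show "\<bar>\<phi> x\<bar> \<le> B" if "\<phi> \<in> F" for \<phi> x by (rule F(4)[OF that])
      fix I :: "nat set" and u :: "nat \<Rightarrow> 'a set"
      assume "finite I" "\<And>i. i \<in> I \<Longrightarrow> u i \<in> P"
      then show "real (card {v \<in> PiE I (\<lambda>_. P). real (card {i\<in>I. v i \<noteq> u i}) \<le> \<rho> * card I}) \<le> exp (\<tau> / 4 * card I)"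
        by (rule ball)
    qed (assumption | rule mp P cell cell_eq far B0m B0s \<kappa> \<kappa>ln \<kappa>\<rho> \<gamma>\<^sub>0 F(1-3) \<tau> \<eta> elim(1,2) qn)+
  qed
  then show ?thesis using \<kappa> \<gamma>\<^sub>0 by (intro that)
qed

section \<open>The main theorem\<close>


lemma finite_continuous_family_bound:
  fixes F :: "('a::metric_space \<Rightarrow> real) set"
  assumes cpt: "compact (UNIV :: 'a set)" and F: "finite F" "\<And>\<phi>. \<phi> \<in> F \<Longrightarrow> continuous_on UNIV \<phi>"
  obtains B where "0 \<le> B" "\<And>\<phi> x. \<phi> \<in> F \<Longrightarrow> \<bar>\<phi> x\<bar> \<le> B"
proof -
  have "\<exists>b. \<forall>x. \<bar>\<phi> x\<bar> \<le> b" if "\<phi> \<in> F" for \<phi>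
    using compact_imp_bounded[OF compact_continuous_image[OF F(2)[OF that] cpt]] by (auto simp: bounded_iff)
  then have "\<forall>\<phi>\<in>F. \<exists>b. \<forall>x. \<bar>\<phi> x\<bar> \<le> b" by blast
  from bchoice[OF this] obtain b where b: "\<And>\<phi> x. \<phi> \<in> F \<Longrightarrow> \<bar>\<phi> x\<bar> \<le> b \<phi>" by blast
  have "\<bar>\<phi> x\<bar> \<le> (\<Sum>\<phi>\<in>F. \<bar>b \<phi>\<bar>)" if "\<phi> \<in> F" for \<phi> x
  proof -
    have "\<bar>\<phi> x\<bar> \<le> \<bar>b \<phi>\<bar>" using b[OF that, of x] by linarith
    also have "\<dots> \<le> (\<Sum>\<phi>\<in>F. \<bar>b \<phi>\<bar>)" using that F(1) by (intro member_le_sum) auto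
    finally show ?thesis .
  qed
  then show ?thesis by (intro that[of "\<Sum>\<phi>\<in>F. \<bar>b \<phi>\<bar>"]) (auto intro: sum_nonneg)
qed

lemma finite_continuous_family_modulus:
  fixes F :: "('a::metric_space \<Rightarrow> real) set"
  assumes cpt: "compact (UNIV :: 'a set)" and F: "finite F" "\<And>\<phi>. \<phi> \<in> F \<Longrightarrow> continuous_on UNIV \<phi>"
    and "0 < \<omega>" and "0 < d"
  obtains e where "0 < e" "e < d" "\<And>\<phi> x y. \<phi> \<in> F \<Longrightarrow> dist x y \<le> e \<Longrightarrow> \<bar>\<phi> x - \<phi> y\<bar> \<le> \<omega>"
proof -
  have "\<forall>\<^sub>F e in at_right (0::real). \<forall>x y. dist x y \<le> e \<longrightarrow> \<bar>\<phi> x - \<phi> y\<bar> \<le> \<omega>" if \<phi>: "\<phi> \<in> F" for \<phi>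
  proof -
    obtain e0 where e0: "e0 > 0" "\<And>x y. dist x y < e0 \<Longrightarrow> dist (\<phi> x) (\<phi> y) < \<omega>"
      using compact_uniformly_continuous[OF F(2)[OF \<phi>] cpt] \<open>0 < \<omega>\<close> unfolding uniformly_continuous_on_def by (metis UNIV_I)
    have "\<forall>\<^sub>F e in at_right (0::real). e < e0" by (rule order_tendstoD(2)[OF tendsto_ident_at e0(1)])
    then show ?thesis
    proof eventually_elim
      case (elim e)
      show ?case
      proof (intro allI impI)
        fix x y :: 'a assume "dist x y \<le> e"
        then have "dist x y < e0" using elim by simp
        from e0(2)[OF this] show "\<bar>\<phi> x - \<phi> y\<bar> \<le> \<omega>" by (simp add: dist_real_def)
      qed
    qed
  qed
  then have "\<forall>\<^sub>F e in at_right (0::real). \<forall>\<phi>\<in>F. \<forall>x y. dist x y \<le> e \<longrightarrow> \<bar>\<phi> x - \<phi> y\<bar> \<le> \<omega>"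
    using F(1) by (simp add: eventually_ball_finite_distrib)
  moreover have "\<forall>\<^sub>F e in at_right (0::real). e < d" by (rule order_tendstoD(2)[OF tendsto_ident_at \<open>0 < d\<close>])
  moreover have "\<forall>\<^sub>F e in at_right (0::real). 0 < e" by (rule eventually_at_right_less)
  ultimately have "\<forall>\<^sub>F e in at_right (0::real). (0 < e \<and> e < d) \<and> (\<forall>\<phi>\<in>F. \<forall>x y. dist x y \<le> e \<longrightarrow> \<bar>\<phi> x - \<phi> y\<bar> \<le> \<omega>)"
    by eventually_elim blast
  from eventually_happens'[OF trivial_limit_at_right_real this]
  show ?thesis using that by blast
qed

text \<open>Rounding \<open>exp x\<close> up to an integer at most doubles it because
  \<open>exp x \<ge> 1\<close>; this is the origin of \<open>ln 2\<close>.\<close>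

lemma subset_with_prescribed_exponential_card:
  fixes x y :: real
  assumes W: "finite W" and y: "exp y \<le> real (card W)" and xy: "x + ln 2 \<le> y" and x: "0 \<le> x"
  obtains V where "V \<subseteq> W" "V \<noteq> {}" "x \<le> ln (real (card V))" "ln (real (card V)) \<le> y"
proof -
  define m where "m = nat \<lceil>exp x\<rceil>"
  have m1: "exp x \<le> m" by (simp add: m_def real_nat_ceiling_ge)
  then have mpos: "0 < real m" using exp_gt_zero[of x] by linarith
  have "real m \<le> exp x + 1" unfolding m_def using ceiling_correct[of "exp x"] by simp
  also have "1 \<le> exp x" using x by simp
  then have "exp x + 1 \<le> exp (x + ln 2)" by (simp add: exp_add)
  also have "\<dots> \<le> exp y" using xy by simp
  finally have m2: "real m \<le> exp y" .
  then have "m \<le> card W" using y by (simp flip: of_nat_le_iff)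
  then obtain V where V: "V \<subseteq> W" "card V = m" by (meson obtain_subset_with_card_n)
  have "x \<le> ln (real m)" using ln_mono[OF m1 ] by simp
  moreover have "ln (real m) \<le> y" using ln_mono[OF m2 mpos] by simp
  moreover have "V \<noteq> {}" using V(2) mpos by auto
  ultimately show ?thesis using V by (intro that[of V]) auto
qed

theorem theorem1p2:
  fixes f :: "'a::metric_space \<Rightarrow> 'a"
  assumes "compact (UNIV :: 'a set)"
    and "continuous_on UNIV f"
    and "approximate_product_property f"
  shows "\<forall>\<mu>\<in>invariant_measures f. almost_entropy_approximable f \<mu>"
  unfolding almost_entropy_approximable_def
proof (intro ballI allI impI)
  note cpt = assms(1) and contf = assms(2)
  fix \<mu> U and h \<epsilon> \<beta> :: real
  assume \<mu>: "\<mu> \<in> invariant_measures f" and U: "\<mu> \<in> weak_star_topology f interior_of U"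
    and h: "0 < h" "ereal h < metric_entropy \<mu> f" and \<epsilon>: "0 < \<epsilon>" and \<beta>: "0 < \<beta>"
  have mp: "measure_preserving_map \<mu> f" by (rule invariant_measures_imp_measure_preserving[OF \<mu> contf])
  have s: "sets \<mu> = sets borel" using \<mu> by (simp add: invariant_measures_def)
  have int: "integrable \<nu> \<phi>" if \<nu>: "\<nu> \<in> invariant_measures f" and \<phi>: "continuous_on UNIV \<phi>" for \<nu> and \<phi> :: "'a \<Rightarrow> real"
  proof -
    have sn: "sets \<nu> = sets borel" and pn: "prob_space \<nu>" using \<nu> by (auto simp: invariant_measures_def)
    interpret prob_space \<nu> by (rule pn)
    obtain B where B: "\<And>x. \<bar>\<phi> x\<bar> \<le> B"
      using compact_imp_bounded[OF compact_continuous_image[OF \<phi> cpt]] by (auto simp: bounded_iff)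
    have "\<phi> \<in> borel_measurable \<nu>"
      using borel_measurable_continuous_onI[OF \<phi>] by (subst measurable_cong_sets[OF sn refl])
    then show ?thesis using B by (intro integrable_const_bound[of _ B]) auto
  qed
  obtain F\<^sub>0 and \<eta> :: real where F0: "finite F\<^sub>0" "\<And>\<phi>. \<phi> \<in> F\<^sub>0 \<Longrightarrow> continuous_on UNIV (\<phi> :: 'a \<Rightarrow> real)" and \<eta>: "0 < \<eta>"
    and nbhd: "\<And>\<nu>. \<nu> \<in> invariant_measures f \<Longrightarrow> (\<And>\<phi>. \<phi> \<in> F\<^sub>0 \<Longrightarrow> \<bar>(\<integral>x. \<phi> x \<partial>\<nu>) - (\<integral>x. \<phi> x \<partial>\<mu>)\<bar> < \<eta>) \<Longrightarrow> \<nu> \<in> U"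
  proof (rule weak_star_neighbourhood[OF U])
    fix F and \<eta> :: real
    assume "finite F" "\<And>\<phi>. \<phi> \<in> F \<Longrightarrow> continuous_on UNIV (\<phi> :: 'a \<Rightarrow> real)" "0 < \<eta>"
      "\<And>\<nu>. \<nu> \<in> invariant_measures f \<Longrightarrow> (\<And>\<phi>. \<phi> \<in> F \<Longrightarrow> \<bar>(\<integral>x. \<phi> x \<partial>\<nu>) - (\<integral>x. \<phi> x \<partial>\<mu>)\<bar> < \<eta>) \<Longrightarrow> \<nu> \<in> U"
    then show thesis by (rule that)
  qed
  \<comment> \<open>For functions of \<mu>-mean 0, closeness of integrals becomes smallness of
    integrals, and gap times enter orbit sums only as errors.\<close>
  define centre where "centre \<phi> = (\<lambda>x. \<phi> x - (\<integral>x. \<phi> x \<partial>\<mu>))" for \<phi> :: "'a \<Rightarrow> real"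
  define F where "F = centre ` F\<^sub>0"
  have fF: "finite F" using F0 by (simp add: F_def)
  have cF: "continuous_on UNIV \<phi>" if "\<phi> \<in> F" for \<phi>
    using that F0(2) by (auto simp: F_def centre_def intro!: continuous_intros)
  have centre_int: "(\<integral>x. centre \<phi> x \<partial>\<nu>) = (\<integral>x. \<phi> x \<partial>\<nu>) - (\<integral>x. \<phi> x \<partial>\<mu>)"
    if "\<nu> \<in> invariant_measures f" "\<phi> \<in> F\<^sub>0" for \<nu> \<phi>
  proof -
    interpret prob_space \<nu> using that(1) by (simp add: invariant_measures_def)
    show ?thesis using int[OF that(1) F0(2)[OF that(2)]] prob_space by (simp add: centre_def)
  qed
  have F_mean: "(\<integral>x. \<phi> x \<partial>\<mu>) = 0" if "\<phi> \<in> F" for \<phi>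
    using that centre_int[OF \<mu>] by (auto simp: F_def)
  obtain B where B0: "0 \<le> B" and B: "\<And>\<phi> x. \<phi> \<in> F \<Longrightarrow> \<bar>\<phi> x\<bar> \<le> B"
    using finite_continuous_family_bound[OF cpt fF cF] by metis
  obtain P h' where P: "finite P" "P \<subseteq> sets \<mu>" "partition_on UNIV P" and hh': "h < h'"
    and ev: "\<forall>\<^sub>F n in sequentially. h' * real n < partition_entropy \<mu> (dynamical_join f P n)"
    by (rule measure_preserving_map.metric_entropy_gt_obtain[OF mp h(2)])
  \<comment> \<open>The room for all losses: \<open>h + a\<close> stays within the available entropy
    \<open>h'\<close> and within the tolerance \<open>h + \<beta>\<close>.\<close>
  define a where "a = min (h' - h) \<beta>"
  have a: "0 < a" "a \<le> \<beta>" "h + a \<le> h'" using hh' \<beta> by (auto simp: a_def)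
  have a4: "0 < a / 4" and a16: "0 < a / 16" and \<eta>8: "0 < \<eta> / 8" using a \<eta> by auto
  obtain \<zeta> \<gamma>\<^sub>0 :: real where \<zeta>: "0 < \<zeta>" and \<gamma>\<^sub>0: "0 < \<gamma>\<^sub>0" and words:
    "\<forall>\<^sub>F n in sequentially. \<exists>N W. 0 < N \<and> finite W \<and> W \<noteq> {} \<and> n * N * (h' - a / 4) \<le> ln (real (card W)) \<and>
     (\<forall>w\<in>W. \<forall>\<phi>\<in>F. \<bar>\<Sum>j<N. \<Sum>i<n. \<phi> ((f ^^ i) (w j))\<bar> \<le> n * N * (\<eta> / 8)) \<and>
     (\<forall>w\<in>W. \<forall>w'\<in>W. w \<noteq> w' \<longrightarrow> (\<exists>j<N. \<zeta> * n \<le> card {i\<in>{..<n}. \<gamma>\<^sub>0 < dist ((f ^^ i) (w j)) ((f ^^ i) (w' j))}))"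
  proof (rule block_word_selection[where F = F and B = B and h = h' and \<tau> = "a / 4" and \<eta> = "\<eta> / 8", OF mp s cpt P ev fF])
    show "integrable \<mu> \<phi>" if "\<phi> \<in> F" for \<phi> by (rule int[OF \<mu> cF[OF that]])
    show "\<bar>\<phi> x\<bar> \<le> B" if "\<phi> \<in> F" for \<phi> x by (rule B[OF that])
  qed (use F_mean a4 \<eta>8 in auto)
  define \<gamma> where "\<gamma> = \<epsilon> / 2"
  have \<gamma>: "0 < \<gamma>" "\<gamma> < \<epsilon>" using \<epsilon> by (auto simp: \<gamma>_def)
  \<comment> \<open>Coding at scale \<open>\<gamma>\<close> requires
    \<open>2 * e \<le> \<gamma>\<close>, and
    \<open>2 * e + \<gamma>\<^sub>0 / 2 \<le> \<gamma>\<^sub>0\<close> keeps tracers of different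
    words \<open>\<gamma>\<^sub>0 / 2\<close> apart.\<close>
  have "0 < min (\<gamma> / 2) (\<gamma>\<^sub>0 / 4)" using \<gamma> \<gamma>\<^sub>0 by simp
  then obtain e where e: "0 < e" "e < min (\<gamma> / 2) (\<gamma>\<^sub>0 / 4)"
    and modulus: "\<And>\<phi> x y. \<phi> \<in> F \<Longrightarrow> dist x y \<le> e \<Longrightarrow> \<bar>\<phi> x - \<phi> y\<bar> \<le> \<eta> / 8"
    using finite_continuous_family_modulus[OF cpt fF cF \<eta>8] by metis
  obtain D :: "'a set" and \<iota> :: "'a \<Rightarrow> 'a" where D: "finite D" "\<And>x. \<iota> x \<in> D" "\<And>x y. \<iota> x = \<iota> y \<Longrightarrow> dist x y \<le> \<gamma>"
    using compact_finite_small_cover[OF cpt \<gamma>(1)] by metis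
  have fD: "finite (insert None (Some ` D))" using D(1) by simp
  obtain \<rho> :: real where \<rho>: "0 < \<rho>" and ball: "\<And>(I :: nat set) u. finite I \<Longrightarrow> (\<And>i. i \<in> I \<Longrightarrow> u i \<in> insert None (Some ` D)) \<Longrightarrow>
       real (card {v \<in> PiE I (\<lambda>_. insert None (Some ` D)). real (card {i\<in>I. v i \<noteq> u i}) \<le> \<rho> * card I}) \<le> exp (a / 16 * card I)"
  proof (rule hamming_ball_card_exp[OF fD a16, where 'i = nat])
    fix \<rho> :: real
    assume "0 < \<rho>" "\<And>(I :: nat set) u. finite I \<Longrightarrow> (\<And>i. i \<in> I \<Longrightarrow> u i \<in> insert None (Some ` D)) \<Longrightarrow>
       real (card {v \<in> PiE I (\<lambda>_. insert None (Some ` D)). real (card {i\<in>I. v i \<noteq> u i}) \<le> \<rho> * card I}) \<le> exp (a / 16 * card I)"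
    then show thesis by (rule that)
  qed
  \<comment> \<open>Chosen to make \<open>B * d\<close> negligible against \<open>\<eta>\<close>;
    the summand 1 avoids division by 0.\<close>
  define d where "d = \<eta> / (32 * (B + 1))"
  have d: "0 < d" "B * d \<le> \<eta> / 32" using \<eta> B0 by (auto simp: d_def field_simps)
  \<comment> \<open>The bound 1 comes from \<open>block_words\<close>, \<open>\<rho> / 2\<close>
    limits the bad times, \<open>a / (16 * h)\<close> the entropy lost to stretched time, and
    \<open>d\<close> the shift of averages. In \<open>\<delta>\<^sub>2\<close> the bound
    \<open>\<zeta> / 2\<close> protects the separation of words.\<close>
  define \<delta>\<^sub>1 where "\<delta>\<^sub>1 = min (min 1 (\<rho> / 2)) (min (a / (16 * h)) d)"
  define \<delta>\<^sub>2 where "\<delta>\<^sub>2 = min (min (\<zeta> / 2) (\<rho> / 2)) d"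
  have step1: "0 < \<delta>\<^sub>1" "\<delta>\<^sub>1 \<le> 1" "\<delta>\<^sub>1 \<le> \<rho> / 2" "\<delta>\<^sub>1 \<le> a / (16 * h)" "\<delta>\<^sub>1 \<le> d"
    using \<rho> a h d by (auto simp: \<delta>\<^sub>1_def)
  have step2: "0 < \<delta>\<^sub>2" "2 * \<delta>\<^sub>2 \<le> \<zeta>" "\<delta>\<^sub>2 \<le> \<rho> / 2" "\<delta>\<^sub>2 \<le> d" using \<rho> \<zeta> d by (auto simp: \<delta>\<^sub>2_def)
  have \<delta>\<rho>: "\<delta>\<^sub>1 + \<delta>\<^sub>2 \<le> \<rho>" using step1(3) step2(3) by linarith
  have B\<delta>: "B * \<delta>\<^sub>1 \<le> \<eta> / 32" "B * \<delta>\<^sub>2 \<le> \<eta> / 32"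
    using mult_left_mono[OF step1(5) B0] mult_left_mono[OF step2(4) B0] d(2) by linarith+
  obtain m where "\<forall>n. m < real n \<longrightarrow> (\<forall>x :: nat \<Rightarrow> 'a. \<exists>t z. spaced n \<delta>\<^sub>1 t \<and> traced f n \<delta>\<^sub>1 \<delta>\<^sub>2 t e x z)"
    using assms(3) step1(1) step2(1) e(1) unfolding approximate_product_property_def by meson
  then have tracing: "\<exists>t z. traced f n \<delta>\<^sub>1 \<delta>\<^sub>2 t e x z" if "m < real n" for n and x :: "nat \<Rightarrow> 'a"
    using that by blast
  \<comment> \<open>\<open>n\<close> has to pass the threshold for tracing and to make four costs
    small: rounding of times, the factor 2 in thinning the words, the entropy of the increments, and
    whatever word selection requires.\<close>
  have big: "\<forall>\<^sub>F n in sequentially. c < real n" for c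
    using eventually_compose_filterlim[OF eventually_gt_at_top filterlim_real_sequentially] .
  have "\<forall>\<^sub>F n in sequentially. ln (real n) / real n < a / 16" by (rule order_tendstoD(2)[OF lim_ln_over_n a16])
  with words big[of m] big[of "1 / \<delta>\<^sub>1"] big[of "ln 2 / (a / 4)"] big[of 0]
  have "\<forall>\<^sub>F n in sequentially. (\<exists>N W. 0 < N \<and> finite W \<and> W \<noteq> {} \<and> n * N * (h' - a / 4) \<le> ln (real (card W)) \<and>
     (\<forall>w\<in>W. \<forall>\<phi>\<in>F. \<bar>\<Sum>j<N. \<Sum>i<n. \<phi> ((f ^^ i) (w j))\<bar> \<le> n * N * (\<eta> / 8)) \<and>
     (\<forall>w\<in>W. \<forall>w'\<in>W. w \<noteq> w' \<longrightarrow> (\<exists>j<N. \<zeta> * n \<le> card {i\<in>{..<n}. \<gamma>\<^sub>0 < dist ((f ^^ i) (w j)) ((f ^^ i) (w' j))})))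
     \<and> (m < real n \<and> 1 / \<delta>\<^sub>1 < real n \<and> ln 2 / (a / 4) < real n \<and> 0 < real n \<and> ln (real n) / real n < a / 16)"
    by eventually_elim simp
  from eventually_happens'[OF sequentially_bot this]
  obtain n N :: nat and W where N: "0 < N" and W: "finite W" "W \<noteq> {}" "n * N * (h' - a / 4) \<le> ln (real (card W))"
    and Wsum: "\<forall>w\<in>W. \<forall>\<phi>\<in>F. \<bar>\<Sum>j<N. \<Sum>i<n. \<phi> ((f ^^ i) (w j))\<bar> \<le> n * N * (\<eta> / 8)"
    and Wsep: "\<forall>w\<in>W. \<forall>w'\<in>W. w \<noteq> w' \<longrightarrow> (\<exists>j<N. \<zeta> * n \<le> card {i\<in>{..<n}. \<gamma>\<^sub>0 < dist ((f ^^ i) (w j)) ((f ^^ i) (w' j))})"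
    and n': "m < real n" "1 / \<delta>\<^sub>1 < real n" "ln 2 / (a / 4) < real n" "0 < real n" "ln (real n) / real n < a / 16"
    by (elim exE conjE) (rule that)
  have n: "0 < n" using n'(4) by simp
  have n\<delta>: "1 \<le> n * \<delta>\<^sub>1" using n'(2) step1(1) by (simp add: field_simps)
  have nN: "real n \<le> real (n * N)" using N by (simp only: of_nat_le_iff) simp
  \<comment> \<open>As \<open>h + a \<le> h'\<close>, the rate of \<open>W\<close> is at least
    \<open>h + 3 * a / 4\<close>, but it may be far larger. It is thinned to a rate between
    \<open>h + a / 2\<close>, which survives the losses of the lower bound, and
    \<open>h + 3 * a / 4\<close>, which leaves room for the upper bound.\<close>
  have "exp (n * N * (h + 3 * a / 4)) \<le> real (card W)"
  proof -
    have "n * N * (h + 3 * a / 4) \<le> n * N * (h' - a / 4)" using a(3) by (intro mult_left_mono) auto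
    then have "exp (n * N * (h + 3 * a / 4)) \<le> exp (ln (real (card W)))" using W(3) by simp
    also have "\<dots> = real (card W)" using W(1,2) by (simp add: card_gt_0_iff)
    finally show ?thesis .
  qed
  moreover have "n * N * (h + a / 2) + ln 2 \<le> n * N * (h + 3 * a / 4)"
  proof -
    have "ln 2 \<le> n * (a / 4)" using n'(3) a4 by (simp add: field_simps)
    also have "\<dots> \<le> real (n * N) * (a / 4)" using nN a4 by (intro mult_right_mono) auto
    finally show ?thesis by (simp add: algebra_simps)
  qed
  moreover have "0 \<le> n * N * (h + a / 2)" using h a by simp
  ultimately obtain V where V: "V \<subseteq> W" "V \<noteq> {}" "n * N * (h + a / 2) \<le> ln (real (card V))" "ln (real (card V)) \<le> n * N * (h + 3 * a / 4)"
    by (rule subset_with_prescribed_exponential_card[OF W(1)])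
  interpret block_words f n N \<delta>\<^sub>1 \<delta>\<^sub>2 e V
    using n N step1 step2 V W cpt contf by unfold_locales (auto intro: finite_subset)
  have "entropy_at_scale tracking_set f \<gamma> \<le> ereal ((h + 3 * a / 4) + ln n / n + a / 16)"
  proof (rule entropy_at_scale_tracking_set_le[where \<iota> = \<iota> and \<rho> = \<rho>, OF D])
    show "real (card {v \<in> PiE I (\<lambda>_. insert None (Some ` D)). real (card {i\<in>I. v i \<noteq> u i}) \<le> \<rho> * card I}) \<le> exp (a / 16 * card I)"
      if "finite I" "\<And>i. i \<in> I \<Longrightarrow> u i \<in> insert None (Some ` D)" for I :: "nat set" and u by (rule ball[OF that])
  qed (use \<gamma> e \<delta>\<rho> a16 V h a in auto)
  \<comment> \<open>Increments and bad times cost at most \<open>a / 16\<close> each, so the total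
    stays below \<open>h + a\<close>.\<close>
  also have "\<dots> < ereal (h + \<beta>)" unfolding less_ereal.simps using n'(5) a by linarith
  finally have upper: "entropy_at_scale tracking_set f \<gamma> < ereal (h + \<beta>)" .
  \<comment> \<open>The lower bound lives at the scale \<open>\<gamma>\<^sub>0 / 2\<close>, which is
    unrelated to \<open>\<gamma>\<close>; the topological entropy dominates every scale.\<close>
  have "ereal (((h + a / 2) - ln n / n) / (1 + 2 * \<delta>\<^sub>1)) \<le> entropy_at_scale tracking_set f (\<gamma>\<^sub>0 / 2)"
  proof (rule entropy_at_scale_tracking_set_ge[where \<zeta> = \<zeta> and \<gamma>\<^sub>0 = \<gamma>\<^sub>0])
    show "\<exists>t z. traced f n \<delta>\<^sub>1 \<delta>\<^sub>2 t e x z" for x by (rule tracing[OF n'(1)])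
    show "\<exists>j<N. \<zeta> * n \<le> card {i\<in>{..<n}. \<gamma>\<^sub>0 < dist ((f ^^ i) (w j)) ((f ^^ i) (w' j))}"
      if "w \<in> V" "w' \<in> V" "w \<noteq> w'" for w w' using Wsep V(1) that by blast
    show "2 * \<delta>\<^sub>2 \<le> \<zeta>" by (rule step2(2))
    show "ln n / n \<le> h + a / 2" using n'(5) h a by linarith
  qed (use e \<gamma>\<^sub>0 V n\<delta> in auto)
  also have "\<dots> \<le> topological_entropy tracking_set f"
    using \<gamma>\<^sub>0 by (intro entropy_at_scale_le_topological_entropy[OF cpt]) simp
  finally have "ereal (((h + a / 2) - ln n / n) / (1 + 2 * \<delta>\<^sub>1)) \<le> topological_entropy tracking_set f" .
  \<comment> \<open>Stretched time costs at most \<open>2 * h * \<delta>\<^sub>1 \<le> a / 8\<close>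
    and the increments less than \<open>a / 16\<close>, together less than
    \<open>a / 2\<close>.\<close>
  moreover have "h < ((h + a / 2) - ln n / n) / (1 + 2 * \<delta>\<^sub>1)"
  proof -
    have "h * \<delta>\<^sub>1 \<le> a / 16" using mult_left_mono[OF step1(4), of h] h by simp
    then have "h + 2 * (h * \<delta>\<^sub>1) < (h + a / 2) - ln n / n" using n'(5) a by linarith
    then have "h * (1 + 2 * \<delta>\<^sub>1) < (h + a / 2) - ln n / n" by (simp add: distrib_left mult.left_commute)
    then show ?thesis using step1(1) by (simp add: pos_less_divide_eq)
  qed
  ultimately have lower: "ereal h < topological_entropy tracking_set f"
    using less_le_trans ereal_less(2) by (metis less_ereal.simps(1))
  have "invariant_measures_on tracking_set f \<subseteq> U"
  proof
    fix \<nu> assume \<nu>: "\<nu> \<in> invariant_measures_on tracking_set f"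
    then have \<nu>': "\<nu> \<in> invariant_measures f"
      using invariant_measures_on_eq[OF contf closed_tracking_set tracking_set_invariant] by simp
    show "\<nu> \<in> U"
    proof (rule nbhd[OF \<nu>'])
      fix \<phi> assume \<phi>: "\<phi> \<in> F\<^sub>0"
      then have cF': "centre \<phi> \<in> F" by (simp add: F_def)
      have "\<bar>\<integral>x. centre \<phi> x \<partial>\<nu>\<bar> \<le> \<eta> / 8 + \<eta> / 8 + 2 * B * \<delta>\<^sub>2 + B * \<delta>\<^sub>1"
      proof (rule invariant_measure_on_tracking_set[OF \<nu> cF[OF cF']])
        show "\<bar>centre \<phi> y\<bar> \<le> B" for y by (rule B[OF cF'])
        show "\<bar>centre \<phi> y - centre \<phi> y'\<bar> \<le> \<eta> / 8" if "dist y y' \<le> e" for y y' by (rule modulus[OF cF' that])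
        show "\<bar>\<Sum>j<N. \<Sum>i<n. centre \<phi> ((f ^^ i) (w j))\<bar> \<le> n * N * (\<eta> / 8)" if "w \<in> V" for w
          using Wsum V(1) that cF' by blast
      qed (use \<eta> in auto)
      \<comment> \<open>The total is at most \<open>11 * \<eta> / 32\<close>.\<close>
      also have "\<dots> < \<eta>" using B\<delta> \<eta> by linarith
      finally show "\<bar>(\<integral>x. \<phi> x \<partial>\<nu>) - (\<integral>x. \<phi> x \<partial>\<mu>)\<bar> < \<eta>" by (simp add: centre_int[OF \<nu>' \<phi>])
    qed
  qed
  then show "\<exists>\<Lambda> \<gamma>. compact \<Lambda> \<and> f ` \<Lambda> \<subseteq> \<Lambda> \<and> 0 < \<gamma> \<and> \<gamma> < \<epsilon> \<and> invariant_measures_on \<Lambda> f \<subseteq> U \<and>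
      topological_entropy \<Lambda> f > ereal h \<and> entropy_at_scale \<Lambda> f \<gamma> < ereal (h + \<beta>)"
    by (intro exI[of _ tracking_set] exI[of _ \<gamma>] conjI compact_tracking_set tracking_set_invariant \<gamma> upper lower)
qed

end
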